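(* Let $\mathfrak g$ be a compact semi-simple Lie algebra, the Lie algebra of a compact connected semi-simple Lie group $G$. The distribution $\mathcal N$ on the manifold $\mathfrak g^*_{reg}$ is integrable. Furthermore, via the identification of $\mathfrak g^*$ with $\mathfrak g$ by the Killing form, for every maximal torus $T\subset G$ with Lie algebra $\mathfrak t$, each connected component (Weyl chamber) of the set of regular elements of $\mathfrak t$ is a maximal integral surface of the distribution $\mathcal N$ at each of its points $x$.
   Context: $\mathfrak g^*$ carries the linear Lie–Poisson structure: if $\{e_\mu\}$ is a basis of $\mathfrak g$ with $[e_\mu,e_\nu]=c^\sigma_{\mu\nu}e_\sigma$ and $\lambda_\nu=\langle\lambda,e_\nu\rangle$ are the corresponding linear coordinates on $\mathfrak g^*$, then $P^{\mu\nu}(\lambda)=\{\lambda_\mu,\lambda_\nu\}=c^\sigma_{\mu\nu}\lambda_\sigma$. Its symplectic leaves are the co-adjoint orbits of $G$. The Killing form $K(x,y)=\operatorname{Tr}(\operatorname{ad}(x)\circ\operatorname{ad}(y))$ is negative definite, so $-K$ is an invariant inner product on $\mathfrak g$; viewing $T^*_\lambda(\mathfrak g^* )\simeq\mathfrak g$, it defines a constant Riemannian metric on $\mathfrak g^*$ with contravariant components $g^{\mu\nu}=-K_{\mu\nu}$. $\mathfrak g^*_{reg}$ is the set of regular points, i.e. those lying on co-adjoint orbits of maximal dimension; under the identification $\mathfrak g^*\simeq\mathfrak g$ given by the Killing form (which carries co-adjoint orbits to adjoint orbits) a point $x\in\mathfrak g$ is regular iff it lies in a unique Lie algebra $\mathfrak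 t$ of a maximal torus. $\mathcal N$ is the distribution on $\mathfrak g^*_{reg}$ orthogonal, with respect to this metric, to the tangent spaces of the symplectic leaves. A distribution is integrable iff it is involutive (Frobenius). *)

theory Defs
  imports "HOL-Analysis.Analysis" "HOL-Algebra.Group"
begin

section \<open>Smooth maps, manifolds and Lie groups\<close>

text \<open>Meant for open \<open>S\<close> and finite-dimensional \<open>'a\<close>, where continuity of all iterated
  directional derivatives is the usual notion of being of class \<open>C\<^sup>k\<close>.\<close>

primrec Ck_on :: "nat \<Rightarrow> 'a::real_normed_vector set \<Rightarrow> ('a \<Rightarrow> 'b::real_normed_vector) \<Rightarrow> bool" where
  "Ck_on 0 S f \<longleftrightarrow> continuous_on S f"
| "Ck_on (Suc k) S f \<longleftrightarrow>
     (\<exists>f'. (\<forall>x\<in>S. (f has_derivative f' x) (at x)) \<and> (\<forall>v. Ck_on k S (\<lambda>x. f' x v)))"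

definition smooth_on :: "'a::real_normed_vector set \<Rightarrow> ('a \<Rightarrow> 'b::real_normed_vector) \<Rightarrow> bool" where
  "smooth_on S f \<longleftrightarrow> (\<forall>k. Ck_on k S f)"

text \<open>A chart is a pair of its domain and its coordinate map; \<open>inv_into U \<phi>\<close> is the
  local parametrisation inverse to \<open>(U, \<phi>)\<close>.\<close>

definition is_chart :: "'g topology \<Rightarrow> 'g set \<Rightarrow> ('g \<Rightarrow> 'm::euclidean_space) \<Rightarrow> bool" where
  "is_chart X U \<phi> \<longleftrightarrow> openin X U \<and> open (\<phi> ` U) \<and>
     homeomorphic_map (subtopology X U) (top_of_set (\<phi> ` U)) \<phi>"

definition smooth_manifold ::
    "'g topology \<Rightarrow> ('g set \<times> ('g \<Rightarrow> 'm::euclidean_space)) set \<Rightarrow> bool" where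
  "smooth_manifold X A \<longleftrightarrow>
     Hausdorff_space X \<and> second_countable X \<and>
     (\<forall>(U, \<phi>) \<in> A. is_chart X U \<phi>) \<and> (\<Union>(U, \<phi>) \<in> A. U) = topspace X \<and>
     (\<forall>(U, \<phi>) \<in> A. \<forall>(V, \<psi>) \<in> A. smooth_on (\<phi> ` (U \<inter> V)) (\<psi> \<circ> inv_into U \<phi>))"

definition smooth_map ::
    "'g topology \<Rightarrow> ('g set \<times> ('g \<Rightarrow> 'm::euclidean_space)) set \<Rightarrow>
     'h topology \<Rightarrow> ('h set \<times> ('h \<Rightarrow> 'n::euclidean_space)) set \<Rightarrow> ('g \<Rightarrow> 'h) \<Rightarrow> bool" where
  "smooth_map X A Y B f \<longleftrightarrow> continuous_map X Y f \<and>
     (\<forall>(U, \<phi>) \<in> A. \<forall>(V, \<psi>) \<in> B.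
        smooth_on (\<phi> ` {x \<in> U. f x \<in> V}) (\<psi> \<circ> f \<circ> inv_into U \<phi>))"

definition prod_atlas ::
    "('g set \<times> ('g \<Rightarrow> 'm)) set \<Rightarrow> ('h set \<times> ('h \<Rightarrow> 'n)) set \<Rightarrow>
     (('g \<times> 'h) set \<times> ('g \<times> 'h \<Rightarrow> 'm \<times> 'n)) set" where
  "prod_atlas A B = {(U \<times> V, map_prod \<phi> \<psi>) | U \<phi> V \<psi>. (U, \<phi>) \<in> A \<and> (V, \<psi>) \<in> B}"

definition lie_group ::
    "('g, 'b) monoid_scheme \<Rightarrow> 'g topology \<Rightarrow> ('g set \<times> ('g \<Rightarrow> 'm::euclidean_space)) set \<Rightarrow> bool" where
  "lie_group G X A \<longleftrightarrow>
     group G \<and> topspace X = carrier G \<and> smooth_manifold X A \<and>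
     smooth_map (prod_topology X X) (prod_atlas A A) X A (\<lambda>(a, b). a \<otimes>\<^bsub>G\<^esub> b) \<and>
     smooth_map X A X A (\<lambda>a. inv\<^bsub>G\<^esub> a)"

section \<open>The Lie algebra of a Lie group\<close>

text \<open>Throughout, \<open>(U, \<phi>)\<close> is a chart around the identity. Its differential identifies the
  tangent space at the identity with the model space \<open>'m\<close>, which thereby becomes the Lie algebra.
  \<open>Ad g\<close> is the differential at the identity of conjugation by \<open>g\<close>, and
  \<open>x \<mapsto> [x, \<cdot>]\<close> is the differential at the identity of \<open>Ad\<close>.\<close>

definition Ad ::
    "('g, 'b) monoid_scheme \<Rightarrow> 'g set \<Rightarrow> ('g \<Rightarrow> 'm::euclidean_space) \<Rightarrow> 'g \<Rightarrow> 'm \<Rightarrow> 'm" where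
  "Ad G U \<phi> g =
     frechet_derivative (\<lambda>p. \<phi> (g \<otimes>\<^bsub>G\<^esub> inv_into U \<phi> p \<otimes>\<^bsub>G\<^esub> inv\<^bsub>G\<^esub> g)) (at (\<phi> \<one>\<^bsub>G\<^esub>))"

definition lie_bracket ::
    "('g, 'b) monoid_scheme \<Rightarrow> 'g set \<Rightarrow> ('g \<Rightarrow> 'm::euclidean_space) \<Rightarrow> 'm \<Rightarrow> 'm \<Rightarrow> 'm" where
  "lie_bracket G U \<phi> x y =
     frechet_derivative (\<lambda>p. Ad G U \<phi> (inv_into U \<phi> p) y) (at (\<phi> \<one>\<^bsub>G\<^esub>)) x"

definition semisimple_bracket :: "('m::real_vector \<Rightarrow> 'm \<Rightarrow> 'm) \<Rightarrow> bool" where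
  "semisimple_bracket br \<longleftrightarrow>
     (\<forall>I. subspace I \<and> (\<forall>x. \<forall>y\<in>I. br x y \<in> I) \<and> (\<forall>x\<in>I. \<forall>y\<in>I. br x y = 0) \<longrightarrow> I = {0})"

text \<open>The Lie algebra of a closed subgroup \<open>T\<close>: initial velocities of the one-parameter
  subgroups contained in \<open>T\<close>.\<close>

definition subgroup_lie_algebra ::
    "('g, 'b) monoid_scheme \<Rightarrow> 'g topology \<Rightarrow> ('g \<Rightarrow> 'm::euclidean_space) \<Rightarrow> 'g set \<Rightarrow> 'm set" where
  "subgroup_lie_algebra G X \<phi> T =
     {x. \<exists>\<gamma> :: real \<Rightarrow> 'g. continuous_map euclideanreal X \<gamma> \<and>
          (\<forall>s t. \<gamma> (s + t) = \<gamma> s \<otimes>\<^bsub>G\<^esub> \<gamma> t) \<and> (\<forall>t. \<gamma> t \<in> T) \<and>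
          ((\<phi> \<circ> \<gamma>) has_vector_derivative x) (at 0)}"

definition torus_in :: "('g, 'b) monoid_scheme \<Rightarrow> 'g topology \<Rightarrow> 'g set \<Rightarrow> bool" where
  "torus_in G X T \<longleftrightarrow> subgroup T G \<and> compactin X T \<and> connectedin X T \<and>
     (\<forall>a\<in>T. \<forall>b\<in>T. a \<otimes>\<^bsub>G\<^esub> b = b \<otimes>\<^bsub>G\<^esub> a)"

definition maximal_torus :: "('g, 'b) monoid_scheme \<Rightarrow> 'g topology \<Rightarrow> 'g set \<Rightarrow> bool" where
  "maximal_torus G X T \<longleftrightarrow> torus_in G X T \<and> (\<forall>T'. torus_in G X T' \<and> T \<subseteq> T' \<longrightarrow> T' = T)"

definition linear_trace :: "('m::euclidean_space \<Rightarrow> 'm) \<Rightarrow> real" where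
  "linear_trace f = (\<Sum>b\<in>Basis. f b \<bullet> b)"

definition killing_form ::
    "('g, 'b) monoid_scheme \<Rightarrow> 'g set \<Rightarrow> ('g \<Rightarrow> 'm::euclidean_space) \<Rightarrow> 'm \<Rightarrow> 'm \<Rightarrow> real" where
  "killing_form G U \<phi> x y = linear_trace (lie_bracket G U \<phi> x \<circ> lie_bracket G U \<phi> y)"

text \<open>The identification of the Lie algebra with its dual by the Killing form.\<close>

definition killing_dual ::
    "('g, 'b) monoid_scheme \<Rightarrow> 'g set \<Rightarrow> ('g \<Rightarrow> 'm::euclidean_space) \<Rightarrow> 'm \<Rightarrow> 'm \<Rightarrow>\<^sub>L real" where
  "killing_dual G U \<phi> x = Blinfun (killing_form G U \<phi> x)"

section \<open>Submanifolds and distributions of a normed space\<close>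

definition submanifold :: "'v::real_normed_vector set \<Rightarrow> bool" where
  "submanifold S \<longleftrightarrow>
     (\<forall>p\<in>S. \<exists>D E \<psi> \<psi>' V. open D \<and> p \<in> D \<and> open E \<and> homeomorphism D E \<psi> \<psi>' \<and>
        smooth_on D \<psi> \<and> smooth_on E \<psi>' \<and> subspace (V :: 'v set) \<and> \<psi> ` (D \<inter> S) = E \<inter> V)"

text \<open>For a submanifold this is its tangent space at \<open>p\<close>, as the space of velocities at \<open>p\<close>
  of curves in \<open>S\<close>.\<close>

definition tangent_space :: "'v::real_normed_vector set \<Rightarrow> 'v \<Rightarrow> 'v set" where
  "tangent_space S p =
     {v. \<exists>\<gamma> :: real \<Rightarrow> 'v. \<gamma> 0 = p \<and> (\<forall>t. \<gamma> t \<in> S) \<and> (\<gamma> has_vector_derivative v) (at 0)}"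

definition smooth_distribution ::
    "'v::real_normed_vector set \<Rightarrow> ('v \<Rightarrow> 'v set) \<Rightarrow> bool" where
  "smooth_distribution M N \<longleftrightarrow> open M \<and>
     (\<exists>k. \<forall>p\<in>M. \<exists>D Z. open D \<and> p \<in> D \<and> D \<subseteq> M \<and> (\<forall>i<k. smooth_on D (Z i)) \<and>
        (\<forall>q\<in>D. N q = span ((\<lambda>i. Z i q) ` {..<k}) \<and> dim (N q) = k))"

text \<open>An integral manifold is an immersed submanifold, given as a topology \<open>\<tau>\<close> on its set of
  points that may be finer than the induced one: every point has a \<open>\<tau>\<close>-neighbourhood
  that carries the induced topology and is an embedded submanifold tangent to \<open>N\<close>.\<close>

definition integral_manifold ::
    "'v::real_normed_vector set \<Rightarrow> ('v \<Rightarrow> 'v set) \<Rightarrow> 'v topology \<Rightarrow> bool" where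
  "integral_manifold M N \<tau> \<longleftrightarrow> topspace \<tau> \<subseteq> M \<and>
     (\<forall>p \<in> topspace \<tau>. \<exists>W. openin \<tau> W \<and> p \<in> W \<and> subtopology \<tau> W = top_of_set W \<and>
        submanifold W \<and> (\<forall>q\<in>W. tangent_space W q = N q))"

definition integrable_distribution ::
    "'v::real_normed_vector set \<Rightarrow> ('v \<Rightarrow> 'v set) \<Rightarrow> bool" where
  "integrable_distribution M N \<longleftrightarrow> smooth_distribution M N \<and>
     (\<forall>p\<in>M. \<exists>\<tau>. integral_manifold M N \<tau> \<and> p \<in> topspace \<tau>)"

definition maximal_integral_manifold_at ::
    "'v::real_normed_vector set \<Rightarrow> ('v \<Rightarrow> 'v set) \<Rightarrow> 'v topology \<Rightarrow> 'v \<Rightarrow> bool" where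
  "maximal_integral_manifold_at M N \<tau> p \<longleftrightarrow>
     integral_manifold M N \<tau> \<and> connected_space \<tau> \<and> p \<in> topspace \<tau> \<and>
     (\<forall>\<tau>'. integral_manifold M N \<tau>' \<and> connected_space \<tau>' \<and> p \<in> topspace \<tau>'
        \<longrightarrow> topspace \<tau>' \<subseteq> topspace \<tau>)"

section \<open>The co-adjoint representation\<close>

text \<open>The co-adjoint orbits are the symplectic leaves of the Lie--Poisson structure.\<close>

definition coadjoint_orbit ::
    "('g, 'b) monoid_scheme \<Rightarrow> 'g set \<Rightarrow> ('g \<Rightarrow> 'm::euclidean_space) \<Rightarrow>
     'm \<Rightarrow>\<^sub>L real \<Rightarrow> ('m \<Rightarrow>\<^sub>L real) set" where
  "coadjoint_orbit G U \<phi> \<xi> = (\<lambda>g. \<xi> o\<^sub>L Blinfun (Ad G U \<phi> (inv\<^bsub>G\<^esub> g))) ` carrier G"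

definition leaf_tangent ::
    "('g, 'b) monoid_scheme \<Rightarrow> 'g set \<Rightarrow> ('g \<Rightarrow> 'm::euclidean_space) \<Rightarrow>
     'm \<Rightarrow>\<^sub>L real \<Rightarrow> ('m \<Rightarrow>\<^sub>L real) set" where
  "leaf_tangent G U \<phi> \<xi> = tangent_space (coadjoint_orbit G U \<phi> \<xi>) \<xi>"

definition coadjoint_regular ::
    "('g, 'b) monoid_scheme \<Rightarrow> 'g set \<Rightarrow> ('g \<Rightarrow> 'm::euclidean_space) \<Rightarrow> ('m \<Rightarrow>\<^sub>L real) set" where
  "coadjoint_regular G U \<phi> =
     {\<xi>. \<forall>\<eta>. dim (leaf_tangent G U \<phi> \<eta>) \<le> dim (leaf_tangent G U \<phi> \<xi>)}"

text \<open>The constant metric on the dual whose contravariant form, on cotangent vectors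
  \<open>x, y\<close> (elements of the Lie algebra), is \<open>- K x y\<close>: on tangent vectors it is obtained
  by raising indices.\<close>

definition raise_index ::
    "('g, 'b) monoid_scheme \<Rightarrow> 'g set \<Rightarrow> ('g \<Rightarrow> 'm::euclidean_space) \<Rightarrow> 'm \<Rightarrow>\<^sub>L real \<Rightarrow> 'm" where
  "raise_index G U \<phi> \<alpha> = (THE x. \<forall>y. - killing_form G U \<phi> x y = blinfun_apply \<alpha> y)"

definition dual_metric ::
    "('g, 'b) monoid_scheme \<Rightarrow> 'g set \<Rightarrow> ('g \<Rightarrow> 'm::euclidean_space) \<Rightarrow>
     'm \<Rightarrow>\<^sub>L real \<Rightarrow> 'm \<Rightarrow>\<^sub>L real \<Rightarrow> real" where
  "dual_metric G U \<phi> \<alpha> \<beta> = - killing_form G U \<phi> (raise_index G U \<phi> \<alpha>) (raise_index G U \<phi> \<beta>)"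

definition normal_distribution ::
    "('g, 'b) monoid_scheme \<Rightarrow> 'g set \<Rightarrow> ('g \<Rightarrow> 'm::euclidean_space) \<Rightarrow>
     'm \<Rightarrow>\<^sub>L real \<Rightarrow> ('m \<Rightarrow>\<^sub>L real) set" where
  "normal_distribution G U \<phi> \<xi> = {v. \<forall>w \<in> leaf_tangent G U \<phi> \<xi>. dual_metric G U \<phi> v w = 0}"

text \<open>The regular elements of the Lie algebra of the subgroup \<open>T\<close>; for a maximal torus the
  connected components of this set are its Weyl chambers.\<close>

definition regular_part ::
    "('g, 'b) monoid_scheme \<Rightarrow> 'g topology \<Rightarrow> 'g set \<Rightarrow> ('g \<Rightarrow> 'm::euclidean_space) \<Rightarrow>
     'g set \<Rightarrow> 'm set" where
  "regular_part G X U \<phi> T =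
     {x \<in> subgroup_lie_algebra G X \<phi> T. killing_dual G U \<phi> x \<in> coadjoint_regular G U \<phi>}"

end

theory Submission
  imports Defs
begin

text \<open>Averaging the Euclidean inner product along a one-parameter subgroup makes \<open>ad x\<close> skew, so the
  Killing form \<open>K\<close> is negative definite. Identifying the dual with the Lie algebra by \<open>K\<close>, the tangent
  space of the orbit of \<open>x\<close> is the image of \<open>ad x\<close>, and the normal distribution at \<open>x\<close> is its orthogonal
  complement, the centraliser \<open>ker (ad x)\<close>. At a regular \<open>x\<close> the centraliser is abelian and has
  constant dimension, so it is also the centraliser of each of its regular points: its regular part is
  an integral manifold. A Gronwall estimate shows that the centraliser is constant along curves
  tangent to the distribution, which gives uniqueness and maximality. For regular \<open>x\<close> in the Lie
  algebra of a maximal torus \<open>T\<close>, commuting points of an orbit are isolated, so the connected group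
  \<open>T\<close> fixes the centraliser of \<open>x\<close> pointwise; one-parameter subgroups generated by the centraliser thus
  commute with \<open>T\<close>, and by maximality lie in \<open>T\<close>.\<close>

section \<open>Compact semisimple Lie algebras\<close>

text \<open>The bracket is given only as a derivative of \<open>Ad\<close> in one chart, so
  antisymmetry and the Jacobi identity have to be proved. Antisymmetry rests on [x, x] = 0, hence on
  one-parameter subgroups with every velocity. These come from compactness rather than from a
  differential equation: limits of powers along a nonprincipal ultrafilter exist for all times at
  once and respect products. The same kind of limit, applied to time averages, yields the invariant
  form. Tangent spaces consist of velocities of curves that are required to be differentiable at 0
  only. That the tangent space of an orbit is no larger than the image of ad x therefore needs a
  metric estimate on all orbit points near x; the same estimate isolates the commuting points of an
  orbit. A competing integral manifold may carry a topology finer than the induced one. Maximality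
  is therefore reached through a quantity, the centraliser, that is locally constant in that
  topology.\<close>

lemma linear_trace_comm:
  fixes f g :: "'a::euclidean_space \<Rightarrow> 'a"
  assumes "linear f" "linear g"
  shows "linear_trace (f \<circ> g) = linear_trace (g \<circ> f)"
proof -
  have *: "linear_trace (f \<circ> g) = (\<Sum>b\<in>Basis. \<Sum>c\<in>Basis. (g b \<bullet> c) * (f c \<bullet> b))"
    if "linear f" for f g :: "'a \<Rightarrow> 'a"
  proof -
    have "f (g b) \<bullet> b = (\<Sum>c\<in>Basis. (g b \<bullet> c) * (f c \<bullet> b))" for b
    proof -
      have "f (g b) = f (\<Sum>c\<in>Basis. (g b \<bullet> c) *\<^sub>R c)" by (simp add: euclidean_representation)
      also have "\<dots> = (\<Sum>c\<in>Basis. (g b \<bullet> c) *\<^sub>R f c)"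
        using that by (simp add: linear_sum linear_scale)
      finally show ?thesis by (simp add: inner_sum_left)
    qed
    then show ?thesis by (simp add: linear_trace_def)
  qed
  have "linear_trace (f \<circ> g) = (\<Sum>b\<in>Basis. \<Sum>c\<in>Basis. (g b \<bullet> c) * (f c \<bullet> b))"
    by (rule *[OF assms(1)])
  also have "\<dots> = (\<Sum>c\<in>Basis. \<Sum>b\<in>Basis. (f c \<bullet> b) * (g b \<bullet> c))"
    by (subst sum.swap) (simp add: mult.commute)
  also have "\<dots> = linear_trace (g \<circ> f)" by (rule *[OF assms(2), symmetric])
  finally show ?thesis .
qed

lemma linear_trace_add: "linear_trace (\<lambda>v. f v + g v) = linear_trace f + linear_trace g"
  by (simp add: linear_trace_def inner_add_left sum.distrib)

lemma linear_trace_diff: "linear_trace (\<lambda>v. f v - g v) = linear_trace f - linear_trace g"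
  by (simp add: linear_trace_def inner_diff_left sum_subtractf)

lemma linear_trace_scaleR: "linear_trace (\<lambda>v. c *\<^sub>R f v) = c * linear_trace f"
  by (simp add: linear_trace_def sum_distrib_left)

text \<open>The weight \<open>exp (- 2 * C * s)\<close> absorbs the growth that the bound on
  \<open>h'\<close> allows, so the weighted squared norm is nonincreasing; it is nonnegative and
  starts at 0.\<close>

lemma gronwall_zero:
  fixes h :: "real \<Rightarrow> 'a::real_inner"
  assumes der: "\<And>s. 0 \<le> s \<Longrightarrow> s \<le> b \<Longrightarrow> (h has_vector_derivative h' s) (at s)"
    and bd: "\<And>s. 0 \<le> s \<Longrightarrow> s \<le> b \<Longrightarrow> norm (h' s) \<le> C * norm (h s)"
    and "h 0 = 0" and s: "0 \<le> s" "s \<le> b"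
  shows "h s = 0"
proof -
  let ?g = "\<lambda>s. exp (- 2 * C * s) * (h s \<bullet> h s)"
  have "?g s \<le> ?g 0"
  proof (rule DERIV_nonpos_imp_nonincreasing[OF s(1)], intro exI conjI)
    fix t assume "0 \<le> t" "t \<le> s"
    then have t: "0 \<le> t" "t \<le> b" using s by auto
    let ?y = "exp (- 2 * C * t) * (2 * (h t \<bullet> h' t) - 2 * C * (h t \<bullet> h t))"
    have "((\<lambda>s. h s \<bullet> h s) has_vector_derivative (h t \<bullet> h' t + h' t \<bullet> h t)) (at t)"
      by (rule bounded_bilinear.has_vector_derivative[OF bounded_bilinear_inner der[OF t] der[OF t]])
    then have hh: "((\<lambda>s. h s \<bullet> h s) has_real_derivative (2 * (h t \<bullet> h' t))) (at t)"
      by (simp add: has_real_derivative_iff_has_vector_derivative inner_commute)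
    show "(?g has_real_derivative ?y) (at t)"
      by (rule derivative_eq_intros hh refl)+ (simp add: algebra_simps)
    have "h t \<bullet> h' t \<le> norm (h t) * norm (h' t)" by (rule norm_cauchy_schwarz)
    also have "\<dots> \<le> norm (h t) * (C * norm (h t))" using bd[OF t] by (intro mult_left_mono) auto
    also have "\<dots> = C * (h t \<bullet> h t)" by (simp add: power2_norm_eq_inner[symmetric] power2_eq_square)
    finally show "?y \<le> 0" by (simp add: mult_nonneg_nonpos)
  qed
  then have "h s \<bullet> h s \<le> 0" using \<open>h 0 = 0\<close> by (simp add: mult_le_0_iff)
  then show ?thesis using inner_ge_zero[of "h s"] by (simp add: antisym)
qed

text \<open>Negative definiteness of the trace form stands for compactness and semisimplicity
  together. No group is left inside this locale: it is linear algebra plus one estimate along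
  curves.\<close>

locale compact_lie_algebra =
  fixes br :: "'m::euclidean_space \<Rightarrow> 'm \<Rightarrow> 'm"
  assumes bil: "bilinear br"
    and anti: "br x y = - br y x"
    and jacobi: "br x (br y z) = br (br x y) z + br y (br x z)"
    and trace_neg: "x \<noteq> 0 \<Longrightarrow> linear_trace (br x \<circ> br x) < 0"
begin

definition B :: "'m \<Rightarrow> 'm \<Rightarrow> real" where "B x y = - linear_trace (br x \<circ> br y)"
definition cent :: "'m \<Rightarrow> 'm set" where "cent x = {y. br x y = 0}"
text \<open>Maximal rank of ad will match maximal dimension of the coadjoint leaf, since the leaf
  tangent at the dual of x turns out to be the dual of \<open>range (br x)\<close>.\<close>

definition reg :: "'m set" where "reg = {x. \<forall>y. dim (range (br y)) \<le> dim (range (br x))}"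

lemma lin: "linear (br x)" using bil by (simp add: bilinear_def)

lemmas br_simps = bilinear_ladd[OF bil] bilinear_radd[OF bil] bilinear_lmul[OF bil]
  bilinear_rmul[OF bil] bilinear_lneg[OF bil] bilinear_rneg[OF bil] bilinear_lzero[OF bil]
  bilinear_rzero[OF bil] bilinear_lsub[OF bil] bilinear_rsub[OF bil]

lemma br_self: "br x x = 0" using anti[of x x] by (metis add.right_inverse scaleR_2 scaleR_eq_0_iff zero_neq_numeral)

lemma cent_sym: "y \<in> cent x \<longleftrightarrow> x \<in> cent y" using anti[of x y] by (auto simp: cent_def)

lemma subspace_cent: "subspace (cent x)" by (auto simp: cent_def subspace_def br_simps)

lemma subspace_im: "subspace (range (br x))"
  using linear_subspace_image[OF lin subspace_UNIV] .

lemma B_sym: "B x y = B y x" unfolding B_def using linear_trace_comm[OF lin lin] by metis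

lemma B_add: "B x (y + z) = B x y + B x z"
  by (simp add: B_def o_def br_simps linear_add[OF lin] linear_trace_add)

lemma B_scale: "B x (c *\<^sub>R z) = c * B x z"
  by (simp add: B_def o_def br_simps linear_scale[OF lin] linear_trace_scaleR)

lemma B_linear: "linear (B x)" by (rule linearI) (simp_all add: B_add B_scale)

lemma B_linear_left: "linear (\<lambda>x. B x y)" using B_linear[of y] by (simp add: B_sym[of _ y])

lemma B_pos: "x \<noteq> 0 \<Longrightarrow> B x x > 0" using trace_neg by (simp add: B_def)

text \<open>As ad [x, y] is the commutator of ad x and ad y, both sides expand into traces of triple
  products. One product occurs on both sides, and cyclicity of the trace identifies the other two.
  So ad x is skew for \<open>B\<close>.\<close>

lemma B_inv: "B (br x y) z = - B y (br x z)"
proof -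
  have l: "linear (\<lambda>v. br x (br y v))" "linear (\<lambda>v. br y (br z v))" for x y z
    using linear_compose[OF lin lin] by (simp_all add: o_def)
  have e: "br (br x y) v = br x (br y v) - br y (br x v)" for x y v
    using jacobi[of x y v] by simp
  have 1: "linear_trace (br (br x y) \<circ> br z) = linear_trace (\<lambda>v. br x (br y (br z v))) - linear_trace (\<lambda>v. br y (br x (br z v)))"
    by (simp add: o_def e linear_trace_diff)
  have 2: "linear_trace (br y \<circ> br (br x z)) = linear_trace (\<lambda>v. br y (br x (br z v))) - linear_trace (\<lambda>v. br y (br z (br x v)))"
    by (simp add: o_def e br_simps linear_trace_diff)
  have 3: "linear_trace (\<lambda>v. br x (br y (br z v))) = linear_trace (\<lambda>v. br y (br z (br x v)))"
    using linear_trace_comm[OF lin l(1), of x y z] by (simp add: o_def)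
  show ?thesis unfolding B_def using 1 2 3 by simp
qed

text \<open>Kernel and image of an operator that is skew for a definite form are orthogonal
  complements. For the converse, y is paired with [x, [x, y]], which lies in the image; this gives
  \<open>B (br x y) (br x y) = 0\<close>.\<close>

lemma cent_iff_orth: "y \<in> cent x \<longleftrightarrow> (\<forall>v\<in>range (br x). B v y = 0)"
proof
  assume "y \<in> cent x" then show "\<forall>v\<in>range (br x). B v y = 0"
    using B_inv by (auto simp: cent_def linear_0[OF B_linear])
next
  assume *: "\<forall>v\<in>range (br x). B v y = 0"
  have "B (br x y) (br x y) = - B y (br x (br x y))" by (rule B_inv)
  also have "\<dots> = - B (br x (br x y)) y" by (simp add: B_sym)
  also have "\<dots> = 0" using * by simp
  finally show "y \<in> cent x" using B_pos[of "br x y"] by (auto simp: cent_def)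
qed

lemma cent_im_0: assumes "v \<in> cent x" "v \<in> range (br x)" shows "v = 0"
proof -
  have "B v v = 0" using cent_iff_orth[of v x] assms by blast
  then show ?thesis using B_pos[of v] by auto
qed

text \<open>Kernel and image meet only in 0, so ad x is bijective on its image. Hence some w in the
  image has [x, w] = [x, v], and v - w is the component in the kernel.\<close>

lemma cent_im_decomp: obtains k w where "v = k + w" "k \<in> cent x" "w \<in> range (br x)"
proof -
  let ?I = "range (br x)"
  have "inj_on (br x) ?I"
  proof (subst linear_inj_on_iff_eq_0[OF lin subspace_im], intro ballI impI)
    fix v assume "v \<in> ?I" "br x v = 0"
    then show "v = 0" by (intro cent_im_0) (auto simp: cent_def)
  qed
  then have "inj_on (br x) (span ?I)" using subspace_im by (metis span_eq_iff)
  then have "dim (br x ` ?I) = dim ?I" using dim_image_eq[OF lin] by blast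
  then have "br x ` ?I = ?I"
    by (intro subspace_dim_equal linear_subspace_image[OF lin] subspace_im) auto
  then obtain w where w: "w \<in> ?I" "br x v = br x w" by blast
  then have "v - w \<in> cent x" by (simp add: cent_def br_simps)
  then show thesis using that[of "v - w" w] w by simp
qed

lemma im_iff_orth: "v \<in> range (br x) \<longleftrightarrow> (\<forall>y\<in>cent x. B v y = 0)"
proof
  show "v \<in> range (br x) \<Longrightarrow> \<forall>y\<in>cent x. B v y = 0" using cent_iff_orth by blast
  assume *: "\<forall>y\<in>cent x. B v y = 0"
  obtain k w where kw: "v = k + w" "k \<in> cent x" "w \<in> range (br x)" by (rule cent_im_decomp)
  have "B k k = B v k - B w k" using kw linear_add[OF B_linear_left] by simp
  also have "\<dots> = 0" using * kw cent_iff_orth by auto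
  finally have "k = 0" using B_pos[of k] by auto
  then show "v \<in> range (br x)" using kw by simp
qed

lemma dim_cent: "dim (cent x) + dim (range (br x)) = DIM('m)"
proof -
  have "{a + b |a b. a \<in> cent x \<and> b \<in> range (br x)} = UNIV"
  proof -
    have "\<exists>a b. v = a + b \<and> a \<in> cent x \<and> b \<in> range (br x)" for v
      by (rule cent_im_decomp[of v x]) blast
    then show ?thesis by blast
  qed
  moreover have "cent x \<inter> range (br x) = {0}"
    using cent_im_0 subspace_0[OF subspace_cent] subspace_0[OF subspace_im] by blast
  ultimately show ?thesis using dim_sums_Int[OF subspace_cent[of x] subspace_im[of x]] by simp
qed

lemma reg_cent: "x \<in> reg \<longleftrightarrow> (\<forall>y. dim (cent x) \<le> dim (cent y))"
proof -
  have "dim (range (br y)) \<le> dim (range (br x)) \<longleftrightarrow> dim (cent x) \<le> dim (cent y)" for y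
    using dim_cent[of x] dim_cent[of y] by linarith
  then show ?thesis by (simp add: reg_def)
qed

lemma reg_dim_eq: "x \<in> reg \<Longrightarrow> y \<in> reg \<Longrightarrow> dim (cent x) = dim (cent y)"
  using reg_cent by (simp add: le_antisym)

lemma br_bounded: obtains C where "C > 0" "\<And>x y. norm (br x y) \<le> C * norm x * norm y"
proof -
  obtain C where C: "\<forall>x y. norm (br x y) \<le> C * norm x * norm y" using bilinear_bounded[OF bil] by blast
  have "C * norm x * norm y \<le> (\<bar>C\<bar> + 1) * norm x * norm y" for x y :: 'm by (intro mult_right_mono) auto
  then show thesis using that[of "\<bar>C\<bar> + 1"] C by (meson order_trans abs_ge_zero add_nonneg_pos zero_less_one)
qed

section \<open>Stability of images and centralisers near a point\<close>

text \<open>ad x is injective on its own image, hence bounded below there, and half of the bound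
  survives for nearby y. Testing every y on the fixed space \<open>range (br x)\<close> makes the
  constant uniform.\<close>

lemma near:
  obtains r d where "r > 0" "d > 0"
    "\<And>y w. norm (y - x) < r \<Longrightarrow> w \<in> range (br x) \<Longrightarrow> d * norm w \<le> norm (br y w)"
proof -
  have "\<exists>e>0. \<forall>w\<in>range (br x). norm (br x w) \<ge> e * norm w"
    by (rule injective_imp_isometric[OF closed_subspace[OF subspace_im] subspace_im])
      (use lin cent_im_0 in \<open>auto simp: linear_conv_bounded_linear cent_def\<close>)
  then obtain e where e: "e > 0" "\<And>w. w \<in> range (br x) \<Longrightarrow> norm (br x w) \<ge> e * norm w" by blast
  obtain C where C: "C > 0" "\<And>x y. norm (br x y) \<le> C * norm x * norm y" using br_bounded by blast
  show thesis
  \<comment> \<open>At this radius ad (y - x) takes away at most half of the lower bound e.\<close>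
  proof (rule that[of "e / (2 * C)" "e / 2"])
    fix y w assume y: "norm (y - x) < e / (2 * C)" and w: "w \<in> range (br x)"
    have "br y w = br x w + br (y - x) w" by (simp add: br_simps)
    then have "norm (br x w) \<le> norm (br y w) + norm (br (y - x) w)"
      by (metis add_diff_cancel_right' norm_triangle_ineq4)
    moreover have "norm (br (y - x) w) \<le> C * norm (y - x) * norm w" by (rule C)
    moreover have "C * norm (y - x) \<le> e / 2" using y C(1) by (simp add: field_simps)
    then have "C * norm (y - x) * norm w \<le> e / 2 * norm w" by (intro mult_right_mono) auto
    ultimately show "e / 2 * norm w \<le> norm (br y w)" using e(2)[OF w] by simp
  qed (use e C in auto)
qed

text \<open>Since ad y stays injective on the image of ad x, the rank cannot drop near x. At a
  regular x it cannot rise either, which makes \<open>reg\<close> open.\<close>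

lemma near_rank:
  obtains r where "r > 0" "\<And>y. norm (y - x) < r \<Longrightarrow> dim (range (br x)) \<le> dim (range (br y))"
    "\<And>y w. norm (y - x) < r \<Longrightarrow> w \<in> range (br x) \<Longrightarrow> w \<in> cent y \<Longrightarrow> w = 0"
proof -
  obtain r d where rd: "r > 0" "d > 0"
    "\<And>y w. norm (y - x) < r \<Longrightarrow> w \<in> range (br x) \<Longrightarrow> d * norm w \<le> norm (br y w)"
    using near[of x] by metis
  have inj0: "w = 0" if "norm (y - x) < r" "w \<in> range (br x)" "w \<in> cent y" for y w
    using rd(3)[OF that(1,2)] that(3) rd(2) by (simp add: cent_def mult_le_0_iff)
  have "dim (range (br x)) \<le> dim (range (br y))" if y: "norm (y - x) < r" for y
  proof -
    have "inj_on (br y) (range (br x))"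
    proof (subst linear_inj_on_iff_eq_0[OF lin subspace_im], intro ballI impI)
      fix v assume "v \<in> range (br x)" "br y v = 0"
      then show "v = 0" by (intro inj0[OF y]) (auto simp: cent_def)
    qed
    then have "inj_on (br y) (span (range (br x)))"
      using subspace_im by (metis span_eq_iff)
    then have "dim (br y ` range (br x)) = dim (range (br x))" using dim_image_eq[OF lin] by blast
    moreover have "dim (br y ` range (br x)) \<le> dim (range (br y))" by (rule dim_subset) auto
    ultimately show ?thesis by simp
  qed
  then show thesis using that rd(1) inj0 by blast
qed

lemma open_reg: "open reg"
proof (unfold open_dist, intro ballI)
  fix x assume x: "x \<in> reg"
  obtain r where r: "r > 0" "\<And>y. norm (y - x) < r \<Longrightarrow> dim (range (br x)) \<le> dim (range (br y))"
    using near_rank[of x] by metis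
  have "y \<in> reg" if "dist y x < r" for y
    using x r(2)[of y] that unfolding reg_def by (auto simp: dist_norm intro: order_trans)
  then show "\<exists>e>0. \<forall>y. dist y x < e \<longrightarrow> y \<in> reg" using r(1) by blast
qed

text \<open>The image of ad x stays a complement of \<open>cent y\<close>: the intersection is
  trivial by \<open>near_rank\<close>, and regularity makes the dimensions add up. A complement that
  does not move with y is what the estimates along curves rely on.\<close>

lemma near_decomp:
  assumes "x \<in> reg"
  obtains r where "r > 0" "\<And>y v. norm (y - x) < r \<Longrightarrow> \<exists>k w. v = k + w \<and> k \<in> cent y \<and> w \<in> range (br x)"
proof -
  obtain r where r: "r > 0" "\<And>y. norm (y - x) < r \<Longrightarrow> dim (range (br x)) \<le> dim (range (br y))"
    "\<And>y w. norm (y - x) < r \<Longrightarrow> w \<in> range (br x) \<Longrightarrow> w \<in> cent y \<Longrightarrow> w = 0"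
    using near_rank[of x] by metis
  have "\<exists>k w. v = k + w \<and> k \<in> cent y \<and> w \<in> range (br x)" if y: "norm (y - x) < r" for y v
  proof -
    let ?S = "{a + b |a b. a \<in> cent y \<and> b \<in> range (br x)}"
    have "cent y \<inter> range (br x) = {0}"
      using r(3)[OF y] subspace_0[OF subspace_cent] subspace_0[OF subspace_im] by blast
    moreover have "dim (range (br y)) = dim (range (br x))"
      using r(2)[OF y] assms by (simp add: reg_def le_antisym)
    ultimately have "dim ?S = DIM('m)"
      using dim_sums_Int[OF subspace_cent[of y] subspace_im[of x]] dim_cent[of y] by simp
    then have "span ?S = UNIV" using dim_eq_full by blast
    moreover have "span ?S = ?S" using subspace_sums[OF subspace_cent[of y] subspace_im[of x]] by (simp only: span_eq_iff)
    ultimately have "?S = UNIV" by simp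
    then show ?thesis by blast
  qed
  then show thesis using that r(1) by blast
qed

text \<open>Move x slightly inside its centraliser, to y = x + e z. As y commutes with x and is
  close to it, \<open>cent y\<close> lies in \<open>cent x\<close>, and minimality of the dimension
  at x forces equality. So w commutes with x and with y, hence with z.\<close>

lemma cent_abelian:
  assumes x: "x \<in> reg" and z: "z \<in> cent x" and w: "w \<in> cent x"
  shows "br z w = 0"
proof -
  obtain r where r: "r > 0" "\<And>y w. norm (y - x) < r \<Longrightarrow> w \<in> range (br x) \<Longrightarrow> w \<in> cent y \<Longrightarrow> w = 0"
    using near_rank[of x] by metis
  \<comment> \<open>This keeps e z shorter than r; the summand 1 covers z = 0.\<close>
  define e where "e = r / (2 * (norm z + 1))"
  have e0: "e > 0" using r(1) by (simp add: e_def add_nonneg_pos)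
  define y where "y = x + e *\<^sub>R z"
  have "norm (y - x) = e * norm z" using e0 by (simp add: y_def)
  also have "\<dots> \<le> e * (norm z + 1)" using e0 by simp
  also have "\<dots> = r / 2" by (simp add: e_def field_simps add_nonneg_eq_0_iff)
  finally have y: "norm (y - x) < r" using r(1) by simp
  have xy: "br x y = 0" using z by (simp add: y_def br_simps br_self cent_def)
  then have yx: "br y x = 0" using anti[of y x] by simp
  have sub: "cent y \<subseteq> cent x"
  proof
    fix u assume u: "u \<in> cent y"
    obtain k w where kw: "u = k + w" "k \<in> cent x" "w \<in> range (br x)" by (rule cent_im_decomp)
    \<comment> \<open>Because y commutes with x, ad y preserves both the kernel and the image of ad
      x. These meet only in 0, so the two components of [y, u] = 0 vanish separately.\<close>
    have a: "br y k \<in> cent x" using jacobi[of x y k] xy kw(2) by (simp add: cent_def br_simps)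
    obtain t where t: "w = br x t" using kw(3) by blast
    have b: "br y w \<in> range (br x)" using jacobi[of y x t] yx by (simp add: t br_simps)
    have "br y k = - br y w" using u kw(1) by (simp add: cent_def br_simps eq_neg_iff_add_eq_0)
    then have "br y w \<in> cent x" using a subspace_neg[OF subspace_cent] by fastforce
    then have "w = 0" using r(2)[OF y kw(3)] cent_im_0[OF _ b] by (simp add: cent_def)
    then show "u \<in> cent x" using kw by simp
  qed
  have "cent y = cent x"
    using subspace_dim_equal[OF subspace_cent subspace_cent sub] x by (simp add: reg_cent)
  then have "br (x + e *\<^sub>R z) w = 0" using w by (auto simp: cent_def y_def)
  then show ?thesis using w e0 by (simp add: br_simps cent_def)
qed

lemma cent_eq:
  assumes "x \<in> reg" "y \<in> reg" "y \<in> cent x" shows "cent y = cent x"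
proof -
  have "cent x \<subseteq> cent y" using cent_abelian[OF assms(1,3)] by (auto simp: cent_def)
  then show ?thesis
    using subspace_dim_equal[OF subspace_cent subspace_cent, of x y] reg_dim_eq[OF assms(1,2)] by simp
qed

text \<open>Uniqueness of integral curves: since \<open>ad (\<alpha>' s)\<close> vanishes on \<open>cent (\<alpha> s)\<close>, the derivative of
  \<open>[\<alpha> s, z]\<close> is bounded by a multiple of \<open>[\<alpha> s, z]\<close> itself.\<close>

lemma cent_const_along:
  assumes x: "x \<in> reg"
  obtains r where "r > 0"
    "\<And>al al' M b. (\<And>s. 0 \<le> s \<Longrightarrow> s \<le> b \<Longrightarrow> (al has_vector_derivative al' s) (at s) \<and> al' s \<in> cent (al s)
        \<and> al s \<in> reg \<and> norm (al s - x) < r \<and> norm (al' s) \<le> M) \<Longrightarrow> 0 \<le> b \<Longrightarrow> cent (al b) = cent (al 0)"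
proof -
  obtain r1 d where rd: "r1 > 0" "d > 0"
    "\<And>y w. norm (y - x) < r1 \<Longrightarrow> w \<in> range (br x) \<Longrightarrow> d * norm w \<le> norm (br y w)"
    using near[of x] by metis
  obtain r2 where r2: "r2 > 0" "\<And>y v. norm (y - x) < r2 \<Longrightarrow> \<exists>k w. v = k + w \<and> k \<in> cent y \<and> w \<in> range (br x)"
    using near_decomp[OF x] by metis
  obtain C where C: "C > 0" "\<And>x y. norm (br x y) \<le> C * norm x * norm y" using br_bounded by blast
  show thesis
  proof (rule that[of "min r1 r2"])
    show "min r1 r2 > 0" using rd r2 by simp
    fix al al' :: "real \<Rightarrow> 'm" and M b :: real
    assume al: "\<And>s. 0 \<le> s \<Longrightarrow> s \<le> b \<Longrightarrow> (al has_vector_derivative al' s) (at s) \<and> al' s \<in> cent (al s)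
        \<and> al s \<in> reg \<and> norm (al s - x) < min r1 r2 \<and> norm (al' s) \<le> M" and b: "0 \<le> b"
    have "cent (al 0) \<subseteq> cent (al b)"
    proof
      fix z assume z: "z \<in> cent (al 0)"
      \<comment> \<open>In both brackets z may be replaced by its component w in the fixed
        complement \<open>range (br x)\<close>. There \<open>C * M\<close> bounds [al' s, w] in
        terms of w, and 1 / d comes from the lower bound of ad (al s) on that complement.\<close>
      have "(\<lambda>s. br (al s) z) b = 0"
      proof (rule gronwall_zero[where h' = "\<lambda>s. br (al' s) z" and C = "C * M / d" and b = b])
        fix s assume s: "0 \<le> s" "s \<le> b"
        have "bounded_linear (\<lambda>x. br x z)"
          using bil by (simp add: bilinear_def linear_conv_bounded_linear)
        then show "((\<lambda>s. br (al s) z) has_vector_derivative br (al' s) z) (at s)"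
          using al[OF s] bounded_linear.has_vector_derivative by blast
        obtain k w where kw: "z = k + w" "k \<in> cent (al s)" "w \<in> range (br x)"
          using r2(2)[of "al s" z] al[OF s] by auto
        have "br (al' s) k = 0" using cent_abelian[of "al s" "al' s" k] al[OF s] kw by blast
        then have e: "br (al' s) z = br (al' s) w" by (simp add: kw br_simps)
        have e2: "br (al s) z = br (al s) w" using kw by (simp add: kw cent_def br_simps)
        have M: "norm (al' s) \<le> M" "0 \<le> M" using al[OF s] norm_ge_zero order_trans by blast+
        have "norm (br (al' s) w) \<le> C * norm (al' s) * norm w" by (rule C)
        also have "\<dots> \<le> C * M * norm w" using C(1) M by (intro mult_right_mono mult_left_mono) auto
        also have "\<dots> = (C * M / d) * (d * norm w)" using rd(2) by simp
        also have "\<dots> \<le> (C * M / d) * norm (br (al s) w)"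
          using rd(3)[of "al s" w] al[OF s] kw(3) C(1) M rd(2) by (intro mult_left_mono) auto
        finally show "norm (br (al' s) z) \<le> C * M / d * norm (br (al s) z)" by (simp add: e e2)
      qed (use z b in \<open>auto simp: cent_def\<close>)
      then show "z \<in> cent (al b)" by (simp add: cent_def)
    qed
    then show "cent (al b) = cent (al 0)"
      using subspace_dim_equal[OF subspace_cent subspace_cent, of "al 0" "al b"]
        reg_dim_eq[of "al b" "al 0"] al[of b] al[of 0] b by simp
  qed
qed

end

section \<open>Lie groups in a chart around the identity\<close>

lemma Ck_on_cong:
  assumes "open S" "\<And>x. x \<in> S \<Longrightarrow> f x = g x" "Ck_on k S f"
  shows "Ck_on k S g"
proof (cases k)
  case 0
  then show ?thesis using assms by (simp add: continuous_on_cong[of S S f g])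
next
  case (Suc j)
  then obtain f' where f': "\<And>x. x \<in> S \<Longrightarrow> (f has_derivative f' x) (at x)" "\<And>v. Ck_on j S (\<lambda>x. f' x v)"
    using assms(3) by auto
  have "(g has_derivative f' x) (at x)" if "x \<in> S" for x
    by (rule has_derivative_transform_within_open[OF f'(1)[OF that] assms(1) that]) (use assms(2) in auto)
  then show ?thesis using Suc f' by auto
qed

section \<open>Limits along an ultrafilter\<close>

text \<open>Zorn's lemma on proper filters below \<open>sequentially\<close>, ordered by refinement.
  The ultrafilter selects a limit for every sequence in a compact space, and the selections for
  different sequences are compatible with continuous operations.\<close>

lemma ultrafilter_exists:
  obtains F :: "nat filter" where "F \<noteq> bot" "F \<le> sequentially"
    "\<And>P. eventually P F \<or> eventually (\<lambda>n. \<not> P n) F"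
proof -
  let ?A = "{F :: nat filter. F \<noteq> bot \<and> F \<le> sequentially}"
  let ?R = "relation_of (\<lambda>a b. b \<le> a) ?A"
  have "\<exists>m\<in>?A. \<forall>a\<in>?A. a \<le> m \<longrightarrow> a = m"
  proof (rule predicate_Zorn)
    show "partial_order_on ?A ?R"
      by (rule partial_order_on_relation_ofI) auto
    fix C assume C: "C \<in> Chains ?R"
    then have sub: "C \<subseteq> ?A" and ch: "\<And>a b. a \<in> C \<Longrightarrow> b \<in> C \<Longrightarrow> a \<le> b \<or> b \<le> a"
      by (auto simp: Chains_def relation_of_def)
    show "\<exists>u\<in>?A. \<forall>a\<in>C. u \<le> a"
    proof (cases "C = {}")
      case True then show ?thesis by (auto intro!: exI[of _ sequentially])
    next
      case False
      \<comment> \<open>For a chain the infimum holds exactly the predicates that hold along some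
        member, so it is proper because the members are.\<close>
      have "eventually P (Inf C) \<longleftrightarrow> (\<exists>b\<in>C. eventually P b)" for P
        by (rule eventually_Inf_base[OF False]) (metis ch inf.orderE inf_commute order_refl)
      then have "Inf C \<noteq> bot" using sub by (auto simp: trivial_limit_def)
      moreover have "Inf C \<le> sequentially" using False sub by (auto intro: Inf_lower2)
      ultimately show ?thesis by (intro bexI[of _ "Inf C"]) (auto intro: Inf_lower)
    qed
  qed
  then obtain F where F: "F \<noteq> bot" "F \<le> sequentially" "\<And>a. a \<noteq> bot \<Longrightarrow> a \<le> sequentially \<Longrightarrow> a \<le> F \<Longrightarrow> a = F"
    by auto
  \<comment> \<open>Restricting F to the set of P either destroys it, so that P fails eventually, or
    by minimality gives back F.\<close>
  have "eventually P F \<or> eventually (\<lambda>n. \<not> P n) F" for P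
  proof (cases "inf F (principal {n. P n}) = bot")
    case True
    then show ?thesis by (simp add: trivial_limit_def eventually_inf_principal)
  next
    case False
    then have "inf F (principal {n. P n}) = F" using F(3) F(2) by (meson inf.cobounded1 order_trans)
    moreover have "eventually P (inf F (principal {n. P n}))" by (simp add: eventually_inf_principal)
    ultimately show ?thesis by simp
  qed
  then show thesis using that F by blast
qed

text \<open>A point that is not a limit has a neighbourhood that f does not eventually enter, and
  along an ultrafilter f then eventually avoids it. Finitely many such neighbourhoods cover a
  compact space, leaving no room for f.\<close>

lemma ultrafilter_limitin:
  assumes F: "\<And>P. eventually P F \<or> eventually (\<lambda>n. \<not> P n) F" "F \<noteq> bot"
    and X: "compact_space X" and f: "\<And>n. f n \<in> topspace X"
  obtains l where "limitin X f l F"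
proof -
  have "\<exists>l. limitin X f l F"
  proof (rule ccontr)
    assume no: "\<nexists>l. limitin X f l F"
    have "\<exists>W. openin X W \<and> l \<in> W \<and> eventually (\<lambda>n. f n \<notin> W) F" if "l \<in> topspace X" for l
    proof -
      have "\<not> limitin X f l F" using no by blast
      then show ?thesis using F(1) that unfolding limitin_def by blast
    qed
    then obtain W where W: "\<And>l. l \<in> topspace X \<Longrightarrow> openin X (W l) \<and> l \<in> W l \<and> eventually (\<lambda>n. f n \<notin> W l) F"
      by metis
    have "\<exists>\<F>. finite \<F> \<and> \<F> \<subseteq> W ` topspace X \<and> topspace X \<subseteq> \<Union>\<F>"
      using X[unfolded compact_space_alt, rule_format, of "W ` topspace X"] W by blast
    then obtain \<F> where fin: "finite \<F>" "\<F> \<subseteq> W ` topspace X" "topspace X \<subseteq> \<Union>\<F>" by blast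
    have "eventually (\<lambda>n. \<forall>V\<in>\<F>. f n \<notin> V) F"
      using fin W by (subst eventually_ball_finite_distrib) auto
    then have "eventually (\<lambda>n. False) F" by (rule eventually_mono) (use f fin in blast)
    then show False using F(2) by (simp add: trivial_limit_def)
  qed
  then show thesis using that by blast
qed

lemma differentiable_Pair_const:
  "(\<lambda>q. (c, q)) differentiable (at x)" "(\<lambda>q. (q, c)) differentiable (at x)"
  unfolding differentiable_def
  by (rule exI, rule has_derivative_Pair[OF has_derivative_const has_derivative_ident])
    (rule exI, rule has_derivative_Pair[OF has_derivative_ident has_derivative_const])

section \<open>Group operations and the adjoint representation in charts\<close>

locale lie_chart =
  fixes G :: "('g, 'b) monoid_scheme" and X :: "'g topology"
    and A :: "('g set \<times> ('g \<Rightarrow> 'm::euclidean_space)) set" and U :: "'g set" and \<phi> :: "'g \<Rightarrow> 'm"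
  assumes lg: "lie_group G X A" and UA: "(U, \<phi>) \<in> A" and oneU: "\<one>\<^bsub>G\<^esub> \<in> U"
begin

text \<open>The chart need not send the identity to 0, so elements near the identity appear later as
  displacements \<open>org + u\<close>.\<close>

definition org :: 'm where "org = \<phi> \<one>\<^bsub>G\<^esub>"
definition \<psi> :: "'m \<Rightarrow> 'g" where "\<psi> = inv_into U \<phi>"

sublocale group G using lg by (simp add: lie_group_def)

lemma topspace_eq: "topspace X = carrier G" using lg by (simp add: lie_group_def)

lemma Hausdorff: "Hausdorff_space X" using lg by (simp add: lie_group_def smooth_manifold_def)

lemma chart_at: assumes "a \<in> carrier G" obtains V \<xi> where "(V, \<xi>) \<in> A" "a \<in> V"
proof -
  have "(\<Union>(U, \<phi>) \<in> A. U) = carrier G"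
    using lg by (simp add: lie_group_def smooth_manifold_def)
  then show thesis using that assms by blast
qed

lemma is_chart_A: "(V, \<xi>) \<in> A \<Longrightarrow> is_chart X V \<xi>"
  using lg by (auto simp: lie_group_def smooth_manifold_def)

lemma
  assumes "(V, \<xi>) \<in> A"
  shows chart_openin: "openin X V" and chart_subset: "V \<subseteq> carrier G"
    and chart_inj: "inj_on \<xi> V" and chart_open: "open (\<xi> ` V)"
    and chart_cont: "continuous_map (subtopology X V) euclidean \<xi>"
    and chart_cont_inv: "continuous_map (top_of_set (\<xi> ` V)) X (inv_into V \<xi>)"
proof -
  have c: "is_chart X V \<xi>" using assms by (rule is_chart_A)
  show V: "openin X V" using c by (simp add: is_chart_def)
  show sub: "V \<subseteq> carrier G" using openin_subset[OF V] topspace_eq by simp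
  have ts: "topspace (subtopology X V) = V" using sub topspace_eq by (auto simp: topspace_subtopology)
  have h: "homeomorphic_map (subtopology X V) (top_of_set (\<xi> ` V)) \<xi>" using c by (simp add: is_chart_def)
  show inj: "inj_on \<xi> V" using homeomorphic_imp_injective_map[OF h] ts by simp
  show "open (\<xi> ` V)" using c by (simp add: is_chart_def)
  show "continuous_map (subtopology X V) euclidean \<xi>"
    using homeomorphic_imp_continuous_map[OF h] continuous_map_into_fulltopology by blast
  obtain g where g: "homeomorphic_maps (subtopology X V) (top_of_set (\<xi> ` V)) \<xi> g"
    using h homeomorphic_map_maps by blast
  then have "continuous_map (top_of_set (\<xi> ` V)) (subtopology X V) g" by (simp add: homeomorphic_maps_def)
  then have gc: "continuous_map (top_of_set (\<xi> ` V)) X g" using continuous_map_into_fulltopology by blast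
  show "continuous_map (top_of_set (\<xi> ` V)) X (inv_into V \<xi>)"
  proof (rule continuous_map_eq[OF gc])
    fix x assume "x \<in> topspace (top_of_set (\<xi> ` V))"
    then obtain v where v: "v \<in> V" "x = \<xi> v" by auto
    then have "g x = v" using g ts by (auto simp: homeomorphic_maps_def)
    then show "g x = inv_into V \<xi> x" using v inj by simp
  qed
qed

lemma mult_cont: "continuous_map (prod_topology X X) X (\<lambda>(a, b). a \<otimes>\<^bsub>G\<^esub> b)"
  using lg by (simp add: lie_group_def smooth_map_def)

lemma inv_cont: "continuous_map X X (\<lambda>a. inv\<^bsub>G\<^esub> a)"
  using lg by (simp add: lie_group_def smooth_map_def)

lemma mult_cont':
  assumes "continuous_map Y X f" "continuous_map Y X g"
  shows "continuous_map Y X (\<lambda>x. f x \<otimes>\<^bsub>G\<^esub> g x)"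
  using continuous_map_compose[OF continuous_map_pairedI[OF assms] mult_cont] by (simp add: o_def)

lemma inv_cont': "continuous_map Y X f \<Longrightarrow> continuous_map Y X (\<lambda>x. inv\<^bsub>G\<^esub> (f x))"
  using continuous_map_compose[OF _ inv_cont] by (fastforce simp: o_def)

lemma lmult_cont: "a \<in> carrier G \<Longrightarrow> continuous_map X X (\<lambda>b. a \<otimes>\<^bsub>G\<^esub> b)"
  by (rule mult_cont') (auto simp: topspace_eq)

lemma rmult_cont: "a \<in> carrier G \<Longrightarrow> continuous_map X X (\<lambda>b. b \<otimes>\<^bsub>G\<^esub> a)"
  by (rule mult_cont') (auto simp: topspace_eq)

lemma conj_cont: "a \<in> carrier G \<Longrightarrow> continuous_map X X (\<lambda>b. a \<otimes>\<^bsub>G\<^esub> b \<otimes>\<^bsub>G\<^esub> inv\<^bsub>G\<^esub> a)"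
  by (intro mult_cont') (auto simp: topspace_eq)

lemma psi_phi: "a \<in> U \<Longrightarrow> \<psi> (\<phi> a) = a" using chart_inj[OF UA] by (simp add: \<psi>_def)

lemma phi_psi: "p \<in> \<phi> ` U \<Longrightarrow> \<phi> (\<psi> p) = p" by (simp add: \<psi>_def f_inv_into_f)

lemma psi_in: "p \<in> \<phi> ` U \<Longrightarrow> \<psi> p \<in> U" by (simp add: \<psi>_def inv_into_into)

lemma psi_carrier: "p \<in> \<phi> ` U \<Longrightarrow> \<psi> p \<in> carrier G" using psi_in chart_subset[OF UA] by blast

lemma org_in: "org \<in> \<phi> ` U" using oneU by (simp add: org_def)

lemma psi_org: "\<psi> org = \<one>\<^bsub>G\<^esub>" using psi_phi[OF oneU] by (simp add: org_def)

lemma psi_cont: "continuous_map (top_of_set (\<phi> ` U)) X \<psi>"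
  using chart_cont_inv[OF UA] by (simp add: \<psi>_def)

lemma openin_chart_vimage:
  assumes "open S" shows "openin X {b \<in> U. \<phi> b \<in> S}"
proof -
  have "openin (subtopology X U) {b \<in> topspace (subtopology X U). \<phi> b \<in> S}"
    by (rule openin_continuous_map_preimage[OF chart_cont[OF UA]]) (use assms in simp)
  moreover have "topspace (subtopology X U) = U" using chart_subset[OF UA] topspace_eq by auto
  ultimately show ?thesis using openin_trans_full chart_openin[OF UA] by fastforce
qed

lemma ev_psi:
  assumes "openin X W" "\<one>\<^bsub>G\<^esub> \<in> W"
  shows "\<forall>\<^sub>F p in nhds org. p \<in> \<phi> ` U \<and> \<psi> p \<in> W"
proof -
  have "openin (top_of_set (\<phi> ` U)) {p \<in> \<phi> ` U. \<psi> p \<in> W}"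
    using openin_continuous_map_preimage[OF psi_cont assms(1)] by simp
  then have "open {p \<in> \<phi> ` U. \<psi> p \<in> W}" using chart_open[OF UA] by (simp add: openin_open_eq)
  then show ?thesis using org_in psi_org assms(2) by (auto simp: eventually_nhds)
qed

lemma ev_psi_map:
  assumes "continuous_map X X f" "openin X W" "f \<one>\<^bsub>G\<^esub> \<in> W"
  shows "\<forall>\<^sub>F p in nhds org. p \<in> \<phi> ` U \<and> f (\<psi> p) \<in> W"
proof -
  have "openin X {a \<in> carrier G. f a \<in> W}"
    using openin_continuous_map_preimage[OF assms(1,2)] topspace_eq by simp
  from ev_psi[OF this] assms(3) show ?thesis by (auto elim: eventually_mono)
qed

text \<open>Smoothness of the product is stated with the inverse of the product chart
  \<open>map_prod \<xi>1 \<xi>2\<close>. On the open set \<open>D\<close> this inverse splits into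
  the inverses of the two factors, and \<open>Ck_on_cong\<close> rewrites the map.\<close>

lemma mult_chart:
  assumes 1: "(V1, \<xi>1) \<in> A" and 2: "(V2, \<xi>2) \<in> A" and 3: "(V3, \<xi>3) \<in> A"
  defines "D \<equiv> {z. fst z \<in> \<xi>1 ` V1 \<and> snd z \<in> \<xi>2 ` V2 \<and>
      inv_into V1 \<xi>1 (fst z) \<otimes>\<^bsub>G\<^esub> inv_into V2 \<xi>2 (snd z) \<in> V3}"
  shows "open D" and "smooth_on D (\<lambda>z. \<xi>3 (inv_into V1 \<xi>1 (fst z) \<otimes>\<^bsub>G\<^esub> inv_into V2 \<xi>2 (snd z)))"
proof -
  let ?T = "\<xi>1 ` V1 \<times> \<xi>2 ` V2"
  let ?m = "\<lambda>z. inv_into V1 \<xi>1 (fst z) \<otimes>\<^bsub>G\<^esub> inv_into V2 \<xi>2 (snd z)"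
  have a: "continuous_map (top_of_set ?T) X (\<lambda>z. inv_into V1 \<xi>1 (fst z))"
  proof -
    have "continuous_map (top_of_set ?T) (top_of_set (\<xi>1 ` V1)) fst"
      by (auto simp: continuous_map_in_subtopology Pi_def intro!: continuous_intros)
    from continuous_map_compose[OF this chart_cont_inv[OF 1]] show ?thesis by (simp add: o_def)
  qed
  have b: "continuous_map (top_of_set ?T) X (\<lambda>z. inv_into V2 \<xi>2 (snd z))"
  proof -
    have "continuous_map (top_of_set ?T) (top_of_set (\<xi>2 ` V2)) snd"
      by (auto simp: continuous_map_in_subtopology Pi_def intro!: continuous_intros)
    from continuous_map_compose[OF this chart_cont_inv[OF 2]] show ?thesis by (simp add: o_def)
  qed
  have "openin (top_of_set ?T) {z \<in> topspace (top_of_set ?T). ?m z \<in> V3}"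
    by (rule openin_continuous_map_preimage[OF mult_cont'[OF a b] chart_openin[OF 3]])
  moreover have "{z \<in> topspace (top_of_set ?T). ?m z \<in> V3} = D" by (auto simp: D_def)
  moreover have "open ?T" using chart_open 1 2 by (simp add: open_Times)
  ultimately show oD: "open D" by (simp add: openin_open_eq)
  have pa: "(V1 \<times> V2, map_prod \<xi>1 \<xi>2) \<in> prod_atlas A A" using 1 2 by (auto simp: prod_atlas_def)
  let ?f = "\<lambda>(a, b). a \<otimes>\<^bsub>G\<^esub> b"
  have sm: "smooth_on (map_prod \<xi>1 \<xi>2 ` {x \<in> V1 \<times> V2. ?f x \<in> V3}) (\<xi>3 \<circ> ?f \<circ> inv_into (V1 \<times> V2) (map_prod \<xi>1 \<xi>2))"
    using lg pa 3 unfolding lie_group_def smooth_map_def by fast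
  have inv1: "inv_into V1 \<xi>1 (\<xi>1 a) = a" if "a \<in> V1" for a using chart_inj[OF 1] that by simp
  have inv2: "inv_into V2 \<xi>2 (\<xi>2 a) = a" if "a \<in> V2" for a using chart_inj[OF 2] that by simp
  have inj: "inj_on (map_prod \<xi>1 \<xi>2) (V1 \<times> V2)"
    using chart_inj[OF 1] chart_inj[OF 2] by (rule map_prod_inj_on)
  have De: "map_prod \<xi>1 \<xi>2 ` {x \<in> V1 \<times> V2. ?f x \<in> V3} = D"
  proof (intro equalityI subsetI)
    fix z assume "z \<in> map_prod \<xi>1 \<xi>2 ` {x \<in> V1 \<times> V2. ?f x \<in> V3}"
    then show "z \<in> D" by (auto simp: D_def inv1 inv2)
  next
    fix z assume z: "z \<in> D"
    then obtain a b where ab: "a \<in> V1" "b \<in> V2" "fst z = \<xi>1 a" "snd z = \<xi>2 b" by (auto simp: D_def)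
    then have "a \<otimes>\<^bsub>G\<^esub> b \<in> V3" using z by (simp add: D_def inv1 inv2)
    moreover have "z = map_prod \<xi>1 \<xi>2 (a, b)" using ab by (simp add: prod_eq_iff)
    ultimately show "z \<in> map_prod \<xi>1 \<xi>2 ` {x \<in> V1 \<times> V2. ?f x \<in> V3}" using ab by (intro image_eqI[of _ _ "(a, b)"]) simp_all
  qed
  show "smooth_on D (\<lambda>z. \<xi>3 (?m z))"
    unfolding smooth_on_def
  proof
    fix k
    have "Ck_on k D (\<xi>3 \<circ> ?f \<circ> inv_into (V1 \<times> V2) (map_prod \<xi>1 \<xi>2))"
      using sm by (simp add: smooth_on_def De)
    then show "Ck_on k D (\<lambda>z. \<xi>3 (?m z))"
    proof (rule Ck_on_cong[OF oD, rotated])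
      fix z assume "z \<in> D"
      then obtain a b where ab: "a \<in> V1" "b \<in> V2" "fst z = \<xi>1 a" "snd z = \<xi>2 b" by (auto simp: D_def)
      then have z: "z = map_prod \<xi>1 \<xi>2 (a, b)" by (simp add: prod_eq_iff)
      have "inv_into (V1 \<times> V2) (map_prod \<xi>1 \<xi>2) z = (a, b)"
        unfolding z by (rule inv_into_f_f[OF inj]) (simp only: mem_Sigma_iff ab)
      then show "(\<xi>3 \<circ> ?f \<circ> inv_into (V1 \<times> V2) (map_prod \<xi>1 \<xi>2)) z = \<xi>3 (?m z)"
        by (simp only: o_apply prod.case ab inv1 inv2)
    qed
  qed
qed

lemma mult_differentiable:
  assumes 1: "(V1, \<xi>1) \<in> A" and 2: "(V2, \<xi>2) \<in> A" and 3: "(V3, \<xi>3) \<in> A"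
    and ab: "a \<in> V1" "b \<in> V2" "a \<otimes>\<^bsub>G\<^esub> b \<in> V3"
  shows "(\<lambda>z. \<xi>3 (inv_into V1 \<xi>1 (fst z) \<otimes>\<^bsub>G\<^esub> inv_into V2 \<xi>2 (snd z))) differentiable (at (\<xi>1 a, \<xi>2 b))"
proof -
  have "Ck_on (Suc 0) {z. fst z \<in> \<xi>1 ` V1 \<and> snd z \<in> \<xi>2 ` V2 \<and>
      inv_into V1 \<xi>1 (fst z) \<otimes>\<^bsub>G\<^esub> inv_into V2 \<xi>2 (snd z) \<in> V3}
      (\<lambda>z. \<xi>3 (inv_into V1 \<xi>1 (fst z) \<otimes>\<^bsub>G\<^esub> inv_into V2 \<xi>2 (snd z)))"
    using mult_chart(2)[OF 1 2 3] unfolding smooth_on_def by blast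
  moreover have "(\<xi>1 a, \<xi>2 b) \<in> {z. fst z \<in> \<xi>1 ` V1 \<and> snd z \<in> \<xi>2 ` V2 \<and>
      inv_into V1 \<xi>1 (fst z) \<otimes>\<^bsub>G\<^esub> inv_into V2 \<xi>2 (snd z) \<in> V3}"
    using ab chart_inj[OF 1] chart_inj[OF 2] by simp
  ultimately show ?thesis by (auto simp: differentiable_def)
qed

text \<open>The element a may lie far from the identity. Conjugation is therefore factored through a
  chart V around a: left multiplication goes from U to V, right multiplication by the inverse goes
  from V back to U.\<close>

lemma conj_differentiable:
  assumes a: "a \<in> carrier G"
  shows "(\<lambda>p. \<phi> (a \<otimes>\<^bsub>G\<^esub> \<psi> p \<otimes>\<^bsub>G\<^esub> inv\<^bsub>G\<^esub> a)) differentiable (at org)"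
proof -
  obtain V \<xi> where V: "(V, \<xi>) \<in> A" "a \<in> V" using chart_at[OF a] by blast
  obtain V' \<xi>' where V': "(V', \<xi>') \<in> A" "inv\<^bsub>G\<^esub> a \<in> V'" using chart_at[of "inv\<^bsub>G\<^esub> a"] a by blast
  define F1 where "F1 = (\<lambda>z. \<xi> (inv_into V \<xi> (fst z) \<otimes>\<^bsub>G\<^esub> inv_into U \<phi> (snd z)))"
  define F2 where "F2 = (\<lambda>z. \<phi> (inv_into V \<xi> (fst z) \<otimes>\<^bsub>G\<^esub> inv_into V' \<xi>' (snd z)))"
  define f1 where "f1 = (\<lambda>q. F1 (\<xi> a, q))"
  define f2 where "f2 = (\<lambda>p. F2 (p, \<xi>' (inv\<^bsub>G\<^esub> a)))"
  have ia: "inv_into V \<xi> (\<xi> a) = a" "inv_into V' \<xi>' (\<xi>' (inv\<^bsub>G\<^esub> a)) = inv\<^bsub>G\<^esub> a"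
    using V V' chart_inj by simp_all
  have "F1 differentiable (at (\<xi> a, org))"
    unfolding F1_def org_def by (rule mult_differentiable[OF V(1) UA V(1)]) (use V oneU a in auto)
  then have d1: "f1 differentiable (at org)"
    unfolding f1_def by (intro differentiable_compose[of F1 "\<lambda>q. (\<xi> a, q)"] differentiable_Pair_const)
  have f1o: "f1 org = \<xi> a" using psi_org a by (simp add: f1_def F1_def ia \<psi>_def)
  have "F2 differentiable (at (\<xi> a, \<xi>' (inv\<^bsub>G\<^esub> a)))"
    unfolding F2_def by (rule mult_differentiable[OF V(1) V'(1) UA]) (use V V' oneU a in auto)
  then have "f2 differentiable (at (f1 org))"
    unfolding f2_def f1o
    by (intro differentiable_compose[of F2 "\<lambda>p. (p, \<xi>' (inv\<^bsub>G\<^esub> a))"] differentiable_Pair_const)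
  then have "(\<lambda>p. f2 (f1 p)) differentiable (at org)"
    using d1 by (rule differentiable_compose)
  then obtain f' where f': "((\<lambda>p. f2 (f1 p)) has_derivative f') (at org)" by (auto simp: differentiable_def)
  have "\<forall>\<^sub>F p in nhds org. p \<in> \<phi> ` U \<and> a \<otimes>\<^bsub>G\<^esub> \<psi> p \<in> V"
    by (rule ev_psi_map[OF lmult_cont[OF a] chart_openin[OF V(1)]]) (use V a in simp)
  then have ev: "\<forall>\<^sub>F p in nhds org. f2 (f1 p) = \<phi> (a \<otimes>\<^bsub>G\<^esub> \<psi> p \<otimes>\<^bsub>G\<^esub> inv\<^bsub>G\<^esub> a)"
  proof (rule eventually_mono)
    fix p assume p: "p \<in> \<phi> ` U \<and> a \<otimes>\<^bsub>G\<^esub> \<psi> p \<in> V"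
    have "f1 p = \<xi> (a \<otimes>\<^bsub>G\<^esub> \<psi> p)" by (simp add: f1_def F1_def ia \<psi>_def)
    then show "f2 (f1 p) = \<phi> (a \<otimes>\<^bsub>G\<^esub> \<psi> p \<otimes>\<^bsub>G\<^esub> inv\<^bsub>G\<^esub> a)"
      using p chart_inj[OF V(1)] by (simp add: f2_def F2_def ia)
  qed
  have "((\<lambda>p. \<phi> (a \<otimes>\<^bsub>G\<^esub> \<psi> p \<otimes>\<^bsub>G\<^esub> inv\<^bsub>G\<^esub> a)) has_derivative f') (at org)"
    by (rule has_derivative_transform_eventually[OF f'])
      (use ev in \<open>auto simp: eventually_nhds_conv_at\<close>)
  then show ?thesis by (auto simp: differentiable_def)
qed

abbreviation Adj where "Adj \<equiv> Ad G U \<phi>"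

lemma Ad_has_derivative:
  "a \<in> carrier G \<Longrightarrow> ((\<lambda>p. \<phi> (a \<otimes>\<^bsub>G\<^esub> \<psi> p \<otimes>\<^bsub>G\<^esub> inv\<^bsub>G\<^esub> a)) has_derivative Adj a) (at org)"
  using conj_differentiable unfolding Ad_def org_def \<psi>_def by (subst frechet_derivative_works[symmetric])

lemma Ad_linear: "a \<in> carrier G \<Longrightarrow> linear (Adj a)"
  using Ad_has_derivative has_derivative_linear by blast

lemma Ad_unique:
  assumes "a \<in> carrier G" "(f has_derivative f') (at org)"
    "\<forall>\<^sub>F p in nhds org. f p = \<phi> (a \<otimes>\<^bsub>G\<^esub> \<psi> p \<otimes>\<^bsub>G\<^esub> inv\<^bsub>G\<^esub> a)"
  shows "Adj a = f'"
proof -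
  have "((\<lambda>p. \<phi> (a \<otimes>\<^bsub>G\<^esub> \<psi> p \<otimes>\<^bsub>G\<^esub> inv\<^bsub>G\<^esub> a)) has_derivative f') (at org)"
    by (rule has_derivative_transform_eventually[OF assms(2)])
      (use assms(3) in \<open>auto simp: eventually_nhds_conv_at\<close>)
  then show ?thesis using has_derivative_unique[OF Ad_has_derivative[OF assms(1)]] by blast
qed

lemma conj_one: "a \<in> carrier G \<Longrightarrow> a \<otimes>\<^bsub>G\<^esub> \<one>\<^bsub>G\<^esub> \<otimes>\<^bsub>G\<^esub> inv\<^bsub>G\<^esub> a = \<one>\<^bsub>G\<^esub>" by simp

lemma ev_conj: "a \<in> carrier G \<Longrightarrow> \<forall>\<^sub>F p in nhds org. p \<in> \<phi> ` U \<and> a \<otimes>\<^bsub>G\<^esub> \<psi> p \<otimes>\<^bsub>G\<^esub> inv\<^bsub>G\<^esub> a \<in> U"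
  by (rule ev_psi_map[OF conj_cont chart_openin[OF UA]]) (simp_all add: conj_one oneU)

lemma Ad_one: "Adj \<one>\<^bsub>G\<^esub> = (\<lambda>v. v)"
proof (rule Ad_unique[of _ "\<lambda>p. p"])
  show "\<forall>\<^sub>F p in nhds org. p = \<phi> (\<one>\<^bsub>G\<^esub> \<otimes>\<^bsub>G\<^esub> \<psi> p \<otimes>\<^bsub>G\<^esub> inv\<^bsub>G\<^esub> \<one>\<^bsub>G\<^esub>)"
    using ev_conj[OF one_closed] by (rule eventually_mono) (auto simp: phi_psi psi_carrier)
qed auto

lemma Ad_mult:
  assumes a: "a \<in> carrier G" and b: "b \<in> carrier G"
  shows "Adj (a \<otimes>\<^bsub>G\<^esub> b) v = Adj a (Adj b v)"
proof -
  let ?c = "\<lambda>a p. \<phi> (a \<otimes>\<^bsub>G\<^esub> \<psi> p \<otimes>\<^bsub>G\<^esub> inv\<^bsub>G\<^esub> a)"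
  have co: "?c b org = org" using b by (simp add: psi_org) (simp add: org_def)
  have "((\<lambda>p. ?c a (?c b p)) has_derivative (\<lambda>v. Adj a (Adj b v))) (at org)"
    by (rule has_derivative_compose[OF Ad_has_derivative[OF b]]) (simp only: co Ad_has_derivative[OF a])
  moreover have "\<forall>\<^sub>F p in nhds org. ?c a (?c b p) = ?c (a \<otimes>\<^bsub>G\<^esub> b) p"
    using ev_conj[OF b]
  proof (rule eventually_mono)
    fix p assume p: "p \<in> \<phi> ` U \<and> b \<otimes>\<^bsub>G\<^esub> \<psi> p \<otimes>\<^bsub>G\<^esub> inv\<^bsub>G\<^esub> b \<in> U"
    then show "?c a (?c b p) = ?c (a \<otimes>\<^bsub>G\<^esub> b) p"
      using a b psi_carrier[of p] by (simp add: psi_phi inv_mult_group m_assoc)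
  qed
  ultimately have "Adj (a \<otimes>\<^bsub>G\<^esub> b) = (\<lambda>v. Adj a (Adj b v))" by (intro Ad_unique) (use a b in auto)
  then show ?thesis by simp
qed

lemma Ad_inv: "a \<in> carrier G \<Longrightarrow> Adj a (Adj (inv\<^bsub>G\<^esub> a) v) = v" "a \<in> carrier G \<Longrightarrow> Adj (inv\<^bsub>G\<^esub> a) (Adj a v) = v"
  using Ad_mult[of a "inv\<^bsub>G\<^esub> a"] Ad_mult[of "inv\<^bsub>G\<^esub> a" a] by (simp_all add: Ad_one)

lemma Ad_curve:
  assumes a: "a \<in> carrier G" and \<sigma>: "\<forall>\<^sub>F t in nhds 0. \<sigma> t \<in> U" "\<sigma> 0 = \<one>\<^bsub>G\<^esub>"
    and d: "((\<phi> \<circ> \<sigma>) has_vector_derivative v) (at (0::real))"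
  shows "((\<lambda>t. \<phi> (a \<otimes>\<^bsub>G\<^esub> \<sigma> t \<otimes>\<^bsub>G\<^esub> inv\<^bsub>G\<^esub> a)) has_vector_derivative Adj a v) (at 0)"
proof -
  let ?c = "\<lambda>a p. \<phi> (a \<otimes>\<^bsub>G\<^esub> \<psi> p \<otimes>\<^bsub>G\<^esub> inv\<^bsub>G\<^esub> a)"
  have "(?c a has_derivative Adj a) (at ((\<phi> \<circ> \<sigma>) 0))"
    using Ad_has_derivative[OF a] \<sigma>(2) by (simp add: org_def)
  then have "((\<lambda>t. ?c a ((\<phi> \<circ> \<sigma>) t)) has_derivative (\<lambda>t. Adj a (t *\<^sub>R v))) (at 0)"
    using has_derivative_compose d[unfolded has_vector_derivative_def] by blast
  then have "((\<lambda>t. ?c a ((\<phi> \<circ> \<sigma>) t)) has_vector_derivative Adj a v) (at 0)"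
    by (simp add: has_vector_derivative_def linear_scale[OF Ad_linear[OF a]])
  moreover have ev: "\<forall>\<^sub>F t in nhds 0. ?c a ((\<phi> \<circ> \<sigma>) t) = \<phi> (a \<otimes>\<^bsub>G\<^esub> \<sigma> t \<otimes>\<^bsub>G\<^esub> inv\<^bsub>G\<^esub> a)"
    using \<sigma>(1) by (rule eventually_mono) (simp add: psi_phi)
  ultimately show ?thesis
    unfolding has_vector_derivative_def
    by (elim has_derivative_transform_eventually) (use ev in \<open>auto simp: eventually_nhds_conv_at\<close>)
qed

end

lemma isCont_tendsto_nhds: "isCont f a \<Longrightarrow> (f \<longlongrightarrow> f a) (nhds a)"
  by (simp add: isCont_def tendsto_at_iff_tendsto_nhds[symmetric])

text \<open>\<open>Ck_on\<close> controls derivatives along each fixed direction only. This bound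
  turns finitely many estimates on basis vectors into one for all vectors, at the price of a factor
  \<open>DIM('a)\<close>.\<close>

lemma linear_basis_bound:
  fixes L :: "'a::euclidean_space \<Rightarrow> 'b::real_normed_vector"
  assumes "linear L" "\<And>b. b \<in> Basis \<Longrightarrow> norm (L b) \<le> c"
  shows "norm (L v) \<le> real DIM('a) * c * norm v"
proof -
  have "L v = L (\<Sum>b\<in>Basis. (v \<bullet> b) *\<^sub>R b)" by (simp add: euclidean_representation)
  also have "\<dots> = (\<Sum>b\<in>Basis. (v \<bullet> b) *\<^sub>R L b)" using assms(1) by (simp add: linear_sum linear_scale)
  finally have "norm (L v) \<le> (\<Sum>b\<in>Basis. norm ((v \<bullet> b) *\<^sub>R L b))" using norm_sum by metis
  also have "\<dots> \<le> (\<Sum>b\<in>(Basis :: 'a set). norm v * c)"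
  proof (rule sum_mono)
    fix b :: 'a assume b: "b \<in> Basis"
    then show "norm ((v \<bullet> b) *\<^sub>R L b) \<le> norm v * c"
      using assms(2)[OF b] Basis_le_norm[OF b, of v] by (simp add: mult_mono)
  qed
  finally show ?thesis by (simp add: mult_ac)
qed

section \<open>Multiplication near the identity in coordinates\<close>

context lie_chart
begin

definition mdom :: "('m \<times> 'm) set" where
  "mdom = {z. fst z \<in> \<phi> ` U \<and> snd z \<in> \<phi> ` U \<and> \<psi> (fst z) \<otimes>\<^bsub>G\<^esub> \<psi> (snd z) \<in> U}"
definition \<mu> :: "'m \<times> 'm \<Rightarrow> 'm" where "\<mu> z = \<phi> (\<psi> (fst z) \<otimes>\<^bsub>G\<^esub> \<psi> (snd z))"
definition \<mu>' :: "'m \<times> 'm \<Rightarrow> 'm \<times> 'm \<Rightarrow> 'm" where "\<mu>' z = frechet_derivative \<mu> (at z)"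

lemma open_mdom: "open mdom"
  using mult_chart(1)[OF UA UA UA] by (simp add: mdom_def \<psi>_def)

lemma
  shows mu_has_derivative: "z \<in> mdom \<Longrightarrow> (\<mu> has_derivative \<mu>' z) (at z)"
    and mu'_differentiable: "z \<in> mdom \<Longrightarrow> (\<lambda>z. \<mu>' z v) differentiable (at z)"
proof -
  have "Ck_on (Suc (Suc 0)) mdom \<mu>"
    using mult_chart(2)[OF UA UA UA] unfolding smooth_on_def mdom_def \<mu>_def \<psi>_def by blast
  then obtain f' where f': "\<And>x. x \<in> mdom \<Longrightarrow> (\<mu> has_derivative f' x) (at x)"
    "\<And>v. Ck_on (Suc 0) mdom (\<lambda>x. f' x v)" by auto
  have eq: "f' x = \<mu>' x" if "x \<in> mdom" for x
    unfolding \<mu>'_def by (rule frechet_derivative_at[OF f'(1)[OF that]])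
  show "(\<mu> has_derivative \<mu>' z) (at z)" if "z \<in> mdom" using f'(1)[OF that] eq[OF that] by simp
  have "Ck_on (Suc 0) mdom (\<lambda>x. \<mu>' x v)"
    by (rule Ck_on_cong[OF open_mdom _ f'(2)]) (simp add: eq)
  then show "(\<lambda>z. \<mu>' z v) differentiable (at z)" if "z \<in> mdom" using that by (auto simp: differentiable_def)
qed

lemma org_mdom: "(org, org) \<in> mdom" using org_in psi_org oneU by (simp add: mdom_def)

lemma mu_org: "p \<in> \<phi> ` U \<Longrightarrow> \<mu> (p, org) = p" "p \<in> \<phi> ` U \<Longrightarrow> \<mu> (org, p) = p"
  by (simp_all add: \<mu>_def psi_org phi_psi psi_carrier)

lemma mu'_linear: "z \<in> mdom \<Longrightarrow> linear (\<mu>' z)"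
  using mu_has_derivative has_derivative_linear by blast

lemma mu'_snd: "\<mu>' (org, org) (0, v) = v"
proof -
  have "(\<mu> has_derivative \<mu>' (org, org)) (at (org, org))" by (rule mu_has_derivative[OF org_mdom])
  then have "((\<lambda>q. \<mu> (org, q)) has_derivative (\<lambda>v. \<mu>' (org, org) (0, v))) (at org)"
    using has_derivative_compose[OF has_derivative_Pair[OF has_derivative_const has_derivative_ident], of \<mu> _ org org UNIV]
    by simp
  moreover have "((\<lambda>q. \<mu> (org, q)) has_derivative (\<lambda>v. v)) (at org)"
    by (rule has_derivative_transform_within_open[OF has_derivative_ident chart_open[OF UA] org_in])
      (simp add: mu_org)
  ultimately show ?thesis using has_derivative_unique by metis
qed

lemma inv_differentiable: "(\<lambda>p. \<phi> (inv\<^bsub>G\<^esub> (\<psi> p))) differentiable (at org)"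
proof -
  have "smooth_on (\<phi> ` {x \<in> U. inv\<^bsub>G\<^esub> x \<in> U}) (\<phi> \<circ> (\<lambda>a. inv\<^bsub>G\<^esub> a) \<circ> inv_into U \<phi>)"
    using lg UA unfolding lie_group_def smooth_map_def by fast
  then have "Ck_on (Suc 0) (\<phi> ` {x \<in> U. inv\<^bsub>G\<^esub> x \<in> U}) (\<lambda>p. \<phi> (inv\<^bsub>G\<^esub> (\<psi> p)))"
    unfolding smooth_on_def \<psi>_def by (simp only: o_def)
  then obtain f' where "\<And>p. p \<in> \<phi> ` {x \<in> U. inv\<^bsub>G\<^esub> x \<in> U} \<Longrightarrow> ((\<lambda>p. \<phi> (inv\<^bsub>G\<^esub> (\<psi> p))) has_derivative f' p) (at p)"
    by auto
  moreover have "org \<in> \<phi> ` {x \<in> U. inv\<^bsub>G\<^esub> x \<in> U}" using oneU by (auto simp: org_def)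
  ultimately show ?thesis unfolding differentiable_def by blast
qed

text \<open>For elements near the identity, left multiplication by \<open>\<psi> p\<close> and right
  multiplication by its inverse can both be written with \<open>\<mu>\<close> in the single chart U;
  the chain rule then exhibits the dependence of \<open>Ad\<close> on p.\<close>

lemma Ad_psi_formula:
  assumes p: "(p, org) \<in> mdom" "p \<in> \<phi> ` U" "inv\<^bsub>G\<^esub> (\<psi> p) \<in> U"
  shows "Adj (\<psi> p) y = \<mu>' (p, \<phi> (inv\<^bsub>G\<^esub> (\<psi> p))) (\<mu>' (p, org) (0, y), 0)"
proof -
  let ?i = "\<phi> (inv\<^bsub>G\<^esub> (\<psi> p))"
  have pc: "\<psi> p \<in> carrier G" using psi_carrier p by blast
  have i: "?i \<in> \<phi> ` U" "\<psi> ?i = inv\<^bsub>G\<^esub> (\<psi> p)" using p psi_phi by auto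
  have pi: "(p, ?i) \<in> mdom" using i p pc oneU by (simp add: mdom_def)
  have 1: "((\<lambda>q. \<mu> (p, q)) has_derivative (\<lambda>y. \<mu>' (p, org) (0, y))) (at org)"
    using has_derivative_compose[OF has_derivative_Pair[OF has_derivative_const has_derivative_ident], of \<mu> _ p org UNIV]
      mu_has_derivative[OF p(1)] by simp
  have 2: "((\<lambda>q. \<mu> (q, ?i)) has_derivative (\<lambda>y. \<mu>' (p, ?i) (y, 0))) (at (\<mu> (p, org)))"
    using has_derivative_compose[OF has_derivative_Pair[OF has_derivative_ident has_derivative_const], of \<mu> _ p ?i UNIV]
      mu_has_derivative[OF pi] by (simp add: mu_org p)
  have 3: "((\<lambda>q. \<mu> (\<mu> (p, q), ?i)) has_derivative (\<lambda>y. \<mu>' (p, ?i) (\<mu>' (p, org) (0, y), 0))) (at org)"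
    by (rule has_derivative_compose[OF 1 2])
  have "\<forall>\<^sub>F q in nhds org. q \<in> \<phi> ` U \<and> \<psi> p \<otimes>\<^bsub>G\<^esub> \<psi> q \<in> U"
    by (rule ev_psi_map[OF lmult_cont[OF pc] chart_openin[OF UA]]) (use p psi_in pc in simp)
  then have "\<forall>\<^sub>F q in nhds org. \<mu> (\<mu> (p, q), ?i) = \<phi> (\<psi> p \<otimes>\<^bsub>G\<^esub> \<psi> q \<otimes>\<^bsub>G\<^esub> inv\<^bsub>G\<^esub> (\<psi> p))"
    by (rule eventually_mono) (simp add: \<mu>_def i psi_phi)
  then have "Adj (\<psi> p) = (\<lambda>y. \<mu>' (p, ?i) (\<mu>' (p, org) (0, y), 0))"
    by (intro Ad_unique[OF pc 3])
  then show ?thesis by simp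
qed

text \<open>In \<open>Ad_psi_formula\<close> both the point at which \<open>\<mu>'\<close> is taken
  and the vector fed to it vary with p. Expanding the vector in the basis leaves
  \<open>\<mu>'\<close> with fixed directions, for which differentiability is known.\<close>

lemma Ad_psi_differentiable: "(\<lambda>p. Adj (\<psi> p) y) differentiable (at org)"
proof -
  let ?i = "\<lambda>p. \<phi> (inv\<^bsub>G\<^esub> (\<psi> p))"
  let ?L = "\<lambda>p. \<mu>' (p, org) (0, y)"
  let ?R = "\<lambda>b p. \<mu>' (p, ?i p) (b, 0)"
  have io: "?i org = org" by (simp add: psi_org) (simp add: org_def)
  have dL: "?L differentiable (at org)"
    by (rule differentiable_compose[of "\<lambda>z. \<mu>' z (0, y)" "\<lambda>p. (p, org)" org UNIV])
      (simp_all add: mu'_differentiable[OF org_mdom] differentiable_Pair_const)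
  have "(\<lambda>p. (p, ?i p)) differentiable (at org)"
    using inv_differentiable has_derivative_Pair[OF has_derivative_ident] unfolding differentiable_def by blast
  then have dR: "?R b differentiable (at org)" for b
    by (intro differentiable_compose[of "\<lambda>z. \<mu>' z (b, 0)" "\<lambda>p. (p, ?i p)" org UNIV])
      (simp_all only: io mu'_differentiable[OF org_mdom])
  have "(\<lambda>p. \<Sum>b\<in>Basis. (?L p \<bullet> b) *\<^sub>R ?R b p) differentiable (at org)"
    by (intro differentiable_sum ballI differentiable_scaleR differentiable_inner dL dR) auto
  then obtain f' where f': "((\<lambda>p. \<Sum>b\<in>Basis. (?L p \<bullet> b) *\<^sub>R ?R b p) has_derivative f') (at org)"
    by (auto simp: differentiable_def)
  have ev1: "\<forall>\<^sub>F p in nhds org. p \<in> \<phi> ` U \<and> inv\<^bsub>G\<^esub> (\<psi> p) \<in> U"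
    by (rule ev_psi_map[OF inv_cont chart_openin[OF UA]]) (simp add: oneU)
  have ev: "\<forall>\<^sub>F p in nhds org. (\<Sum>b\<in>Basis. (?L p \<bullet> b) *\<^sub>R ?R b p) = Adj (\<psi> p) y"
    using ev1
  proof (rule eventually_mono)
    fix p assume p: "p \<in> \<phi> ` U \<and> inv\<^bsub>G\<^esub> (\<psi> p) \<in> U"
    have po: "(p, org) \<in> mdom" using p org_in psi_in[of p] by (simp add: mdom_def psi_org psi_carrier)
    have "(p, ?i p) \<in> mdom" using p oneU by (simp add: mdom_def psi_phi psi_carrier)
    then have "linear (\<mu>' (p, ?i p))" by (rule mu'_linear)
    then have l: "linear (\<lambda>y. \<mu>' (p, ?i p) (y, 0))"
      unfolding linear_iff by (metis add.right_neutral add_Pair scaleR_Pair scaleR_zero_right)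
    have "\<mu>' (p, ?i p) (?L p, 0) = \<mu>' (p, ?i p) (\<Sum>b\<in>Basis. (?L p \<bullet> b) *\<^sub>R b, 0)"
      by (simp add: euclidean_representation)
    also have "\<dots> = (\<Sum>b\<in>Basis. (?L p \<bullet> b) *\<^sub>R ?R b p)"
      by (subst linear_sum[OF l, unfolded o_def]) (simp add: linear_scale[OF l])
    finally show "(\<Sum>b\<in>Basis. (?L p \<bullet> b) *\<^sub>R ?R b p) = Adj (\<psi> p) y"
      using Ad_psi_formula[OF po, of y] p by simp
  qed
  have "((\<lambda>p. Adj (\<psi> p) y) has_derivative f') (at org)"
    by (rule has_derivative_transform_eventually[OF f'])
      (use ev in \<open>auto simp: eventually_nhds_conv_at\<close>)
  then show ?thesis by (auto simp: differentiable_def)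
qed

lemma mu'_estimate:
  assumes e: "\<epsilon> > 0"
  obtains \<delta> where "\<delta> > 0" "\<And>u v. norm u \<le> \<delta> \<Longrightarrow> norm v \<le> \<delta> \<Longrightarrow>
      (org + u, org + v) \<in> mdom \<and> (\<forall>h. norm (\<mu>' (org + u, org + v) (0, h) - h) \<le> \<epsilon> * norm h)"
proof -
  \<comment> \<open>Compensates for the factor lost in \<open>linear_basis_bound\<close>.\<close>
  define c where "c = \<epsilon> / real DIM('m)"
  have c: "c > 0" using e by (simp add: c_def)
  have "\<forall>\<^sub>F z in nhds (org, org). norm (\<mu>' z (0, b) - b) < c" for b
  proof -
    have "((\<lambda>z. \<mu>' z (0, b)) \<longlongrightarrow> \<mu>' (org, org) (0, b)) (nhds (org, org))"
      by (rule isCont_tendsto_nhds[OF differentiable_imp_continuous_within[OF mu'_differentiable[OF org_mdom]]])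
    then show ?thesis using tendstoD[OF _ c] by (fastforce simp: mu'_snd dist_norm)
  qed
  then have "\<forall>\<^sub>F z in nhds (org, org). \<forall>b\<in>Basis. norm (\<mu>' z (0, b) - b) < c"
    by (simp add: eventually_ball_finite_distrib)
  moreover have "\<forall>\<^sub>F z in nhds (org, org). z \<in> mdom"
    using open_mdom org_mdom by (auto simp: eventually_nhds)
  ultimately have "\<forall>\<^sub>F z in nhds (org, org). z \<in> mdom \<and> (\<forall>b\<in>Basis. norm (\<mu>' z (0, b) - b) < c)"
    by (simp add: eventually_conj_iff)
  then obtain d where d: "d > 0" "\<And>z. dist z (org, org) < d \<Longrightarrow> z \<in> mdom \<and> (\<forall>b\<in>Basis. norm (\<mu>' z (0, b) - b) < c)"
    unfolding eventually_nhds_metric by blast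
  show thesis
  proof (rule that[of "d / 3"])
    show "d / 3 > 0" using d by simp
    fix u v :: 'm assume u: "norm u \<le> d / 3" and v: "norm v \<le> d / 3"
    have "dist (org + u, org + v) (org, org) \<le> norm u + norm v"
      by (simp add: dist_norm norm_Pair sqrt_sum_squares_le_sum)
    also have "\<dots> < d" using u v d(1) by simp
    finally have n: "(org + u, org + v) \<in> mdom" "\<And>b. b \<in> Basis \<Longrightarrow> norm (\<mu>' (org + u, org + v) (0, b) - b) \<le> c"
      using d(2) by (auto intro: less_imp_le)
    have l: "linear (\<lambda>h. \<mu>' (org + u, org + v) (0, h) - h)"
      using mu'_linear[OF n(1)] unfolding linear_iff
      by (metis (no_types, lifting) add_Pair add_diff_add scaleR_Pair scaleR_diff_right scaleR_zero_right add.right_neutral)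
    have "norm (\<mu>' (org + u, org + v) (0, h) - h) \<le> \<epsilon> * norm h" for h
      using linear_basis_bound[OF l n(2), of h] by (simp add: c_def)
    then show "(org + u, org + v) \<in> mdom \<and> (\<forall>h. norm (\<mu>' (org + u, org + v) (0, h) - h) \<le> \<epsilon> * norm h)"
      using n(1) by blast
  qed
qed

text \<open>Mean value inequality for w \<mapsto> \<mu> (org + u, org + w) - w between 0 and v. The
  error is proportional to v alone, however large u is within \<delta>; this lets errors add up
  linearly over a product of many small factors.\<close>

lemma mult_estimate:
  assumes e: "\<epsilon> > 0"
  obtains \<delta> where "\<delta> > 0" "\<And>u v. norm u \<le> \<delta> \<Longrightarrow> norm v \<le> \<delta> \<Longrightarrow>
      (org + u, org + v) \<in> mdom \<and> norm (\<mu> (org + u, org + v) - org - u - v) \<le> \<epsilon> * norm v"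
proof -
  obtain d where d: "d > 0" "\<And>u v. norm u \<le> d \<Longrightarrow> norm v \<le> d \<Longrightarrow>
      (org + u, org + v) \<in> mdom \<and> (\<forall>h. norm (\<mu>' (org + u, org + v) (0, h) - h) \<le> \<epsilon> * norm h)"
    using mu'_estimate[OF e] by metis
  show thesis
  proof (rule that[of d])
    fix u v :: 'm assume u: "norm u \<le> d" and v: "norm v \<le> d"
    have near: "(org + u, org + w) \<in> mdom" "\<And>h. norm (\<mu>' (org + u, org + w) (0, h) - h) \<le> \<epsilon> * norm h"
      if "w \<in> cball 0 d" for w using d(2)[OF u, of w] that by auto
    let ?g = "\<lambda>w. \<mu> (org + u, org + w) - w"
    have "norm (?g v - ?g 0) \<le> \<epsilon> * norm (v - 0)"
    proof (rule differentiable_bound)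
      show "convex (cball (0::'m) d)" by simp
      show "(?g has_derivative (\<lambda>h. \<mu>' (org + u, org + w) (0, h) - h)) (at w within cball 0 d)"
        if "w \<in> cball 0 d" for w
      proof (rule has_derivative_at_withinI)
        have "((\<lambda>w. (org + u, org + w)) has_derivative (\<lambda>h. (0, h))) (at w)"
          by (auto intro!: derivative_eq_intros)
        from has_derivative_compose[OF this mu_has_derivative[OF near(1)[OF that]]]
        show "(?g has_derivative (\<lambda>h. \<mu>' (org + u, org + w) (0, h) - h)) (at w)"
          by (intro has_derivative_diff has_derivative_ident)
      qed
      show "onorm (\<lambda>h. \<mu>' (org + u, org + w) (0, h) - h) \<le> \<epsilon>" if "w \<in> cball 0 d" for w
        by (rule onorm_bound) (use e near(2)[OF that] in auto)
    qed (use v d in auto)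
    moreover have "?g 0 = org + u"
    proof -
      have "org + u \<in> \<phi> ` U" using near(1)[of 0] d(1) by (simp add: mdom_def)
      then show ?thesis by (simp add: mu_org)
    qed
    ultimately show "(org + u, org + v) \<in> mdom \<and> norm (\<mu> (org + u, org + v) - org - u - v) \<le> \<epsilon> * norm v"
      using near(1)[of v] v by (simp add: algebra_simps)
  qed (rule d(1))
qed

section \<open>The bracket as the derivative of the adjoint representation\<close>

abbreviation bra where "bra \<equiv> lie_bracket G U \<phi>"

lemma Ad_psi_has_derivative: "((\<lambda>p. Adj (\<psi> p) y) has_derivative (\<lambda>x. bra x y)) (at org)"
  using Ad_psi_differentiable unfolding lie_bracket_def org_def \<psi>_def
  by (subst (asm) frechet_derivative_works) simp

text \<open>In the first argument the bracket is a derivative and so linear; in the second it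
  inherits linearity from \<open>Ad\<close>, by uniqueness of derivatives.\<close>

lemma bra_bilinear: "bilinear bra"
  unfolding bilinear_def
proof (intro conjI allI)
  show "linear (\<lambda>x. bra x y)" for y using Ad_psi_has_derivative has_derivative_linear by blast
  have ev: "\<forall>\<^sub>F p in nhds org. p \<in> \<phi> ` U" using chart_open[OF UA] org_in by (auto simp: eventually_nhds)
  fix x show "linear (\<lambda>y. bra x y)"
  proof (rule linearI)
    fix y z
    have "((\<lambda>p. Adj (\<psi> p) (y + z)) has_derivative (\<lambda>x. bra x y + bra x z)) (at org)"
      by (rule has_derivative_transform_eventually[OF has_derivative_add[OF Ad_psi_has_derivative Ad_psi_has_derivative]])
        (use ev in \<open>auto simp: eventually_at_filter linear_add[OF Ad_linear[OF psi_carrier]] org_in elim: eventually_mono\<close>)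
    then show "bra x (y + z) = bra x y + bra x z"
      using has_derivative_unique[OF Ad_psi_has_derivative] by metis
  next
    fix r y
    have "((\<lambda>p. Adj (\<psi> p) (r *\<^sub>R y)) has_derivative (\<lambda>x. r *\<^sub>R bra x y)) (at org)"
      by (rule has_derivative_transform_eventually[OF has_derivative_scaleR_right[OF Ad_psi_has_derivative]])
        (use ev in \<open>auto simp: eventually_at_filter linear_scale[OF Ad_linear[OF psi_carrier]] org_in elim: eventually_mono\<close>)
    then show "bra x (r *\<^sub>R y) = r *\<^sub>R bra x y"
      using has_derivative_unique[OF Ad_psi_has_derivative] by metis
  qed
qed

text \<open>Conjugating \<open>\<psi> p\<close> by a conjugates \<open>Ad (\<psi> p)\<close> by
  \<open>Ad a\<close>. Both sides of the claim are derivatives of this identity at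
  \<open>org\<close>, applied to \<open>Ad a y\<close>.\<close>

lemma Ad_bra:
  assumes a: "a \<in> carrier G"
  shows "Adj a (bra x y) = bra (Adj a x) (Adj a y)"
proof -
  let ?c = "\<lambda>p. \<phi> (a \<otimes>\<^bsub>G\<^esub> \<psi> p \<otimes>\<^bsub>G\<^esub> inv\<^bsub>G\<^esub> a)"
  let ?y = "Adj a y"
  have co: "?c org = org" using a by (simp add: psi_org) (simp add: org_def)
  have 1: "((\<lambda>p. Adj (\<psi> (?c p)) ?y) has_derivative (\<lambda>x. bra (Adj a x) ?y)) (at org)"
    by (rule has_derivative_compose[OF Ad_has_derivative[OF a]]) (simp only: co Ad_psi_has_derivative)
  have bl: "bounded_linear (Adj a)" using Ad_linear[OF a] by (simp add: linear_conv_bounded_linear)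
  have 2: "((\<lambda>p. Adj a (Adj (\<psi> p) y)) has_derivative (\<lambda>x. Adj a (bra x y))) (at org)"
    by (rule bounded_linear.has_derivative[OF bl Ad_psi_has_derivative])
  have ev: "\<forall>\<^sub>F p in nhds org. Adj (\<psi> (?c p)) ?y = Adj a (Adj (\<psi> p) y)"
    using ev_conj[OF a]
  proof (rule eventually_mono)
    fix p assume p: "p \<in> \<phi> ` U \<and> a \<otimes>\<^bsub>G\<^esub> \<psi> p \<otimes>\<^bsub>G\<^esub> inv\<^bsub>G\<^esub> a \<in> U"
    then have pc: "\<psi> p \<in> carrier G" using psi_carrier by blast
    have "Adj (a \<otimes>\<^bsub>G\<^esub> \<psi> p \<otimes>\<^bsub>G\<^esub> inv\<^bsub>G\<^esub> a) ?y = Adj a (Adj (\<psi> p) (Adj (inv\<^bsub>G\<^esub> a) ?y))"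
      using a pc by (simp add: Ad_mult)
    then show "Adj (\<psi> (?c p)) ?y = Adj a (Adj (\<psi> p) y)" using p a by (simp add: psi_phi Ad_inv)
  qed
  have "((\<lambda>p. Adj a (Adj (\<psi> p) y)) has_derivative (\<lambda>x. bra (Adj a x) ?y)) (at org)"
    by (rule has_derivative_transform_eventually[OF 1]) (use ev in \<open>auto simp: eventually_nhds_conv_at\<close>)
  then show ?thesis using has_derivative_unique[OF 2] by metis
qed

lemma bra_bounded_bilinear: "bounded_bilinear bra"
  using bra_bilinear by (simp add: bilinear_conv_bounded_bilinear)

text \<open>The infinitesimal form of \<open>Ad_bra\<close>: both sides are differentiated in the
  group element at the identity.\<close>

lemma bra_jacobi: "bra z (bra x y) = bra (bra z x) y + bra x (bra z y)"
proof -
  have "((\<lambda>p. bra (Adj (\<psi> p) x) (Adj (\<psi> p) y)) has_derivative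
      (\<lambda>z. bra (Adj (\<psi> org) x) (bra z y) + bra (bra z x) (Adj (\<psi> org) y))) (at org)"
    by (rule bounded_bilinear.FDERIV[OF bra_bounded_bilinear Ad_psi_has_derivative Ad_psi_has_derivative])
  then have 1: "((\<lambda>p. bra (Adj (\<psi> p) x) (Adj (\<psi> p) y)) has_derivative
      (\<lambda>z. bra x (bra z y) + bra (bra z x) y)) (at org)" by (simp add: psi_org Ad_one)
  have ev: "\<forall>\<^sub>F p in nhds org. p \<in> \<phi> ` U" using chart_open[OF UA] org_in by (auto simp: eventually_nhds)
  have "((\<lambda>p. Adj (\<psi> p) (bra x y)) has_derivative
      (\<lambda>z. bra x (bra z y) + bra (bra z x) y)) (at org)"
    by (rule has_derivative_transform_eventually[OF 1])
      (use ev in \<open>auto simp: eventually_at_filter Ad_bra psi_carrier org_in elim: eventually_mono\<close>)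
  from fun_cong[OF has_derivative_unique[OF Ad_psi_has_derivative this], of z]
  show ?thesis by (simp add: add.commute)
qed

text \<open>Differentiability of \<open>Ad\<close> gives continuity at the identity; left
  translation by a carries it to a.\<close>

lemma Ad_continuous: "continuous_map X euclidean (\<lambda>a. Adj a y)"
  unfolding continuous_map_def
proof (intro conjI allI impI)
  fix O' :: "'m set" assume O': "openin euclidean O'"
  show "openin X {a \<in> topspace X. Adj a y \<in> O'}"
  proof (subst openin_subopen, intro ballI)
    fix a assume "a \<in> {a \<in> topspace X. Adj a y \<in> O'}"
    then have a: "a \<in> carrier G" "Adj a y \<in> O'" by (auto simp: topspace_eq)
    have bl: "bounded_linear (Adj a)" using Ad_linear[OF a(1)] by (simp add: linear_conv_bounded_linear)
    have "isCont (\<lambda>p. Adj (\<psi> p) y) org" using has_derivative_continuous[OF Ad_psi_has_derivative] by simp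
    then have "isCont (\<lambda>p. Adj a (Adj (\<psi> p) y)) org" by (rule bounded_linear.isCont[OF bl])
    then have "((\<lambda>p. Adj a (Adj (\<psi> p) y)) \<longlongrightarrow> Adj a y) (nhds org)"
      using isCont_tendsto_nhds by (fastforce simp: psi_org Ad_one)
    then have "\<forall>\<^sub>F p in nhds org. Adj a (Adj (\<psi> p) y) \<in> O'"
      using O' a(2) by (auto simp: tendsto_def)
    then obtain S where S: "open S" "org \<in> S" "\<And>p. p \<in> S \<Longrightarrow> Adj a (Adj (\<psi> p) y) \<in> O'"
      by (auto simp: eventually_nhds)
    let ?W = "{b \<in> U. \<phi> b \<in> S}"
    have W: "openin X ?W" by (rule openin_chart_vimage) (use S in simp)
    let ?T = "{c \<in> topspace X. inv\<^bsub>G\<^esub> a \<otimes>\<^bsub>G\<^esub> c \<in> ?W}"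
    have "openin X ?T" by (rule openin_continuous_map_preimage[OF lmult_cont W]) (use a in simp)
    moreover have "a \<in> ?T" using a oneU S(2) by (simp add: topspace_eq org_def)
    moreover have "?T \<subseteq> {a \<in> topspace X. Adj a y \<in> O'}"
    proof
      fix c assume c: "c \<in> ?T"
      then have cc: "c \<in> carrier G" by (simp add: topspace_eq)
      have "Adj a (Adj (\<psi> (\<phi> (inv\<^bsub>G\<^esub> a \<otimes>\<^bsub>G\<^esub> c))) y) \<in> O'" using S(3) c by blast
      moreover have "\<psi> (\<phi> (inv\<^bsub>G\<^esub> a \<otimes>\<^bsub>G\<^esub> c)) = inv\<^bsub>G\<^esub> a \<otimes>\<^bsub>G\<^esub> c" using c psi_phi by blast
      ultimately have "Adj c y \<in> O'" using a cc by (simp add: Ad_mult Ad_inv)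
      then show "c \<in> {a \<in> topspace X. Adj a y \<in> O'}" using c by simp
    qed
    ultimately show "\<exists>T. openin X T \<and> a \<in> T \<and> T \<subseteq> {a \<in> topspace X. Adj a y \<in> O'}" by blast
  qed
qed auto

text \<open>The clauses agree with those in \<open>subgroup_lie_algebra\<close>. A derivative is
  demanded at 0 only; the homomorphism property propagates it through \<open>Ad\<close>.\<close>

definition one_param :: "(real \<Rightarrow> 'g) \<Rightarrow> 'm \<Rightarrow> bool" where
  "one_param \<gamma> w \<longleftrightarrow> continuous_map euclideanreal X \<gamma> \<and> (\<forall>s t. \<gamma> (s + t) = \<gamma> s \<otimes>\<^bsub>G\<^esub> \<gamma> t) \<and>
     ((\<phi> \<circ> \<gamma>) has_vector_derivative w) (at 0)"

lemma one_param_carrier: "one_param \<gamma> w \<Longrightarrow> \<gamma> t \<in> carrier G"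
  by (auto simp: one_param_def topspace_eq dest!: continuous_map_funspace)

lemma one_param_0: assumes "one_param \<gamma> w" shows "\<gamma> 0 = \<one>\<^bsub>G\<^esub>"
proof -
  have "\<gamma> 0 \<otimes>\<^bsub>G\<^esub> \<gamma> 0 = \<gamma> 0" using assms by (metis add.left_neutral one_param_def)
  then show ?thesis using one_param_carrier[OF assms] by (metis l_cancel_one')
qed

lemma ev_curve:
  assumes "continuous_map euclideanreal X \<gamma>" "openin X W" "\<gamma> s \<in> W"
  shows "\<forall>\<^sub>F t in nhds s. \<gamma> t \<in> W"
proof -
  have "openin euclideanreal {t \<in> topspace euclideanreal. \<gamma> t \<in> W}"
    by (rule openin_continuous_map_preimage[OF assms(1,2)])
  then have "open {t. \<gamma> t \<in> W}" by simp
  then show ?thesis using assms(3) by (auto simp: eventually_nhds)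
qed

lemma one_param_ev: "one_param \<gamma> w \<Longrightarrow> \<forall>\<^sub>F t in nhds 0. \<gamma> t \<in> U"
  using ev_curve[OF _ chart_openin[OF UA], of \<gamma> 0] by (simp add: one_param_0 oneU) (simp add: one_param_def)

text \<open>Splitting off the increment t - s on the left of \<open>\<gamma> s\<close> or on its
  right gives two forms of one derivative. The first is a linear differential equation for the
  curve, the second expresses it through the curve of the vector [w, y].\<close>

lemma one_param_Ad:
  assumes "one_param \<gamma> w"
  shows "((\<lambda>t. Adj (\<gamma> t) y) has_vector_derivative bra w (Adj (\<gamma> s) y)) (at s)"
    and "((\<lambda>t. Adj (\<gamma> t) y) has_vector_derivative Adj (\<gamma> s) (bra w y)) (at s)"
proof -
  note c = one_param_carrier[OF assms]
  have *: "((\<lambda>t. Adj (\<gamma> t) y) has_vector_derivative bra w y) (at 0)" for y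
  proof -
    have d: "((\<phi> \<circ> \<gamma>) has_derivative (\<lambda>t. t *\<^sub>R w)) (at 0)"
      using assms by (simp add: one_param_def has_vector_derivative_def)
    have "((\<lambda>p. Adj (\<psi> p) y) has_derivative (\<lambda>x. bra x y)) (at ((\<phi> \<circ> \<gamma>) 0))"
      using Ad_psi_has_derivative one_param_0[OF assms] by (simp add: org_def)
    from has_derivative_compose[OF d this]
    have "((\<lambda>t. Adj (\<psi> ((\<phi> \<circ> \<gamma>) t)) y) has_derivative (\<lambda>t. t *\<^sub>R bra w y)) (at 0)"
      by (simp add: bilinear_lmul[OF bra_bilinear])
    moreover have "\<forall>\<^sub>F t in nhds 0. Adj (\<psi> ((\<phi> \<circ> \<gamma>) t)) y = Adj (\<gamma> t) y"
      using one_param_ev[OF assms] by (rule eventually_mono) (simp add: psi_phi)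
    ultimately show ?thesis unfolding has_vector_derivative_def
      by (elim has_derivative_transform_eventually) (auto simp: eventually_nhds_conv_at)
  qed
  have shift: "((\<lambda>t. f (t - s)) has_vector_derivative d) (at s)"
    if "(f has_vector_derivative d) (at 0)" for f :: "real \<Rightarrow> 'm" and d
  proof -
    have "((\<lambda>t. t - s) has_vector_derivative 1) (at s)" by (auto intro!: derivative_eq_intros)
    then show ?thesis using vector_diff_chain_at[of "\<lambda>t. t - s" 1 s f d] that by (simp add: o_def)
  qed
  have "\<gamma> t = \<gamma> (t - s) \<otimes>\<^bsub>G\<^esub> \<gamma> s" "\<gamma> t = \<gamma> s \<otimes>\<^bsub>G\<^esub> \<gamma> (t - s)" for t
    using assms by (metis one_param_def diff_add_cancel add.commute)+
  then have e: "Adj (\<gamma> t) y = Adj (\<gamma> (t - s)) (Adj (\<gamma> s) y)" "Adj (\<gamma> t) y = Adj (\<gamma> s) (Adj (\<gamma> (t - s)) y)" for t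
    using Ad_mult c by metis+
  show "((\<lambda>t. Adj (\<gamma> t) y) has_vector_derivative bra w (Adj (\<gamma> s) y)) (at s)"
    by (subst e(1)) (rule shift[OF *])
  have bl: "bounded_linear (Adj (\<gamma> s))" using Ad_linear[OF c] by (simp add: linear_conv_bounded_linear)
  show "((\<lambda>t. Adj (\<gamma> t) y) has_vector_derivative Adj (\<gamma> s) (bra w y)) (at s)"
    by (subst e(2)) (rule bounded_linear.has_vector_derivative[OF bl shift[OF *]])
qed

end

section \<open>One-parameter subgroups and the Killing form\<close>

text \<open>In a \<beta>-orthonormal basis E, skewness turns the trace of f o f into minus the sum
  of the squared \<beta>-lengths of f e, and some f e is nonzero.\<close>

lemma trace_square_neg:
  fixes \<beta> :: "'a::euclidean_space \<Rightarrow> 'a \<Rightarrow> real"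
  assumes bil: "bilinear \<beta>" and sym: "\<And>u v. \<beta> u v = \<beta> v u" and pos: "\<And>v. v \<noteq> 0 \<Longrightarrow> \<beta> v v > 0"
    and lin: "linear f" and skew: "\<And>u v. \<beta> (f u) v = - \<beta> u (f v)" and nz: "f v0 \<noteq> 0"
  shows "linear_trace (f \<circ> f) < 0"
proof -
  have lr: "linear (\<beta> u)" and ll: "linear (\<lambda>u. \<beta> u v)" for u v using bil by (auto simp: bilinear_def)
  define ON where "ON E \<longleftrightarrow> finite E \<and> (\<forall>e\<in>E. \<beta> e e = 1) \<and> (\<forall>e\<in>E. \<forall>d\<in>E. d \<noteq> e \<longrightarrow> \<beta> d e = 0)" for E
  have orth: "\<beta> (v - (\<Sum>d\<in>E. \<beta> v d *\<^sub>R d)) e = 0" if "ON E" "e \<in> E" for E v e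
  proof -
    have "\<beta> (\<Sum>d\<in>E. \<beta> v d *\<^sub>R d) e = (\<Sum>d\<in>E. \<beta> v d * \<beta> d e)"
      by (simp add: linear_sum[OF ll] linear_scale[OF ll])
    also have "\<dots> = (\<Sum>d\<in>E. if d = e then \<beta> v d else 0)"
      using that by (intro sum.cong) (auto simp: ON_def)
    also have "\<dots> = \<beta> v e" using that by (simp add: ON_def)
    finally show ?thesis by (simp add: linear_diff[OF ll])
  qed
  \<comment> \<open>Gram-Schmidt, one vector at a time: while fewer than the full number of vectors
    are chosen, some v lies outside their span, and subtracting its projection leaves a nonzero
    vector.\<close>
  have "\<exists>E. ON E \<and> card E = k" if "k \<le> DIM('a)" for k
    using that
  proof (induction k)
    case 0 then show ?case by (intro exI[of _ "{}"]) (simp add: ON_def)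
  next
    case (Suc k)
    then obtain E where E: "ON E" "card E = k" by auto
    have "dim (span E) \<le> card E" using E by (intro dim_le_card) (simp_all add: ON_def)
    then have "span E \<noteq> UNIV" using Suc.prems E by (metis Suc_le_lessD dim_UNIV not_le)
    then obtain v where v: "v \<notin> span E" by blast
    define w where "w = v - (\<Sum>d\<in>E. \<beta> v d *\<^sub>R d)"
    have "(\<Sum>d\<in>E. \<beta> v d *\<^sub>R d) \<in> span E" by (intro span_sum span_scale span_base)
    then have w0: "w \<noteq> 0" using v by (auto simp: w_def)
    define e where "e = (1 / sqrt (\<beta> w w)) *\<^sub>R w"
    have ee: "\<beta> e e = 1"
      using pos[OF w0] by (simp add: e_def linear_scale[OF lr] linear_scale[OF ll] field_simps)
    have eo: "\<beta> e d = 0" if "d \<in> E" for d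
      using orth[OF E(1) that, of v] by (simp add: e_def w_def[symmetric] linear_scale[OF ll])
    then have "e \<notin> E" using ee by auto
    moreover have "ON (insert e E)" using E(1) ee eo sym by (auto simp: ON_def)
    ultimately show ?case using E by (intro exI[of _ "insert e E"]) (simp add: ON_def)
  qed
  then obtain E where E: "ON E" "card E = DIM('a)" by blast
  have finE: "finite E" using E by (simp add: ON_def)
  have "independent E"
  proof
    assume "dependent E"
    then obtain u e where u: "e \<in> E" "u e \<noteq> 0" "(\<Sum>d\<in>E. u d *\<^sub>R d) = 0"
      using dependent_finite[OF finE] by auto
    have "\<beta> (\<Sum>d\<in>E. u d *\<^sub>R d) e = (\<Sum>d\<in>E. u d * \<beta> d e)"
      by (simp add: linear_sum[OF ll] linear_scale[OF ll])
    also have "\<dots> = (\<Sum>d\<in>E. if d = e then u d else 0)"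
      using E u by (intro sum.cong) (auto simp: ON_def)
    also have "\<dots> = u e" using E u by (simp add: ON_def)
    finally show False using u by (simp add: linear_0[OF ll])
  qed
  then have spE: "span E = UNIV" using E(2) by (metis dim_eq_card_independent dim_eq_full)
  have rep: "v = (\<Sum>d\<in>E. \<beta> v d *\<^sub>R d)" for v
  proof -
    let ?w = "v - (\<Sum>d\<in>E. \<beta> v d *\<^sub>R d)"
    have "\<beta> ?w ?w = 0"
      by (rule linear_eq_0_on_span[OF lr, of E]) (use orth[OF E(1)] spE in auto)
    then have "?w = 0" using pos[of ?w] by auto
    then show ?thesis by simp
  qed
  \<comment> \<open>Only the value f (f b) is expanded in E. After the sums are swapped, the
    Euclidean coordinates of e reassemble e, which carries the trace over to the basis E.\<close>
  have "linear_trace (f \<circ> f) = (\<Sum>b\<in>Basis. \<Sum>e\<in>E. \<beta> (f (f b)) e * (e \<bullet> b))"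
  proof -
    have "f (f b) \<bullet> b = (\<Sum>e\<in>E. \<beta> (f (f b)) e * (e \<bullet> b))" for b
      by (subst rep) (simp add: inner_sum_left)
    then show ?thesis by (simp add: linear_trace_def)
  qed
  also have "\<dots> = (\<Sum>e\<in>E. \<Sum>b\<in>Basis. (e \<bullet> b) * \<beta> (f (f b)) e)"
    by (subst sum.swap) (simp add: mult.commute)
  also have "\<dots> = (\<Sum>e\<in>E. \<beta> (f (f e)) e)"
  proof (rule sum.cong[OF refl])
    fix e assume "e \<in> E"
    have l: "linear (\<lambda>v. \<beta> (f (f v)) e)"
      using linear_compose[OF linear_compose[OF lin lin] ll] by (simp add: o_def)
    have "\<beta> (f (f e)) e = \<beta> (f (f (\<Sum>b\<in>Basis. (e \<bullet> b) *\<^sub>R b))) e" by (simp add: euclidean_representation)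
    also have "\<dots> = (\<Sum>b\<in>Basis. (e \<bullet> b) * \<beta> (f (f b)) e)"
      by (simp add: linear_sum[OF l] linear_scale[OF l])
    finally show "(\<Sum>b\<in>Basis. (e \<bullet> b) * \<beta> (f (f b)) e) = \<beta> (f (f e)) e" by simp
  qed
  also have "\<dots> = - (\<Sum>e\<in>E. \<beta> (f e) (f e))" by (simp add: skew sum_negf)
  finally have tr: "linear_trace (f \<circ> f) = - (\<Sum>e\<in>E. \<beta> (f e) (f e))" .
  have "\<exists>e\<in>E. f e \<noteq> 0"
  proof (rule ccontr)
    assume no: "\<not> ?thesis"
    have "f v0 = 0" by (rule linear_eq_0_on_span[OF lin, of E]) (use no spE in auto)
    then show False using nz by blast
  qed
  then obtain e0 where e0: "e0 \<in> E" "f e0 \<noteq> 0" by blast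
  have nn: "\<beta> v v \<ge> 0" for v using pos[of v] linear_0[OF lr] by (cases "v = 0") auto
  have "(\<Sum>e\<in>E. \<beta> (f e) (f e)) > 0"
    by (rule sum_pos2[OF finE e0(1)]) (use pos[OF e0(2)] nn in auto)
  then show ?thesis using tr by simp
qed

locale compact_lie_chart = lie_chart G X A U \<phi>
  for G :: "('g, 'b) monoid_scheme" and X :: "'g topology"
    and A :: "('g set \<times> ('g \<Rightarrow> 'm::euclidean_space)) set" and U :: "'g set" and \<phi> :: "'g \<Rightarrow> 'm" +
  assumes compact: "compact_space X" and semisimple: "semisimple_bracket (lie_bracket G U \<phi>)"
begin

section \<open>Existence of one-parameter subgroups\<close>

text \<open>Each further factor adds an error of at most \<epsilon> times norm u by
  \<open>mult_estimate\<close>, so k factors deviate from k u by at most k such terms. The factor 2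
  in the hypothesis keeps the partial products in range: with \<epsilon> \<le> 1 their displacement
  is at most twice that of k u.\<close>

lemma pow_estimate:
  assumes \<delta>: "\<And>u v. norm u \<le> \<delta> \<Longrightarrow> norm v \<le> \<delta> \<Longrightarrow>
      (org + u, org + v) \<in> mdom \<and> norm (\<mu> (org + u, org + v) - org - u - v) \<le> \<epsilon> * norm v"
    and e: "0 < \<epsilon>" "\<epsilon> \<le> 1" and u: "real k * 2 * norm u \<le> \<delta>"
  shows "\<psi> (org + u) [^]\<^bsub>G\<^esub> k \<in> U \<and>
    norm (\<phi> (\<psi> (org + u) [^]\<^bsub>G\<^esub> k) - org - real k *\<^sub>R u) \<le> \<epsilon> * (real k * norm u)"
  using u
proof (induction k)
  case 0 then show ?case by (simp add: oneU org_def)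
next
  case (Suc k)
  have s: "real k * 2 * norm u + 2 * norm u \<le> \<delta>" using Suc.prems by (simp add: algebra_simps)
  have nk: "norm u \<le> \<delta>" "real k * 2 * norm u \<le> \<delta>"
    using s norm_ge_zero[of u] mult_nonneg_nonneg[of "real k * 2" "norm u"] by linarith+
  note IH = Suc.IH[OF nk(2)]
  let ?a = "\<psi> (org + u)"
  define x where "x = \<phi> (?a [^]\<^bsub>G\<^esub> k) - org"
  have ax: "?a [^]\<^bsub>G\<^esub> k = \<psi> (org + x)" using IH psi_phi by (simp add: x_def)
  have "norm x \<le> norm (x - real k *\<^sub>R u) + norm (real k *\<^sub>R u)" using norm_triangle_ineq[of "x - real k *\<^sub>R u" "real k *\<^sub>R u"] by simp
  also have "\<dots> \<le> \<epsilon> * (real k * norm u) + real k * norm u" using IH by (simp add: x_def)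
  also have "\<dots> \<le> 1 * (real k * norm u) + real k * norm u" using e by (intro add_mono mult_right_mono) auto
  also have "\<dots> \<le> \<delta>" using nk by simp
  finally have xd: "norm x \<le> \<delta>" .
  note E = \<delta>[OF xd nk(1)]
  have mu: "\<mu> (org + x, org + u) = \<phi> (?a [^]\<^bsub>G\<^esub> Suc k)" by (simp add: \<mu>_def ax[symmetric])
  have "norm (\<phi> (?a [^]\<^bsub>G\<^esub> Suc k) - org - x - u) \<le> \<epsilon> * norm u" using E mu by simp
  moreover have "norm (x - real k *\<^sub>R u) \<le> \<epsilon> * (real k * norm u)" using IH by (simp add: x_def)
  moreover have "\<phi> (?a [^]\<^bsub>G\<^esub> Suc k) - org - real (Suc k) *\<^sub>R u
      = (\<phi> (?a [^]\<^bsub>G\<^esub> Suc k) - org - x - u) + (x - real k *\<^sub>R u)" by (simp add: algebra_simps)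
  ultimately have "norm (\<phi> (?a [^]\<^bsub>G\<^esub> Suc k) - org - real (Suc k) *\<^sub>R u) \<le> \<epsilon> * norm u + \<epsilon> * (real k * norm u)"
    by (metis norm_triangle_mono)
  moreover have "?a [^]\<^bsub>G\<^esub> Suc k \<in> U" using E by (simp add: mdom_def ax[symmetric])
  ultimately show ?case by (simp add: algebra_simps)
qed

lemma limitin_mult:
  assumes "limitin X f a F" "limitin X g b F"
  shows "limitin X (\<lambda>n. f n \<otimes>\<^bsub>G\<^esub> g n) (a \<otimes>\<^bsub>G\<^esub> b) F"
proof -
  have "limitin (prod_topology X X) (\<lambda>n. (f n, g n)) (a, b) F"
    using assms by (simp add: limitin_pairwise o_def)
  from continuous_map_limit[OF mult_cont this] show ?thesis by (simp add: o_def)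
qed

lemma limit_phi:
  assumes "limitin X f l F" "l \<in> U"
  shows "((\<lambda>n. \<phi> (f n)) \<longlongrightarrow> \<phi> l) F"
proof -
  have "\<forall>\<^sub>F n in F. f n \<in> U" using limitinD[OF assms(1) chart_openin[OF UA] assms(2)] .
  then have "limitin (subtopology X U) f l F" using assms by (simp add: limitin_subtopology)
  from continuous_map_limit[OF chart_cont[OF UA] this] show ?thesis by (simp add: o_def)
qed

lemma limit_psi:
  assumes "(f \<longlongrightarrow> p) F" "p \<in> \<phi> ` U"
  shows "limitin X (\<lambda>n. \<psi> (f n)) (\<psi> p) F"
proof -
  have "\<forall>\<^sub>F n in F. f n \<in> \<phi> ` U" using assms chart_open[OF UA] by (auto simp: tendsto_def)
  then have "limitin (top_of_set (\<phi> ` U)) f p F" using assms by (simp add: limitin_subtopology)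
  from continuous_map_limit[OF psi_cont this] show ?thesis by (simp add: o_def)
qed

text \<open>The curve at time t is the ultrafilter limit of the powers with exponent floor (n t) of
  the element with coordinates \<open>org + (1 / real n) *\<^sub>R w\<close>. Compactness of the
  group supplies the limits, and \<open>pow_estimate\<close> survives the limit and identifies the
  velocity.\<close>

lemma one_param_exists: obtains \<gamma> where "one_param \<gamma> w"
proof -
  obtain F :: "nat filter" where F: "F \<noteq> bot" "F \<le> sequentially"
    "\<And>P. eventually P F \<or> eventually (\<lambda>n. \<not> P n) F" by (rule ultrafilter_exists) blast
  \<comment> \<open>The value at indices where the point leaves the chart is arbitrary: along F this
    happens only finally not at all, see \<open>evU\<close>.\<close>
  define a where "a n = (if org + (1 / real n) *\<^sub>R w \<in> \<phi> ` U then \<psi> (org + (1 / real n) *\<^sub>R w) else \<one>\<^bsub>G\<^esub>)" for n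
  have ac: "a n \<in> carrier G" for n by (simp add: a_def psi_carrier)
  have lim0: "((\<lambda>n. (1 / real n) *\<^sub>R w) \<longlongrightarrow> 0) F"
  proof -
    have "((\<lambda>n. (1 / real n) *\<^sub>R w) \<longlongrightarrow> 0 *\<^sub>R w) sequentially"
      by (intro tendsto_scaleR tendsto_const lim_1_over_n)
    then show ?thesis using F(2) tendsto_mono by fastforce
  qed
  then have limo: "((\<lambda>n. org + (1 / real n) *\<^sub>R w) \<longlongrightarrow> org) F"
    using tendsto_add[OF tendsto_const lim0, of org] by simp
  then have evU: "\<forall>\<^sub>F n in F. org + (1 / real n) *\<^sub>R w \<in> \<phi> ` U"
    using org_in chart_open[OF UA] by (auto simp: tendsto_def)
  have lima: "limitin X a \<one>\<^bsub>G\<^esub> F"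
  proof (rule limitin_transform_eventually)
    show "\<forall>\<^sub>F n in F. \<psi> (org + (1 / real n) *\<^sub>R w) = a n"
      using evU by (rule eventually_mono) (simp add: a_def)
    show "limitin X (\<lambda>n. \<psi> (org + (1 / real n) *\<^sub>R w)) \<one>\<^bsub>G\<^esub> F" using limit_psi[OF limo org_in] by (simp add: psi_org)
  qed
  define g where "g n t = a n [^]\<^bsub>G\<^esub> \<lfloor>real n * t\<rfloor>" for n and t :: real
  have gc: "g n t \<in> topspace X" for n t using ac by (simp add: g_def topspace_eq)
  have "\<exists>l. limitin X (\<lambda>n. g n t) l F" for t
    using ultrafilter_limitin[OF F(3,1) compact, of "\<lambda>n. g n t"] gc by blast
  then obtain \<gamma> where lim: "\<And>t. limitin X (\<lambda>n. g n t) (\<gamma> t) F" by metis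
  have \<gamma>c: "\<gamma> t \<in> carrier G" for t using limitin_topspace[OF lim] topspace_eq by simp
  have uniq: "l1 = l2" if "limitin X f l1 F" "limitin X f l2 F" for f :: "nat \<Rightarrow> 'g" and l1 l2
    using limitin_Hausdorff_unique[OF that F(1) Hausdorff] .
  have hom: "\<gamma> (s + t) = \<gamma> s \<otimes>\<^bsub>G\<^esub> \<gamma> t" for s t
  proof -
    define e where "e n = \<lfloor>real n * (s + t)\<rfloor> - \<lfloor>real n * s\<rfloor> - \<lfloor>real n * t\<rfloor>" for n
    \<comment> \<open>The floor of a sum exceeds the sum of the floors by 0 or 1. The correction is
      thus a power of \<open>a n\<close> with exponent 0 or 1, which tends to the identity.\<close>
    have e01: "e n = 0 \<or> e n = 1" for n unfolding e_def distrib_left by linarith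
    have "limitin X (\<lambda>n. a n [^]\<^bsub>G\<^esub> e n) \<one>\<^bsub>G\<^esub> F"
    proof (unfold limitin_def, intro conjI allI impI)
      fix W assume W: "openin X W \<and> \<one>\<^bsub>G\<^esub> \<in> W"
      then have "\<forall>\<^sub>F n in F. a n \<in> W" using lima by (simp add: limitin_def)
      then show "\<forall>\<^sub>F n in F. a n [^]\<^bsub>G\<^esub> e n \<in> W"
      proof (rule eventually_mono)
        fix n assume "a n \<in> W" then show "a n [^]\<^bsub>G\<^esub> e n \<in> W"
          using e01[of n] W ac[of n] by auto
      qed
    qed (simp add: topspace_eq)
    then have "limitin X (\<lambda>n. g n s \<otimes>\<^bsub>G\<^esub> g n t \<otimes>\<^bsub>G\<^esub> (a n [^]\<^bsub>G\<^esub> e n)) (\<gamma> s \<otimes>\<^bsub>G\<^esub> \<gamma> t \<otimes>\<^bsub>G\<^esub> \<one>\<^bsub>G\<^esub>) F"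
      by (intro limitin_mult lim)
    moreover have "g n s \<otimes>\<^bsub>G\<^esub> g n t \<otimes>\<^bsub>G\<^esub> (a n [^]\<^bsub>G\<^esub> e n) = g n (s + t)" for n
      unfolding g_def e_def int_pow_mult[OF ac, symmetric] by simp
    ultimately show ?thesis using uniq[OF lim[of "s + t"]] \<gamma>c by simp
  qed
  have est: "\<exists>\<eta>>0. \<forall>t. 0 \<le> t \<and> t \<le> \<eta> \<longrightarrow> \<gamma> t \<in> U \<and> norm (\<phi> (\<gamma> t) - org - t *\<^sub>R w) \<le> \<epsilon> * (t * norm w)"
    if e: "0 < \<epsilon>" "\<epsilon> \<le> 1" for \<epsilon>
  proof -
    obtain \<delta> where \<delta>: "\<delta> > 0" "\<And>u v. norm u \<le> \<delta> \<Longrightarrow> norm v \<le> \<delta> \<Longrightarrow>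
      (org + u, org + v) \<in> mdom \<and> norm (\<mu> (org + u, org + v) - org - u - v) \<le> \<epsilon> * norm v"
      using mult_estimate[OF e(1)] by metis
    have cb: "cball org \<delta> \<subseteq> \<phi> ` U"
    proof
      fix p assume "p \<in> cball org \<delta>"
      then have "norm (p - org) \<le> \<delta>" by (simp add: dist_norm norm_minus_commute)
      from \<delta>(2)[OF this, of 0] show "p \<in> \<phi> ` U" using \<delta>(1) by (simp add: mdom_def)
    qed
    \<comment> \<open>U is open, so a limit of points of U might leave it. Keeping the powers in the
      compact, hence closed, image of a ball inside the chart traps the limit in U.\<close>
    have "compactin (top_of_set (\<phi> ` U)) (cball org \<delta>)" using cb by (simp add: compactin_subtopology)
    then have "compactin X (\<psi> ` cball org \<delta>)" using image_compactin psi_cont by blast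
    then have clK: "closedin X (\<psi> ` cball org \<delta>)" using compactin_imp_closedin Hausdorff by blast
    define \<eta> where "\<eta> = \<delta> / (2 * (norm w + 1))"
    have \<eta>0: "\<eta> > 0" using \<delta>(1) by (simp add: \<eta>_def add_nonneg_pos)
    have "\<gamma> t \<in> U \<and> norm (\<phi> (\<gamma> t) - org - t *\<^sub>R w) \<le> \<epsilon> * (t * norm w)" if t: "0 \<le> t" "t \<le> \<eta>" for t
    proof -
      have "2 * t * norm w \<le> 2 * t * (norm w + 1)" using t by (intro mult_left_mono) auto
      also have "\<dots> \<le> 2 * \<eta> * (norm w + 1)" using t by (intro mult_right_mono) auto
      also have "\<dots> = \<delta>" by (simp add: \<eta>_def field_simps add_nonneg_eq_0_iff)
      finally have tw: "2 * t * norm w \<le> \<delta>" .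
      define k where "k n = nat \<lfloor>real n * t\<rfloor>" for n
      have kn: "real (k n) \<le> real n * t" "int (k n) = \<lfloor>real n * t\<rfloor>" for n
        using t by (auto simp: k_def)
      have "\<forall>\<^sub>F n in sequentially. n > 0" by (rule eventually_gt_at_top)
      then have evp: "\<forall>\<^sub>F n in F. n > 0" using F(2) by (simp add: le_filter_def)
      have ev: "\<forall>\<^sub>F n in F. g n t \<in> U \<and> norm (\<phi> (g n t) - org - (real (k n) / real n) *\<^sub>R w) \<le> \<epsilon> * (t * norm w)"
        using evp evU
      proof eventually_elim
        case (elim n)
        let ?u = "(1 / real n) *\<^sub>R w"
        have nu: "real (k n) * norm ?u \<le> t * norm w"
        proof -
          have "real (k n) / real n \<le> t" using kn(1)[of n] elim by (simp add: field_simps)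
          then have "real (k n) / real n * norm w \<le> t * norm w" by (intro mult_right_mono) auto
          then show ?thesis by simp
        qed
        then have "real (k n) * 2 * norm ?u \<le> \<delta>" using tw by linarith
        from pow_estimate[OF \<delta>(2) e this]
        have p: "\<psi> (org + ?u) [^]\<^bsub>G\<^esub> k n \<in> U"
          "norm (\<phi> (\<psi> (org + ?u) [^]\<^bsub>G\<^esub> k n) - org - real (k n) *\<^sub>R ?u) \<le> \<epsilon> * (real (k n) * norm ?u)"
          by auto
        have "g n t = \<psi> (org + ?u) [^]\<^bsub>G\<^esub> k n"
          using elim by (simp add: g_def a_def kn(2)[symmetric] int_pow_int)
        moreover have "\<epsilon> * (real (k n) * norm ?u) \<le> \<epsilon> * (t * norm w)"
          using nu e by (intro mult_left_mono) auto
        ultimately show ?case using p by simp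
      qed
      have evK: "\<forall>\<^sub>F n in F. g n t \<in> \<psi> ` cball org \<delta>"
        using ev evp
      proof eventually_elim
        case (elim n)
        let ?x = "\<phi> (g n t)"
        have "(real (k n) / real n) \<le> t" using kn(1)[of n] elim by (simp add: field_simps)
        then have "(real (k n) / real n) * norm w \<le> t * norm w" by (intro mult_right_mono) auto
        then have 1: "norm ((real (k n) / real n) *\<^sub>R w) \<le> t * norm w" by simp
        have 2: "\<epsilon> * (t * norm w) \<le> 1 * (t * norm w)" using e t by (intro mult_right_mono) auto
        have "norm (?x - org) \<le> norm (?x - org - (real (k n) / real n) *\<^sub>R w) + norm ((real (k n) / real n) *\<^sub>R w)"
          using norm_triangle_ineq[of "?x - org - (real (k n) / real n) *\<^sub>R w" "(real (k n) / real n) *\<^sub>R w"] by simp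
        also have "\<dots> \<le> \<delta>" using elim 1 2 tw by linarith
        finally have "?x \<in> cball org \<delta>" by (simp add: dist_norm norm_minus_commute)
        moreover have "g n t = \<psi> ?x" using elim psi_phi by simp
        ultimately show ?case by blast
      qed
      have "\<gamma> t \<in> \<psi> ` cball org \<delta>" by (rule limitin_closedin[OF lim clK evK F(1)])
      then obtain p where "\<gamma> t = \<psi> p" "p \<in> cball org \<delta>" by (rule imageE)
      then have U: "\<gamma> t \<in> U" using psi_in[OF subsetD[OF cb]] by simp
      have "((\<lambda>n. real (k n) / real n) \<longlongrightarrow> t) sequentially"
      proof (rule tendsto_sandwich[of "\<lambda>n. t - 1 / real n" _ _ "\<lambda>n. t"])
        show "\<forall>\<^sub>F n in sequentially. t - 1 / real n \<le> real (k n) / real n"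
          using eventually_gt_at_top[of 0]
        proof eventually_elim
          case (elim n)
          have "real n * t - 1 \<le> real (k n)" using kn(2)[of n] by linarith
          then have "(real n * t - 1) / real n \<le> real (k n) / real n" by (intro divide_right_mono) auto
          then show ?case using elim by (simp add: diff_divide_distrib)
        qed
        show "\<forall>\<^sub>F n in sequentially. real (k n) / real n \<le> t"
          using eventually_gt_at_top[of 0] by eventually_elim (use kn(1) in \<open>simp add: field_simps\<close>)
        show "((\<lambda>n. t - 1 / real n) \<longlongrightarrow> t) sequentially"
          using tendsto_diff[OF tendsto_const lim_1_over_n, of t] by simp
      qed auto
      then have "((\<lambda>n. real (k n) / real n) \<longlongrightarrow> t) F" using F(2) tendsto_mono by blast
      then have "((\<lambda>n. norm (\<phi> (g n t) - org - (real (k n) / real n) *\<^sub>R w)) \<longlongrightarrow> norm (\<phi> (\<gamma> t) - org - t *\<^sub>R w)) F"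
        by (intro tendsto_intros limit_phi[OF lim U])
      then have "norm (\<phi> (\<gamma> t) - org - t *\<^sub>R w) \<le> \<epsilon> * (t * norm w)"
        by (rule tendsto_upperbound[OF _ _ F(1)]) (use ev in eventually_elim, auto)
      then show ?thesis using U by blast
    qed
    then show ?thesis using \<eta>0 by blast
  qed
  have \<gamma>0: "\<gamma> 0 = \<one>\<^bsub>G\<^esub>" using hom[of 0 0] \<gamma>c[of 0] by (metis add.left_neutral l_cancel_one')
  have \<gamma>m: "\<gamma> (- t) = inv\<^bsub>G\<^esub> (\<gamma> t)" for t
    using hom[of "- t" t] \<gamma>0 \<gamma>c by (metis add.left_inverse inv_equality)
  have right: "((\<lambda>t. \<phi> (\<gamma> t)) \<longlongrightarrow> org) (at_right 0)" and rightU: "\<forall>\<^sub>F t in at_right 0. \<gamma> t \<in> U"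
  proof -
    obtain \<eta> where \<eta>: "\<eta> > 0" "\<And>t. 0 \<le> t \<Longrightarrow> t \<le> \<eta> \<Longrightarrow> \<gamma> t \<in> U \<and> norm (\<phi> (\<gamma> t) - org - t *\<^sub>R w) \<le> 1 * (t * norm w)"
      using est[of 1] by auto
    have ev: "\<forall>\<^sub>F t in at_right 0. 0 \<le> t \<and> t \<le> \<eta>" 
      using eventually_at_right_less[of "0::real"] eventually_at_right_real[OF \<eta>(1)]
      by eventually_elim auto
    show "\<forall>\<^sub>F t in at_right 0. \<gamma> t \<in> U" using ev by eventually_elim (use \<eta> in auto)
    have "((\<lambda>t. \<phi> (\<gamma> t) - org) \<longlongrightarrow> 0) (at_right 0)"
    proof (rule Lim_null_comparison)
      show "\<forall>\<^sub>F t in at_right 0. norm (\<phi> (\<gamma> t) - org) \<le> 2 * t * norm w"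
        using ev
      proof eventually_elim
        case (elim t)
        have "norm (\<phi> (\<gamma> t) - org) \<le> norm (\<phi> (\<gamma> t) - org - t *\<^sub>R w) + norm (t *\<^sub>R w)"
          using norm_triangle_ineq[of "\<phi> (\<gamma> t) - org - t *\<^sub>R w" "t *\<^sub>R w"] by simp
        then show ?case using \<eta>(2)[of t] elim by simp
      qed
      have "((\<lambda>t. 2 * t * norm w) \<longlongrightarrow> 2 * 0 * norm w) (at_right 0)" by (intro tendsto_intros)
      then show "((\<lambda>t. 2 * t * norm w) \<longlongrightarrow> 0) (at_right 0)" by simp
    qed
    then show "((\<lambda>t. \<phi> (\<gamma> t)) \<longlongrightarrow> org) (at_right 0)" by (simp add: LIM_zero_iff)
  qed
  have limR: "limitin X \<gamma> \<one>\<^bsub>G\<^esub> (at_right 0)"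
  proof (rule limitin_transform_eventually)
    show "\<forall>\<^sub>F t in at_right 0. \<psi> (\<phi> (\<gamma> t)) = \<gamma> t" using rightU by eventually_elim (rule psi_phi)
    show "limitin X (\<lambda>t. \<psi> (\<phi> (\<gamma> t))) \<one>\<^bsub>G\<^esub> (at_right 0)" using limit_psi[OF right org_in] by (simp add: psi_org)
  qed
  \<comment> \<open>The estimate covers t \<ge> 0 only; negative times are reached by
    inversion.\<close>
  have limR': "limitin X (\<lambda>t. \<gamma> (- t)) \<one>\<^bsub>G\<^esub> (at_right 0)"
    using continuous_map_limit[OF inv_cont limR] by (simp add: o_def \<gamma>m)
  have ev0: "\<forall>\<^sub>F t in nhds (0::real). \<gamma> t \<in> W" if W: "openin X W" "\<one>\<^bsub>G\<^esub> \<in> W" for W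
  proof -
    have 1: "\<forall>\<^sub>F t in at_right 0. \<gamma> t \<in> W \<and> \<gamma> (- t) \<in> W"
      using limitinD[OF limR W] limitinD[OF limR' W] by eventually_elim blast
    then obtain d where d: "d > 0" "\<And>t. 0 < t \<Longrightarrow> t < d \<Longrightarrow> \<gamma> t \<in> W \<and> \<gamma> (- t) \<in> W"
      unfolding eventually_at_right[OF zero_less_one] by auto
    have "\<gamma> t \<in> W" if "dist t 0 < d" for t
      using d(2)[of t] d(2)[of "- t"] that W(2) \<gamma>0 by (cases "t = 0"; cases "t > 0") auto
    then show ?thesis unfolding eventually_nhds_metric using d(1) by blast
  qed
  have cont: "continuous_map euclideanreal X \<gamma>"
    unfolding continuous_map_def
  proof (intro conjI allI impI)
    show "\<gamma> \<in> topspace euclideanreal \<rightarrow> topspace X" using \<gamma>c by (simp add: topspace_eq)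
    fix W assume W: "openin X W"
    have "open {t. \<gamma> t \<in> W}"
    proof (subst open_subopen, intro ballI)
      fix s assume s: "s \<in> {t. \<gamma> t \<in> W}"
      let ?W = "{b \<in> topspace X. \<gamma> s \<otimes>\<^bsub>G\<^esub> b \<in> W}"
      have "openin X ?W" by (rule openin_continuous_map_preimage[OF lmult_cont[OF \<gamma>c] W])
      then have "\<forall>\<^sub>F t in nhds 0. \<gamma> t \<in> ?W" by (rule ev0) (use s \<gamma>c in \<open>simp add: topspace_eq\<close>)
      then obtain d where d: "d > 0" "\<And>t. dist t 0 < d \<Longrightarrow> \<gamma> s \<otimes>\<^bsub>G\<^esub> \<gamma> t \<in> W"
        unfolding eventually_nhds_metric by blast
      have "t \<in> {t. \<gamma> t \<in> W}" if "t \<in> ball s d" for t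
        using d(2)[of "t - s"] hom[of s "t - s"] that by (simp add: dist_norm abs_minus_commute)
      then show "\<exists>T. open T \<and> s \<in> T \<and> T \<subseteq> {t. \<gamma> t \<in> W}" using d(1) by (intro exI[of _ "ball s d"]) auto
    qed
    then show "openin euclideanreal {t \<in> topspace euclideanreal. \<gamma> t \<in> W}" by simp
  qed
  have der: "((\<lambda>t. \<phi> (\<gamma> t)) has_derivative (\<lambda>t. t *\<^sub>R w)) (at 0)"
    unfolding has_derivative_at_alt
  proof (intro conjI allI impI bounded_linear_scaleR_left)
    fix e0 :: real assume e0: "e0 > 0"
    \<comment> \<open>The 3 anticipates the constant in \<open>main\<close>.\<close>
    define \<epsilon> where "\<epsilon> = min 1 (e0 / (3 * (norm w + 1)))"
    have e: "0 < \<epsilon>" "\<epsilon> \<le> 1" using e0 by (auto simp: \<epsilon>_def add_nonneg_pos)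
    have "\<epsilon> * (norm w + 1) \<le> e0 / (3 * (norm w + 1)) * (norm w + 1)" by (intro mult_right_mono) (auto simp: \<epsilon>_def)
    also have "\<dots> = e0 / 3" by (simp add: field_simps add_nonneg_eq_0_iff)
    finally have ew: "3 * \<epsilon> * norm w \<le> e0" using e by (simp add: algebra_simps)
    obtain \<delta> where \<delta>: "\<delta> > 0" "\<And>u v. norm u \<le> \<delta> \<Longrightarrow> norm v \<le> \<delta> \<Longrightarrow>
      (org + u, org + v) \<in> mdom \<and> norm (\<mu> (org + u, org + v) - org - u - v) \<le> \<epsilon> * norm v"
      using mult_estimate[OF e(1)] by metis
    obtain \<eta> where \<eta>: "\<eta> > 0" "\<And>t. 0 \<le> t \<Longrightarrow> t \<le> \<eta> \<Longrightarrow> \<gamma> t \<in> U \<and> norm (\<phi> (\<gamma> t) - org - t *\<^sub>R w) \<le> \<epsilon> * (t * norm w)"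
      using est[OF e] by blast
    have "openin X {b \<in> U. \<phi> b \<in> ball org \<delta>}" by (rule openin_chart_vimage) simp
    then have "\<forall>\<^sub>F t in nhds 0. \<gamma> t \<in> {b \<in> U. \<phi> b \<in> ball org \<delta>}"
      by (rule ev0) (use oneU \<delta>(1) in \<open>simp add: org_def\<close>)
    then obtain d where d: "d > 0" "\<And>t. dist t 0 < d \<Longrightarrow> \<gamma> t \<in> U \<and> \<phi> (\<gamma> t) \<in> ball org \<delta>"
      unfolding eventually_nhds_metric by blast
    have main: "norm (\<phi> (\<gamma> t) - org - t *\<^sub>R w) \<le> 3 * \<epsilon> * norm w * \<bar>t\<bar>" if t: "\<bar>t\<bar> < min d \<eta>" for t
    proof (cases "t \<ge> 0")
      case True
      then have "norm (\<phi> (\<gamma> t) - org - t *\<^sub>R w) \<le> \<epsilon> * (t * norm w)" using \<eta>(2)[of t] t by auto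
      also have "\<dots> \<le> 3 * (\<epsilon> * (t * norm w))" using True e by simp
      finally show ?thesis using True by (simp add: mult_ac)
    next
      case False
      \<comment> \<open>For negative t the relation \<gamma> t \<gamma> s = 1 reads, in coordinates,
        u + v = 0 up to \<epsilon> times norm v. With norm v at most 2 s norm w this costs 2
        \<epsilon> s norm w, and the estimate for \<gamma> s costs once more \<epsilon> s norm
        w.\<close>
      define s where "s = - t"
      have s: "0 \<le> s" "s \<le> \<eta>" using False t by (auto simp: s_def)
      define v where "v = \<phi> (\<gamma> s) - org"
      define u where "u = \<phi> (\<gamma> t) - org"
      have su: "\<gamma> s \<in> U" "\<gamma> t \<in> U" "norm v \<le> \<delta>" "norm u \<le> \<delta>"
        using d(2)[of s] d(2)[of t] t by (auto simp: s_def v_def u_def dist_norm norm_minus_commute less_imp_le)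
      have "\<gamma> t \<otimes>\<^bsub>G\<^esub> \<gamma> s = \<one>\<^bsub>G\<^esub>" using hom[of t s] \<gamma>0 by (simp add: s_def)
      then have "\<mu> (org + u, org + v) = org" using su by (simp add: \<mu>_def u_def v_def psi_phi) (simp add: org_def)
      then have 1: "norm (u + v) \<le> \<epsilon> * norm v" using \<delta>(2)[OF su(4,3)] by (metis diff_self diff_diff_add minus_diff_eq norm_minus_cancel diff_0)
      have 2: "norm (v - s *\<^sub>R w) \<le> \<epsilon> * (s * norm w)" using \<eta>(2)[OF s] by (simp add: v_def)
      have "norm v \<le> norm (v - s *\<^sub>R w) + norm (s *\<^sub>R w)" using norm_triangle_ineq[of "v - s *\<^sub>R w" "s *\<^sub>R w"] by simp
      also have "\<dots> \<le> 1 * (s * norm w) + s * norm w"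
        using 2 e s by (intro add_mono order_trans[OF 2] mult_right_mono) auto
      finally have "norm v \<le> 2 * (s * norm w)" by simp
      then have 3: "norm (u + v) \<le> \<epsilon> * (2 * (s * norm w))" using 1 e by (meson mult_left_mono order_trans less_imp_le)
      have "u - t *\<^sub>R w = (u + v) - (v - s *\<^sub>R w)" by (simp add: s_def)
      then have "norm (u - t *\<^sub>R w) \<le> norm (u + v) + norm (v - s *\<^sub>R w)" by (metis norm_triangle_ineq4)
      also have "\<dots> \<le> 3 * \<epsilon> * norm w * s" using 2 3 by (simp add: mult_ac)
      finally show ?thesis using False by (simp add: u_def s_def)
    qed
    have "norm (\<phi> (\<gamma> y) - \<phi> (\<gamma> 0) - (y - 0) *\<^sub>R w) \<le> e0 * norm (y - 0)" if "norm (y - 0) < min d \<eta>" for y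
    proof -
      have "norm (\<phi> (\<gamma> y) - org - y *\<^sub>R w) \<le> 3 * \<epsilon> * norm w * \<bar>y\<bar>" using main that by simp
      also have "\<dots> \<le> e0 * \<bar>y\<bar>" using ew by (intro mult_right_mono) auto
      finally show ?thesis by (simp add: \<gamma>0 org_def[symmetric])
    qed
    then show "\<exists>d>0. \<forall>y. norm (y - 0) < d \<longrightarrow> norm (\<phi> (\<gamma> y) - \<phi> (\<gamma> 0) - (y - 0) *\<^sub>R w) \<le> e0 * norm (y - 0)"
      using d(1) \<eta>(1) by (intro exI[of _ "min d \<eta>"]) auto
  qed
  have "one_param \<gamma> w"
    using cont hom der by (simp add: one_param_def has_vector_derivative_def o_def)
  then show thesis by (rule that)
qed

section \<open>Antisymmetry and definiteness of the Killing form\<close>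

text \<open>A one-parameter subgroup is commutative, so conjugation by its elements fixes it and
  \<open>Ad\<close> fixes its velocity x. The derivative of this constant is [x, x]; antisymmetry
  follows by polarisation.\<close>

lemma bra_self: "bra x x = 0"
proof -
  obtain \<gamma> where \<gamma>: "one_param \<gamma> x" by (rule one_param_exists)
  note c = one_param_carrier[OF \<gamma>]
  have d: "((\<phi> \<circ> \<gamma>) has_vector_derivative x) (at 0)" using \<gamma> by (simp add: one_param_def)
  have "Adj (\<gamma> s) x = x" for s
  proof -
    have "\<gamma> s \<otimes>\<^bsub>G\<^esub> \<gamma> t \<otimes>\<^bsub>G\<^esub> inv\<^bsub>G\<^esub> (\<gamma> s) = \<gamma> t" for t
    proof -
      have "\<gamma> s \<otimes>\<^bsub>G\<^esub> \<gamma> t = \<gamma> t \<otimes>\<^bsub>G\<^esub> \<gamma> s" using \<gamma> by (metis one_param_def add.commute)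
      then show ?thesis using c by (simp add: m_assoc)
    qed
    then have "((\<lambda>t. \<phi> (\<gamma> t)) has_vector_derivative Adj (\<gamma> s) x) (at 0)"
      using Ad_curve[OF c one_param_ev[OF \<gamma>] one_param_0[OF \<gamma>] d, of s] by simp
    then show ?thesis using d vector_derivative_unique_at by (fastforce simp: o_def)
  qed
  then have "((\<lambda>t. x) has_vector_derivative bra x x) (at 0)"
    using one_param_Ad(2)[OF \<gamma>, of x 0] by (simp add: one_param_0[OF \<gamma>] Ad_one)
  then show ?thesis using vector_derivative_unique_at has_vector_derivative_const by blast
qed

lemma bra_anti: "bra x y = - bra y x"
proof -
  have "bra x y + bra y x = 0"
  proof -
    have "bra (x + y) (x + y) = bra x x + bra y x + (bra x y + bra y y)"
      by (simp only: bilinear_ladd[OF bra_bilinear] bilinear_radd[OF bra_bilinear])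
    then show ?thesis by (simp add: bra_self add.commute)
  qed
  then show ?thesis by (simp add: eq_neg_iff_add_eq_0)
qed

text \<open>The centre is an abelian ideal, so semisimplicity makes it trivial.\<close>

lemma bra_center: assumes "\<And>y. bra x y = 0" shows "x = 0"
proof -
  let ?I = "{x. \<forall>y. bra x y = 0}"
  have "subspace ?I"
    by (auto simp: subspace_def bilinear_ladd[OF bra_bilinear] bilinear_lmul[OF bra_bilinear] bilinear_lzero[OF bra_bilinear])
  moreover have z: "bra u v = 0" if "v \<in> ?I" for u v
  proof -
    have "bra v u = 0" using that by simp
    then show ?thesis using bra_anti[of u v] by (simp only: minus_zero)
  qed
  have "\<forall>u. \<forall>v\<in>?I. bra u v \<in> ?I"
  proof (intro allI ballI)
    fix u v assume "v \<in> ?I"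
    then have "bra u v = 0" by (rule z)
    then show "bra u v \<in> ?I" by (simp only: mem_Collect_eq bilinear_lzero[OF bra_bilinear] simp_thms)
  qed
  moreover have "\<forall>u\<in>?I. \<forall>v\<in>?I. bra u v = 0" using z by blast
  ultimately have "?I = {0}"
    by (intro semisimple[unfolded semisimple_bracket_def, THEN spec[of _ ?I], THEN mp] conjI)
  then show ?thesis using assms by blast
qed

text \<open>Orbits of basis vectors are bounded by compactness. Since the inverse of
  \<open>Ad a\<close> is again of this form, the bound also keeps \<open>Ad a v\<close> away from
  0.\<close>

lemma Ad_bounded: obtains C where "C > 0" "\<And>a v. a \<in> carrier G \<Longrightarrow> norm (Adj a v) \<le> C * norm v"
proof -
  have "\<exists>c. \<forall>a\<in>carrier G. norm (Adj a b) \<le> c" for b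
  proof -
    have "compactin euclidean ((\<lambda>a. Adj a b) ` topspace X)"
      using image_compactin[OF _ Ad_continuous] compact by (simp add: compact_space_def)
    then have "bounded ((\<lambda>a. Adj a b) ` carrier G)" by (simp add: compact_imp_bounded topspace_eq)
    then show ?thesis by (auto simp: bounded_iff)
  qed
  then obtain c where c: "\<And>a b. a \<in> carrier G \<Longrightarrow> norm (Adj a b) \<le> c b" by metis
  define C where "C = (\<Sum>b\<in>Basis. \<bar>c b\<bar>)"
  have cC: "c b \<le> C" if "b \<in> Basis" for b
    using member_le_sum[of b Basis "\<lambda>b. \<bar>c b\<bar>"] that by (auto simp: C_def)
  have C0: "C \<ge> 0" by (simp add: C_def sum_nonneg)
  have "norm (Adj a v) \<le> (real DIM('m) * C + 1) * norm v" if a: "a \<in> carrier G" for a v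
  proof -
    have "norm (Adj a v) \<le> real DIM('m) * C * norm v"
      by (rule linear_basis_bound[OF Ad_linear[OF a]]) (use c[OF a] cC order_trans in blast)
    then show ?thesis by (simp add: distrib_right add_increasing2)
  qed
  then show thesis using that[of "real DIM('m) * C + 1"] C0 by (simp add: add_nonneg_pos)
qed

text \<open>The form depends on x: it is the limit \<beta> of the averages over the times 0 to n of
  the inner products transported by \<open>Ad (\<gamma> s)\<close>. It is positive definite by
  \<open>Ad_bounded\<close>, ad x is skew for it, and x is not central, so
  \<open>trace_square_neg\<close> applies.\<close>

lemma bra_trace_neg:
  assumes x: "x \<noteq> 0"
  shows "linear_trace (bra x \<circ> bra x) < 0"
proof -
  obtain F :: "nat filter" where F: "F \<noteq> bot" "F \<le> sequentially"
    "\<And>P. eventually P F \<or> eventually (\<lambda>n. \<not> P n) F" by (rule ultrafilter_exists) blast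
  obtain \<gamma> where \<gamma>: "one_param \<gamma> x" by (rule one_param_exists)
  note c = one_param_carrier[OF \<gamma>]
  obtain C where C: "C > 0" "\<And>a v. a \<in> carrier G \<Longrightarrow> norm (Adj a v) \<le> C * norm v" by (rule Ad_bounded) blast
  define f where "f u v s = Adj (\<gamma> s) u \<bullet> Adj (\<gamma> s) v" for u v s
  have f_der: "(f u v has_vector_derivative (f u (bra x v) s + f (bra x u) v s)) (at s)" for u v s
    unfolding f_def
    by (rule bounded_bilinear.has_vector_derivative[OF bounded_bilinear_inner one_param_Ad(2)[OF \<gamma>] one_param_Ad(2)[OF \<gamma>]])
  have f_cont: "continuous_on S (f u v)" for u v S
    using has_vector_derivative_continuous[OF f_der] by (simp add: continuous_at_imp_continuous_on)
  have f_int: "f u v integrable_on {0..b}" for u v b by (rule integrable_continuous_real[OF f_cont])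
  define K where "K u v = C * norm u * (C * norm v)" for u v :: 'm
  have f_bd: "\<bar>f u v s\<bar> \<le> K u v" for u v s
  proof -
    have "\<bar>f u v s\<bar> \<le> norm (Adj (\<gamma> s) u) * norm (Adj (\<gamma> s) v)" unfolding f_def by (rule Cauchy_Schwarz_ineq2)
    also have "\<dots> \<le> K u v" unfolding K_def by (intro mult_mono C c) (use C in auto)
    finally show ?thesis .
  qed
  define avg where "avg n u v = integral {0..real n} (f u v) / real n" for n u v
  have f_lin: "f (u + u') v s = f u v s + f u' v s" "f (r *\<^sub>R u) v s = r * f u v s" "f u v s = f v u s" for u u' v r s
    by (simp_all add: f_def linear_add[OF Ad_linear[OF c]] linear_scale[OF Ad_linear[OF c]] inner_add_left)
      (rule inner_commute)
  have avg_add: "avg n (u + u') v = avg n u v + avg n u' v" for n u u' v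
  proof -
    have "f (u + u') v = (\<lambda>s. f u v s + f u' v s)" by (rule ext) (rule f_lin)
    then show ?thesis by (simp add: avg_def integral_add[OF f_int f_int] add_divide_distrib)
  qed
  have avg_scale: "avg n (r *\<^sub>R u) v = r * avg n u v" for n r u v
  proof -
    have "f (r *\<^sub>R u) v = (\<lambda>s. r * f u v s)" by (rule ext) (rule f_lin)
    then show ?thesis by (simp add: avg_def)
  qed
  have avg_sym: "avg n u v = avg n v u" for n u v
    unfolding avg_def using f_lin(3) by (metis (no_types, lifting) integral_cong)
  have avg_bd: "avg n u v \<in> {- K u v..K u v}" for n u v
  proof (cases "n = 0")
    \<comment> \<open>With n = 0 the average is 0 by the convention on division, which lies in the
      interval.\<close>
    case True then show ?thesis using f_bd[of u v 0] by (auto simp: avg_def)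
  next
    case False
    have "norm (integral {0..real n} (f u v)) \<le> K u v * (real n - 0)"
      by (rule integral_bound) (use f_bd f_cont in auto)
    then have "\<bar>integral {0..real n} (f u v)\<bar> / real n \<le> K u v" using False by (simp add: field_simps)
    then have "\<bar>avg n u v\<bar> \<le> K u v" by (simp add: avg_def)
    then show ?thesis by auto
  qed
  \<comment> \<open>All pairs u, v use the same F, so symmetry and linearity pass to the
    limit.\<close>
  have "\<exists>l. ((\<lambda>n. avg n u v) \<longlongrightarrow> l) F" for u v
  proof -
    have "compact_space (top_of_set {- K u v..K u v})" by (simp add: compact_space_subtopology)
    then obtain l where "limitin (top_of_set {- K u v..K u v}) (\<lambda>n. avg n u v) l F"
      by (rule ultrafilter_limitin[OF F(3,1)]) (use avg_bd in simp)
    then show ?thesis by (auto simp: limitin_subtopology)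
  qed
  then obtain \<beta> where \<beta>: "\<And>u v. ((\<lambda>n. avg n u v) \<longlongrightarrow> \<beta> u v) F" by metis
  note uniq = tendsto_unique[OF F(1)]
  have \<beta>_sym: "\<beta> u v = \<beta> v u" for u v
    by (rule uniq[OF \<beta>]) (subst avg_sym, rule \<beta>)
  have \<beta>_lin: "linear (\<lambda>u. \<beta> u v)" for v
  proof (rule linearI)
    show "\<beta> (u + u') v = \<beta> u v + \<beta> u' v" for u u'
      by (rule uniq[OF \<beta>]) (subst avg_add, rule tendsto_add[OF \<beta> \<beta>])
    show "\<beta> (r *\<^sub>R u) v = r *\<^sub>R \<beta> u v" for r u
      by (rule uniq[OF \<beta>], subst avg_scale) (simp add: tendsto_mult_left[OF \<beta>])
  qed
  have \<beta>_bil: "bilinear \<beta>" unfolding bilinear_def using \<beta>_lin by (simp add: \<beta>_sym[of _ _])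
  have "eventually (\<lambda>n. n > 0) sequentially" by (rule eventually_gt_at_top)
  then have evp: "\<forall>\<^sub>F n in F. n > 0" using F(2) by (simp add: le_filter_def)
  have \<beta>_pos: "\<beta> v v > 0" if v: "v \<noteq> 0" for v
  proof -
    let ?m = "(norm v / C)\<^sup>2"
    have fm: "?m \<le> f v v s" for s
    proof -
      \<comment> \<open>The bound C applied to the inverse of \<gamma> s.\<close>
      have "norm v \<le> C * norm (Adj (\<gamma> s) v)" using C(2)[of "inv\<^bsub>G\<^esub> (\<gamma> s)" "Adj (\<gamma> s) v"] c by (simp add: Ad_inv)
      then have "norm v / C \<le> norm (Adj (\<gamma> s) v)" using C(1) by (simp add: field_simps)
      then have "?m \<le> (norm (Adj (\<gamma> s) v))\<^sup>2" using C(1) by (intro power_mono) auto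
      then show ?thesis by (simp add: f_def power2_norm_eq_inner)
    qed
    have "?m \<le> \<beta> v v"
    proof (rule tendsto_lowerbound[OF \<beta> _ F(1)])
      show "\<forall>\<^sub>F n in F. ?m \<le> avg n v v"
        using evp
      proof eventually_elim
        case (elim n)
        have "integral {0..real n} (\<lambda>s. ?m) \<le> integral {0..real n} (f v v)"
          by (rule integral_le) (use f_int fm in auto)
        then show ?case using elim by (simp add: avg_def field_simps)
      qed
    qed
    then show ?thesis using v C(1) by (smt (verit) divide_pos_pos zero_less_norm_iff zero_less_power)
  qed
  \<comment> \<open>The two integrands add up to the derivative of s \<mapsto> f u v s, so the
    averages add up to boundary terms of size at most 2 K, divided by n.\<close>
  have skew: "\<beta> (bra x u) v = - \<beta> u (bra x v)" for u v
  proof -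
    have "((\<lambda>n. avg n u (bra x v) + avg n (bra x u) v) \<longlongrightarrow> 0) sequentially"
    proof (rule Lim_null_comparison)
      show "((\<lambda>n. 2 * K u v * (1 / real n)) \<longlongrightarrow> 0) sequentially"
        using tendsto_mult_left[OF lim_1_over_n, of "2 * K u v"] by simp
      show "\<forall>\<^sub>F n in sequentially. norm (avg n u (bra x v) + avg n (bra x u) v) \<le> 2 * K u v * (1 / real n)"
        using eventually_gt_at_top[of 0]
      proof eventually_elim
        case (elim n)
        have "((\<lambda>s. f u (bra x v) s + f (bra x u) v s) has_integral (f u v (real n) - f u v 0)) {0..real n}"
          by (rule fundamental_theorem_of_calculus) (auto intro: has_vector_derivative_at_within f_der)
        then have "integral {0..real n} (f u (bra x v)) + integral {0..real n} (f (bra x u) v) = f u v (real n) - f u v 0"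
          using integral_add[OF f_int f_int] by (metis integral_unique)
        then have "avg n u (bra x v) + avg n (bra x u) v = (f u v (real n) - f u v 0) / real n"
          by (simp add: avg_def add_divide_distrib[symmetric])
        moreover have "\<bar>f u v (real n) - f u v 0\<bar> \<le> 2 * K u v" using f_bd[of u v "real n"] f_bd[of u v 0] by linarith
        ultimately show ?case using elim by (simp add: divide_right_mono)
      qed
    qed
    then have "((\<lambda>n. avg n u (bra x v) + avg n (bra x u) v) \<longlongrightarrow> 0) F" using F(2) tendsto_mono by blast
    moreover have "((\<lambda>n. avg n u (bra x v) + avg n (bra x u) v) \<longlongrightarrow> \<beta> u (bra x v) + \<beta> (bra x u) v) F"
      by (rule tendsto_add[OF \<beta> \<beta>])
    ultimately have "\<beta> u (bra x v) + \<beta> (bra x u) v = 0" using uniq by blast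
    then show ?thesis by simp
  qed
  obtain v0 where "bra x v0 \<noteq> 0" using bra_center x by blast
  moreover have "linear (bra x)" using bra_bilinear by (simp add: bilinear_def)
  ultimately show ?thesis by (intro trace_square_neg[OF \<beta>_bil \<beta>_sym \<beta>_pos _ skew])
qed

sublocale compact_lie_algebra bra
  by unfold_locales (fact bra_bilinear bra_anti bra_jacobi bra_trace_neg)+

section \<open>First-order geometry of adjoint orbits\<close>

text \<open>Orbit points near x come from group elements near the identity. The elements that a
  stabiliser element moves into the chart ball \<open>?W\<close> form an open set \<open>?S\<close>;
  its complement is compact, so the corresponding orbit points form a closed set, and that set
  misses x.\<close>

lemma orbit_chart:
  assumes r: "r > 0"
  obtains \<rho> where "\<rho> > 0" "\<And>a. a \<in> carrier G \<Longrightarrow> norm (Adj a x - x) < \<rho> \<Longrightarrow>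
    \<exists>b\<in>U. norm (\<phi> b - org) < r \<and> Adj b x = Adj a x"
proof -
  let ?W = "{b \<in> U. \<phi> b \<in> ball org r}"
  have W: "openin X ?W" by (rule openin_chart_vimage) simp
  let ?H = "{h \<in> carrier G. Adj h x = x}"
  let ?S = "\<Union>h\<in>?H. {a \<in> topspace X. a \<otimes>\<^bsub>G\<^esub> h \<in> ?W}"
  have "openin X ?S"
  proof (intro openin_Union ballI)
    fix Y assume "Y \<in> (\<lambda>h. {a \<in> topspace X. a \<otimes>\<^bsub>G\<^esub> h \<in> ?W}) ` ?H"
    then obtain h where h: "h \<in> carrier G" "Y = {a \<in> topspace X. a \<otimes>\<^bsub>G\<^esub> h \<in> ?W}" by blast
    show "openin X Y" unfolding h(2) by (rule openin_continuous_map_preimage[OF rmult_cont[OF h(1)] W])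
  qed
  then have "closedin X (topspace X - ?S)" by blast
  then have "compactin X (topspace X - ?S)" using compact closedin_compact_space by blast
  then have "compactin euclidean ((\<lambda>a. Adj a x) ` (topspace X - ?S))" by (rule image_compactin[OF _ Ad_continuous])
  then have cl: "closed ((\<lambda>a. Adj a x) ` (topspace X - ?S))" by (simp add: compact_imp_closed)
  have "x \<notin> (\<lambda>a. Adj a x) ` (topspace X - ?S)"
  proof
    assume "x \<in> (\<lambda>a. Adj a x) ` (topspace X - ?S)"
    then obtain a where a: "x = Adj a x" "a \<in> topspace X" "a \<notin> ?S" by blast
    then have ac: "a \<in> carrier G" by (simp add: topspace_eq)
    have "Adj (inv\<^bsub>G\<^esub> a) x = x" using Ad_inv(2)[OF ac, of x] a(1) by simp
    moreover have "a \<otimes>\<^bsub>G\<^esub> inv\<^bsub>G\<^esub> a \<in> ?W" using ac oneU r by (simp add: org_def)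
    ultimately show False using a ac by blast
  qed
  then obtain \<rho> where \<rho>: "\<rho> > 0" "ball x \<rho> \<subseteq> - ((\<lambda>a. Adj a x) ` (topspace X - ?S))"
    using openE[OF open_Compl[OF cl] ComplI] by blast
  show thesis
  proof (rule that[OF \<rho>(1)])
    fix a assume a: "a \<in> carrier G" "norm (Adj a x - x) < \<rho>"
    then have "Adj a x \<in> ball x \<rho>" by (simp add: dist_norm norm_minus_commute)
    then have "Adj a x \<notin> (\<lambda>a. Adj a x) ` (topspace X - ?S)" using \<rho>(2) by blast
    then have "a \<notin> topspace X - ?S" by blast
    then have "a \<in> ?S" using a(1) topspace_eq by blast
    then obtain h where h: "h \<in> carrier G" "Adj h x = x" "a \<otimes>\<^bsub>G\<^esub> h \<in> ?W" by blast
    then show "\<exists>b\<in>U. norm (\<phi> b - org) < r \<and> Adj b x = Adj a x"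
      using a(1) by (intro bexI[of _ "a \<otimes>\<^bsub>G\<^esub> h"]) (auto simp: Ad_mult dist_norm norm_minus_commute)
  qed
qed

lemma one_param_fixes:
  assumes "one_param \<gamma> w" "bra w x = 0"
  shows "Adj (\<gamma> s) x = x"
proof -
  note c = one_param_carrier[OF assms(1)]
  have "((\<lambda>t. Adj (\<gamma> t) x) has_vector_derivative 0) (at s within UNIV)" for s
    using one_param_Ad(2)[OF assms(1), of x s] assms(2) linear_0[OF Ad_linear[OF c]] by simp
  then obtain k where "\<And>t. Adj (\<gamma> t) x = k"
    by (metis UNIV_I convex_UNIV has_vector_derivative_zero_constant)
  then show ?thesis using Ad_one one_param_0[OF assms(1)] by metis
qed

text \<open>Each orbit point near \<open>x\<close> is \<open>Ad b x\<close> with \<open>b\<close> closest to the identity in its coset of the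
  stabiliser. Moving \<open>b\<close> along one-parameter subgroups of the stabiliser shows that \<open>b\<close> is, to first
  order, orthogonal to \<open>cent x\<close>, and then \<open>Ad b x - x\<close> is comparable to \<open>b\<close>.\<close>

lemma orbit_first_order:
  assumes \<epsilon>: "\<epsilon> > 0"
  obtains \<rho> where "\<rho> > 0" "\<And>a. a \<in> carrier G \<Longrightarrow> norm (Adj a x - x) < \<rho> \<Longrightarrow>
    \<exists>u. norm (Adj a x - x - bra u x) \<le> \<epsilon> * norm (Adj a x - x)"
proof -
  \<comment> \<open>The complement is Euclidean rather than orthogonal for \<open>B\<close>, because
    the point p below minimises Euclidean distance in the chart.\<close>
  let ?O = "{v. \<forall>w\<in>cent x. v \<bullet> w = 0}"
  have subO: "subspace ?O" by (auto simp: subspace_def inner_add_left)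
  have "\<exists>e>0. \<forall>v\<in>?O. norm (bra x v) \<ge> e * norm v"
  proof (rule injective_imp_isometric[OF closed_subspace[OF subO] subO])
    show "bounded_linear (bra x)" using lin by (simp add: linear_conv_bounded_linear)
    show "\<forall>v\<in>?O. bra x v = 0 \<longrightarrow> v = 0" by (auto simp: cent_def)
  qed
  then obtain \<kappa> where \<kappa>: "\<kappa> > 0" "\<And>v. v \<in> ?O \<Longrightarrow> norm (bra x v) \<ge> \<kappa> * norm v" by blast
  obtain \<delta> where \<delta>: "\<delta> > 0" "\<And>u v. norm u \<le> \<delta> \<Longrightarrow> norm v \<le> \<delta> \<Longrightarrow>
      (org + u, org + v) \<in> mdom \<and> (\<forall>h. norm (\<mu>' (org + u, org + v) (0, h) - h) \<le> 1 / 2 * norm h)"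
    using mu'_estimate[of "1 / 2"] by auto
  \<comment> \<open>The first bound leaves norm (y - x) at least \<kappa> / 4 times norm u; the
    second then turns an error relative to u into one relative to y - x.\<close>
  define \<epsilon>1 where "\<epsilon>1 = min (\<kappa> / 4) (\<epsilon> * \<kappa> / 4)"
  have \<epsilon>1: "\<epsilon>1 > 0" "\<epsilon>1 \<le> \<kappa> / 4" "\<epsilon>1 \<le> \<epsilon> * \<kappa> / 4" using \<epsilon> \<kappa>(1) by (auto simp: \<epsilon>1_def)
  obtain d where d: "d > 0" "\<And>p. norm (p - org) < d \<Longrightarrow>
      norm (Adj (\<psi> p) x - Adj (\<psi> org) x - bra (p - org) x) \<le> \<epsilon>1 * norm (p - org)"
    using Ad_psi_has_derivative[of x] \<epsilon>1(1) unfolding has_derivative_at_alt by blast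
  define r where "r = min \<delta> d / 2"
  have r: "r > 0" "r < \<delta>" "r < d" using \<delta>(1) d(1) by (auto simp: r_def)
  have cb: "cball org r \<subseteq> \<phi> ` U"
  proof
    fix p assume "p \<in> cball org r"
    then have "norm (p - org) \<le> \<delta>" using r by (simp add: dist_norm norm_minus_commute)
    from \<delta>(2)[OF this, of 0] show "p \<in> \<phi> ` U" using \<delta>(1) by (simp add: mdom_def)
  qed
  obtain \<rho> where \<rho>: "\<rho> > 0" "\<And>a. a \<in> carrier G \<Longrightarrow> norm (Adj a x - x) < \<rho> \<Longrightarrow>
    \<exists>b\<in>U. norm (\<phi> b - org) < r \<and> Adj b x = Adj a x" using orbit_chart[OF r(1), of x] by metis
  show thesis
  proof (rule that[OF \<rho>(1)])
    fix a assume a: "a \<in> carrier G" "norm (Adj a x - x) < \<rho>"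
    define y where "y = Adj a x"
    obtain b where b: "b \<in> U" "norm (\<phi> b - org) < r" "Adj b x = y" using \<rho>(2)[OF a] by (auto simp: y_def)
    let ?Z = "{p \<in> cball org r. Adj (\<psi> p) x = y}"
    have "continuous_map (top_of_set (\<phi> ` U)) euclidean (\<lambda>p. Adj (\<psi> p) x)"
      using continuous_map_compose[OF psi_cont Ad_continuous] by (simp add: o_def)
    then have "continuous_on (cball org r) (\<lambda>p. Adj (\<psi> p) x)" using cb continuous_on_subset by auto
    then have clZ: "closed ?Z" by (rule continuous_closed_preimage_constant) simp
    have bZ: "\<phi> b \<in> ?Z" using b by (simp add: psi_phi dist_norm norm_minus_commute)
    obtain p where p: "p \<in> ?Z" "\<And>q. q \<in> ?Z \<Longrightarrow> dist org p \<le> dist org q"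
      using distance_attains_inf[OF clZ] bZ by blast
    define u where "u = p - org"
    have pu: "p = org + u" by (simp add: u_def)
    have ur: "norm u < r" using p(2)[OF bZ] b(2) by (simp add: u_def dist_norm norm_minus_commute)
    have pU: "p \<in> \<phi> ` U" using p(1) cb by blast
    have bp: "Adj (\<psi> p) x = y" using p(1) by simp
    have dom: "(org + u, org) \<in> mdom" "\<And>h. norm (\<mu>' (org + u, org) (0, h) - h) \<le> 1 / 2 * norm h"
      using \<delta>(2)[of u 0] ur r \<delta>(1) by auto
    \<comment> \<open>Right multiplication of p by \<open>\<gamma> s\<close> still represents y, so
      the squared distance to \<open>org\<close> has derivative 0 at s = 0. The velocity
      \<open>?L\<close> differs from w by at most half of norm w, whence the factor 1 / 2.\<close>
    have half: "\<bar>u \<bullet> w\<bar> \<le> 1 / 2 * (norm u * norm w)" if w: "w \<in> cent x" for w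
    proof -
      obtain \<gamma> where \<gamma>: "one_param \<gamma> w" by (rule one_param_exists)
      have fixx: "Adj (\<gamma> s) x = x" for s
        using one_param_fixes[OF \<gamma>] w cent_sym by (auto simp: cent_def)
      let ?L = "\<mu>' (org + u, org) (0, w)"
      define q where "q s = \<mu> (org + u, \<phi> (\<gamma> s)) - org" for s
      have q0: "q 0 = u" using pU by (simp add: q_def one_param_0[OF \<gamma>] org_def[symmetric] mu_org pu)
      have g: "((\<lambda>s. \<phi> (\<gamma> s)) has_derivative (\<lambda>s. s *\<^sub>R w)) (at 0)"
        using \<gamma> by (simp add: one_param_def has_vector_derivative_def o_def)
      have "((\<lambda>s. (org + u, \<phi> (\<gamma> s))) has_derivative (\<lambda>s. (0, s *\<^sub>R w))) (at 0)"
        by (rule has_derivative_Pair[OF has_derivative_const g])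
      moreover have "(\<mu> has_derivative \<mu>' (org + u, org)) (at (org + u, \<phi> (\<gamma> 0)))"
        using mu_has_derivative[OF dom(1)] by (simp add: one_param_0[OF \<gamma>] org_def)
      ultimately have "((\<lambda>s. \<mu> (org + u, \<phi> (\<gamma> s))) has_derivative (\<lambda>s. \<mu>' (org + u, org) (0, s *\<^sub>R w))) (at 0)"
        by (rule has_derivative_compose)
      moreover have "\<mu>' (org + u, org) (0, s *\<^sub>R w) = s *\<^sub>R ?L" for s
        using linear_scale[OF mu'_linear[OF dom(1)], of s "(0, w)"] by simp
      ultimately have "((\<lambda>s. \<mu> (org + u, \<phi> (\<gamma> s))) has_vector_derivative ?L) (at 0)"
        by (simp add: has_vector_derivative_def)
      then have qd: "(q has_vector_derivative ?L) (at 0)"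
        unfolding q_def by (auto intro!: derivative_eq_intros)
      have "((\<lambda>s. q s \<bullet> q s) has_vector_derivative (q 0 \<bullet> ?L + ?L \<bullet> q 0)) (at 0)"
        by (rule bounded_bilinear.has_vector_derivative[OF bounded_bilinear_inner qd qd])
      then have D: "((\<lambda>s. q s \<bullet> q s) has_real_derivative (2 * (u \<bullet> ?L))) (at 0)"
        by (simp add: has_real_derivative_iff_has_vector_derivative inner_commute q0)
      have "isCont q 0" using qd has_vector_derivative_continuous by blast
      then have "(q \<longlongrightarrow> u) (nhds 0)" using isCont_tendsto_nhds q0 by metis
      then have ev1: "\<forall>\<^sub>F s in nhds 0. dist (q s) u < r - norm u" using ur by (intro tendstoD) auto
      have pc: "\<psi> p \<in> carrier G" by (rule psi_carrier[OF pU])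
      have "openin X {c \<in> topspace X. \<psi> p \<otimes>\<^bsub>G\<^esub> c \<in> U}"
        by (rule openin_continuous_map_preimage[OF lmult_cont[OF pc] chart_openin[OF UA]])
      moreover have "\<gamma> 0 \<in> {c \<in> topspace X. \<psi> p \<otimes>\<^bsub>G\<^esub> c \<in> U}"
        using pc psi_in[OF pU] by (simp add: one_param_0[OF \<gamma>] topspace_eq)
      ultimately have ev2: "\<forall>\<^sub>F s in nhds 0. \<gamma> s \<in> {c \<in> topspace X. \<psi> p \<otimes>\<^bsub>G\<^esub> c \<in> U}"
        by (intro ev_curve) (use \<gamma> in \<open>simp add: one_param_def\<close>)
      have "\<forall>\<^sub>F s in nhds 0. u \<bullet> u \<le> q s \<bullet> q s"
        using ev1 ev2 one_param_ev[OF \<gamma>]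
      proof eventually_elim
        case (elim s)
        have n: "norm (q s) < r" using elim(1) norm_triangle_ineq2[of "q s" u] by (simp add: dist_norm)
        have qs: "org + q s = \<phi> (\<psi> p \<otimes>\<^bsub>G\<^esub> \<gamma> s)" using elim(3) by (simp add: q_def \<mu>_def psi_phi pu)
        then have "\<psi> (org + q s) = \<psi> p \<otimes>\<^bsub>G\<^esub> \<gamma> s" using elim(2) psi_phi by simp
        then have "Adj (\<psi> (org + q s)) x = y" using bp fixx pc one_param_carrier[OF \<gamma>] by (simp add: Ad_mult)
        then have "org + q s \<in> ?Z" using n by (simp add: dist_norm)
        from p(2)[OF this] have "norm u \<le> norm (q s)" by (simp add: dist_norm pu)
        then show ?case by (simp add: norm_le)
      qed
      then obtain e where e: "e > 0" "\<And>s. dist s 0 < e \<Longrightarrow> u \<bullet> u \<le> q s \<bullet> q s"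
        unfolding eventually_nhds_metric by blast
      have "2 * (u \<bullet> ?L) = 0"
        by (rule DERIV_local_min[OF D e(1)]) (use e(2) q0 in \<open>auto simp: dist_norm\<close>)
      then have "u \<bullet> w = - (u \<bullet> (?L - w))" by (simp add: inner_diff_right)
      then have "\<bar>u \<bullet> w\<bar> \<le> norm u * norm (?L - w)" using Cauchy_Schwarz_ineq2[of u "?L - w"] by simp
      also have "\<dots> \<le> norm u * (1 / 2 * norm w)" using dom(2) by (intro mult_left_mono) auto
      finally show ?thesis by simp
    qed
    obtain k v where kv: "u = k + v" "k \<in> cent x" "v \<in> ?O"
    proof -
      obtain k v where "k \<in> span (cent x)" "\<And>w. w \<in> span (cent x) \<Longrightarrow> orthogonal v w" "u = k + v"
        using orthogonal_subspace_decomp_exists[of "cent x" u] by metis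
      then show thesis using that subspace_cent[of x] by (simp add: span_eq_iff[THEN iffD2] orthogonal_def)
    qed
    have "v \<bullet> k = 0" using kv by simp
    \<comment> \<open>With w = k in \<open>half\<close>, the part of u along the centraliser is at
      most half of u. So v is at least half of u, and ad x is bounded below on it.\<close>
    then have kk: "norm k * norm k = u \<bullet> k" by (simp add: kv(1) inner_add_left dot_square_norm power2_eq_square)
    have "norm k * norm k \<le> (1 / 2 * norm u) * norm k" using half[OF kv(2)] kk by simp
    then have "norm k \<le> 1 / 2 * norm u" by (cases "norm k = 0") (auto simp: mult_le_cancel_right)
    moreover have "norm u \<le> norm k + norm v" using kv(1) norm_triangle_ineq by blast
    ultimately have "norm v \<ge> 1 / 2 * norm u" by linarith
    then have "\<kappa> * (1 / 2 * norm u) \<le> \<kappa> * norm v" using \<kappa>(1) by (intro mult_left_mono) auto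
    also have "\<dots> \<le> norm (bra x v)" by (rule \<kappa>(2)[OF kv(3)])
    also have "bra x v = bra x u" using kv by (simp add: br_simps cent_def)
    also have "norm (bra x u) = norm (bra u x)" using bra_anti[of x u] by simp
    finally have lo: "\<kappa> / 2 * norm u \<le> norm (bra u x)" by simp
    have est: "norm (y - x - bra u x) \<le> \<epsilon>1 * norm u"
      using d(2)[of p] ur r bp by (simp add: psi_org Ad_one u_def)
    have "norm (bra u x) \<le> norm (y - x) + norm (y - x - bra u x)" by (metis norm_triangle_sub norm_minus_commute)
    then have "\<kappa> / 2 * norm u \<le> norm (y - x) + \<kappa> / 4 * norm u"
      using lo est mult_right_mono[OF \<epsilon>1(2), of "norm u"] by auto
    then have "\<kappa> / 4 * norm u \<le> norm (y - x)" by simp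
    then have "\<epsilon> * (\<kappa> / 4 * norm u) \<le> \<epsilon> * norm (y - x)" using \<epsilon> by (intro mult_left_mono) auto
    moreover have "\<epsilon>1 * norm u \<le> \<epsilon> * \<kappa> / 4 * norm u" using \<epsilon>1(3) by (intro mult_right_mono) auto
    ultimately have "norm (y - x - bra u x) \<le> \<epsilon> * norm (y - x)" using est by simp
    then show "\<exists>u. norm (Adj a x - x - bra u x) \<le> \<epsilon> * norm (Adj a x - x)" unfolding y_def by blast
  qed
qed

text \<open>The first-order part [u, x] lies in the image of ad x and is orthogonal to z. Only the
  remainder is paired with z, and \<epsilon> / K compensates for the norm K of that pairing.\<close>

lemma orbit_normal:
  assumes z: "z \<in> cent x" and \<epsilon>: "\<epsilon> > 0"
  obtains \<rho> where "\<rho> > 0" "\<And>a. a \<in> carrier G \<Longrightarrow> norm (Adj a x - x) < \<rho> \<Longrightarrow>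
    \<bar>B (Adj a x - x) z\<bar> \<le> \<epsilon> * norm (Adj a x - x)"
proof -
  obtain K where K: "K > 0" "\<And>v. norm (B v z) \<le> norm v * K"
    using bounded_linear.pos_bounded[of "\<lambda>v. B v z"] B_linear_left[of z] by (auto simp: linear_conv_bounded_linear)
  obtain \<rho> where \<rho>: "\<rho> > 0" "\<And>a. a \<in> carrier G \<Longrightarrow> norm (Adj a x - x) < \<rho> \<Longrightarrow>
    \<exists>u. norm (Adj a x - x - bra u x) \<le> \<epsilon> / K * norm (Adj a x - x)"
    using orbit_first_order[of "\<epsilon> / K" x] \<epsilon> K(1) by (metis divide_pos_pos)
  show thesis
  proof (rule that[OF \<rho>(1)])
    fix a assume "a \<in> carrier G" "norm (Adj a x - x) < \<rho>"
    then obtain u where u: "norm (Adj a x - x - bra u x) \<le> \<epsilon> / K * norm (Adj a x - x)" using \<rho>(2) by blast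
    have "bra u x \<in> range (bra x)" using bra_anti[of u x] bilinear_rneg[OF bra_bilinear, of x u] by (metis rangeI)
    then have "B (bra u x) z = 0" using z cent_iff_orth by blast
    then have "\<bar>B (Adj a x - x) z\<bar> = \<bar>B (Adj a x - x - bra u x) z\<bar>" using linear_diff[OF B_linear_left] by simp
    also have "\<dots> \<le> norm (Adj a x - x - bra u x) * K" using K(2) by simp
    also have "\<dots> \<le> \<epsilon> / K * norm (Adj a x - x) * K" using u K(1) by (intro mult_right_mono) auto
    finally show "\<bar>B (Adj a x - x) z\<bar> \<le> \<epsilon> * norm (Adj a x - x)" using K(1) by simp
  qed
qed

lemma B_bilinear: "bilinear B" unfolding bilinear_def using B_linear B_linear_left by blast

lemma B_coercive: obtains k where "k > 0" "\<And>v. k * (norm v)\<^sup>2 \<le> B v v"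
proof -
  have "continuous_on (sphere 0 1) (\<lambda>v. B v v)"
    using B_bilinear bilinear_continuous_on_compose[OF continuous_on_id continuous_on_id]
    by (simp add: bilinear_conv_bounded_bilinear)
  then have "\<exists>v0\<in>sphere 0 1. \<forall>v\<in>sphere 0 1. B v0 v0 \<le> B v v"
    by (intro continuous_attains_inf) simp_all
  then obtain v0 where v0: "v0 \<in> sphere 0 1" "\<And>v. v \<in> sphere 0 1 \<Longrightarrow> B v0 v0 \<le> B v v"
    by blast
  have "v0 \<noteq> 0" using v0(1) by auto
  then have "B v0 v0 > 0" by (rule B_pos)
  moreover have "B v0 v0 * (norm v)\<^sup>2 \<le> B v v" for v
  proof (cases "v = 0")
    case True then show ?thesis using B_bilinear by (simp add: bilinear_lzero)
  next
    case False
    let ?w = "(1 / norm v) *\<^sub>R v"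
    have "B v0 v0 \<le> B ?w ?w" using False by (intro v0(2)) simp
    also have "\<dots> = B v v / (norm v)\<^sup>2"
      by (simp add: bilinear_lmul[OF B_bilinear] bilinear_rmul[OF B_bilinear] power2_eq_square)
    finally show ?thesis using False by (simp add: field_simps)
  qed
  ultimately show thesis using that by blast
qed

section \<open>Uniqueness of one-parameter subgroups\<close>

text \<open>If b is near the identity with displacement u and acts trivially, the first-order
  expansion of \<open>Ad\<close> makes ad u small compared with u. Then \<open>B u u\<close>, minus
  the trace of the square of ad u, is too small for coercivity unless u = 0.\<close>

lemma Ad_locally_faithful:
  obtains W where "openin X W" "\<one>\<^bsub>G\<^esub> \<in> W" "\<And>b. b \<in> W \<Longrightarrow> (\<And>v. Adj b v = v) \<Longrightarrow> b = \<one>\<^bsub>G\<^esub>"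
proof -
  obtain k where k: "k > 0" "\<And>v. k * (norm v)\<^sup>2 \<le> B v v" by (rule B_coercive) blast
  obtain C where C: "C > 0" "\<And>x y. norm (bra x y) \<le> C * norm x * norm y" using br_bounded by blast
  define n where "n = real DIM('m)"
  have n: "n > 0" by (simp add: n_def)
  \<comment> \<open>Makes n * n * \<epsilon> * C equal to k / 2; one factor n is lost in
    \<open>linear_basis_bound\<close>, the other in the trace.\<close>
  define \<epsilon> where "\<epsilon> = k / (2 * n * n * C)"
  have \<epsilon>: "\<epsilon> > 0" using k C n by (simp add: \<epsilon>_def)
  have "\<forall>\<^sub>F p in nhds org. norm (Adj (\<psi> p) b - b - bra (p - org) b) \<le> \<epsilon> * norm (p - org)" for b
  proof -
    obtain d where "d > 0" "\<And>p. norm (p - org) < d \<Longrightarrow>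
      norm (Adj (\<psi> p) b - Adj (\<psi> org) b - bra (p - org) b) \<le> \<epsilon> * norm (p - org)"
      using Ad_psi_has_derivative[of b] \<epsilon> unfolding has_derivative_at_alt by blast
    then show ?thesis unfolding eventually_nhds_metric by (auto simp: dist_norm psi_org Ad_one)
  qed
  then have "\<forall>\<^sub>F p in nhds org. \<forall>b\<in>Basis. norm (Adj (\<psi> p) b - b - bra (p - org) b) \<le> \<epsilon> * norm (p - org)"
    by (simp add: eventually_ball_finite_distrib)
  then obtain S where S: "open S" "org \<in> S"
    "\<And>p b. p \<in> S \<Longrightarrow> b \<in> Basis \<Longrightarrow> norm (Adj (\<psi> p) b - b - bra (p - org) b) \<le> \<epsilon> * norm (p - org)"
    by (auto simp: eventually_nhds)
  let ?W = "{b \<in> U. \<phi> b \<in> S}"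
  have W: "openin X ?W" by (rule openin_chart_vimage) (use S in simp)
  show thesis
  proof (rule that[OF W])
    show "\<one>\<^bsub>G\<^esub> \<in> ?W" using oneU S(2) by (simp add: org_def)
    fix b assume b: "b \<in> ?W" and id: "\<And>v. Adj b v = v"
    define u where "u = \<phi> b - org"
    have "norm (bra u c) \<le> \<epsilon> * norm u" if "c \<in> Basis" for c
      using S(3)[of "\<phi> b" c] b that by (simp add: psi_phi id u_def)
    then have 1: "norm (bra u v) \<le> n * (\<epsilon> * norm u) * norm v" for v
      unfolding n_def by (rule linear_basis_bound[OF lin])
    have "B u u = (\<Sum>c\<in>Basis. - (bra u (bra u c) \<bullet> c))" by (simp add: B_def linear_trace_def sum_negf)
    also have "\<dots> \<le> (\<Sum>c\<in>(Basis :: 'm set). n * (\<epsilon> * norm u) * (C * norm u))"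
    proof (rule sum_mono)
      fix c :: 'm assume c: "c \<in> Basis"
      have "- (bra u (bra u c) \<bullet> c) \<le> norm (bra u (bra u c))" using Basis_le_norm[OF c, of "bra u (bra u c)"] by linarith
      also have "\<dots> \<le> n * (\<epsilon> * norm u) * norm (bra u c)" by (rule 1)
      also have "\<dots> \<le> n * (\<epsilon> * norm u) * (C * norm u)"
        using C(2)[of u c] c n \<epsilon> by (intro mult_left_mono) auto
      finally show "- (bra u (bra u c) \<bullet> c) \<le> n * (\<epsilon> * norm u) * (C * norm u)" .
    qed
    also have "\<dots> = (n * n * \<epsilon> * C) * (norm u)\<^sup>2" by (simp add: n_def power2_eq_square)
    also have "n * n * \<epsilon> * C = k / 2" using n C by (simp add: \<epsilon>_def)
    finally have "k * (norm u)\<^sup>2 \<le> k / 2 * (norm u)\<^sup>2" using k(2)[of u] by linarith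
    then have "u = 0" using k(1) by simp
    then have "\<phi> b = \<phi> \<one>\<^bsub>G\<^esub>" by (simp add: u_def org_def)
    then show "b = \<one>\<^bsub>G\<^esub>" using chart_inj[OF UA] b oneU by (simp add: inj_on_eq_iff)
  qed
qed

lemma one_param_minus: "one_param \<gamma> w \<Longrightarrow> \<gamma> (- t) = inv\<^bsub>G\<^esub> (\<gamma> t)"
  using one_param_0[of \<gamma> w] one_param_carrier[of \<gamma> w] unfolding one_param_def
  by (metis add.left_inverse inv_equality)

text \<open>The images of both curves under \<open>Ad\<close> solve the same linear equation, so
  their quotient \<open>d\<close> acts trivially. The times with \<open>d s\<close> equal to the
  identity are open by \<open>Ad_locally_faithful\<close> and closed by the Hausdorff property,
  hence fill the half-line.\<close>

lemma one_param_unique: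
  assumes \<gamma>: "one_param \<gamma> w" and \<sigma>: "one_param \<sigma> w"
  shows "\<gamma> t = \<sigma> t"
proof -
  note c = one_param_carrier[OF \<gamma>] one_param_carrier[OF \<sigma>]
  obtain C where C: "C > 0" "\<And>x y. norm (bra x y) \<le> C * norm x * norm y" using br_bounded by blast
  have eq: "Adj (\<gamma> s) v = Adj (\<sigma> s) v" if s: "0 \<le> s" for s v
  proof -
    have "(\<lambda>s. Adj (\<gamma> s) v - Adj (\<sigma> s) v) s = 0"
    proof (rule gronwall_zero[where b = s and C = "C * norm w" and h' = "\<lambda>s. bra w (Adj (\<gamma> s) v - Adj (\<sigma> s) v)"])
      fix r
      show "((\<lambda>s. Adj (\<gamma> s) v - Adj (\<sigma> s) v) has_vector_derivative bra w (Adj (\<gamma> r) v - Adj (\<sigma> r) v)) (at r)"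
        using has_vector_derivative_diff[OF one_param_Ad(1)[OF \<gamma>] one_param_Ad(1)[OF \<sigma>]]
        by (simp add: linear_diff[OF lin])
      show "norm (bra w (Adj (\<gamma> r) v - Adj (\<sigma> r) v)) \<le> C * norm w * norm (Adj (\<gamma> r) v - Adj (\<sigma> r) v)" by (rule C)
    qed (use s in \<open>auto simp: one_param_0[OF \<gamma>] one_param_0[OF \<sigma>]\<close>)
    then show ?thesis by simp
  qed
  obtain W where W: "openin X W" "\<one>\<^bsub>G\<^esub> \<in> W" "\<And>b. b \<in> W \<Longrightarrow> (\<And>v. Adj b v = v) \<Longrightarrow> b = \<one>\<^bsub>G\<^esub>"
    using Ad_locally_faithful by metis
  define d where "d s = \<gamma> s \<otimes>\<^bsub>G\<^esub> inv\<^bsub>G\<^esub> (\<sigma> s)" for s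
  have dc: "continuous_map euclideanreal X d"
    unfolding d_def using \<gamma> \<sigma> by (intro mult_cont' inv_cont') (simp_all add: one_param_def)
  have d1: "d s = \<one>\<^bsub>G\<^esub>" if "d s \<in> W" "0 \<le> s" for s
  proof (rule W(3)[OF that(1)])
    fix v
    have "Adj (d s) v = Adj (\<gamma> s) (Adj (inv\<^bsub>G\<^esub> (\<sigma> s)) v)" using c by (simp add: d_def Ad_mult)
    also have "\<dots> = Adj (\<sigma> s) (Adj (inv\<^bsub>G\<^esub> (\<sigma> s)) v)" by (rule eq[OF that(2)])
    also have "\<dots> = v" using c by (simp add: Ad_inv)
    finally show "Adj (d s) v = v" .
  qed
  let ?S = "{s \<in> {0..}. d s = \<one>\<^bsub>G\<^esub>}"
  have "openin euclideanreal {s \<in> topspace euclideanreal. d s \<in> W}"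
    by (rule openin_continuous_map_preimage[OF dc W(1)])
  then have "open {s. d s \<in> W}" by simp
  moreover have "?S = {0..} \<inter> {s. d s \<in> W}" using d1 W(2) by auto
  ultimately have op: "openin (top_of_set {0..}) ?S" by (metis openin_open)
  have "closedin X {\<one>\<^bsub>G\<^esub>}" using Hausdorff by (simp add: closedin_Hausdorff_singleton topspace_eq)
  then have "closedin euclideanreal {s \<in> topspace euclideanreal. d s \<in> {\<one>\<^bsub>G\<^esub>}}"
    by (rule closedin_continuous_map_preimage[OF dc])
  then have "closed {s. d s = \<one>\<^bsub>G\<^esub>}" by simp
  moreover have "?S = {0..} \<inter> {s. d s = \<one>\<^bsub>G\<^esub>}" by auto
  ultimately have cl: "closedin (top_of_set {0..}) ?S" by (metis closedin_closed)
  have "connected {0::real..}" by simp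
  then have "?S = {} \<or> ?S = {0..}" using op cl unfolding connected_clopen by blast
  moreover have "0 \<in> ?S" by (simp add: d_def one_param_0[OF \<gamma>] one_param_0[OF \<sigma>])
  ultimately have all: "?S = {0..}" by auto
  have pos: "\<gamma> s = \<sigma> s" if "0 \<le> s" for s
  proof -
    have "s \<in> ?S" using that all by auto
    then have "\<gamma> s \<otimes>\<^bsub>G\<^esub> inv\<^bsub>G\<^esub> (\<sigma> s) = \<one>\<^bsub>G\<^esub>" by (simp add: d_def)
    then show ?thesis using c by (metis inv_equality inv_closed inv_inv)
  qed
  show ?thesis
  proof (cases "0 \<le> t")
    case False
    then have "\<gamma> (- t) = \<sigma> (- t)" by (intro pos) simp
    then show ?thesis using one_param_minus[OF \<gamma>, of "- t"] one_param_minus[OF \<sigma>, of "- t"] by simp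
  qed (rule pos)
qed

lemma one_param_conj:
  assumes \<gamma>: "one_param \<gamma> w" and a: "a \<in> carrier G"
  shows "one_param (\<lambda>t. a \<otimes>\<^bsub>G\<^esub> \<gamma> t \<otimes>\<^bsub>G\<^esub> inv\<^bsub>G\<^esub> a) (Adj a w)"
  unfolding one_param_def
proof (intro conjI allI)
  note c = one_param_carrier[OF \<gamma>]
  have d: "((\<phi> \<circ> \<gamma>) has_vector_derivative w) (at 0)" using \<gamma> by (simp add: one_param_def)
  show "continuous_map euclideanreal X (\<lambda>t. a \<otimes>\<^bsub>G\<^esub> \<gamma> t \<otimes>\<^bsub>G\<^esub> inv\<^bsub>G\<^esub> a)"
    using \<gamma> a by (intro mult_cont') (simp_all add: one_param_def topspace_eq)
  show "((\<phi> \<circ> (\<lambda>t. a \<otimes>\<^bsub>G\<^esub> \<gamma> t \<otimes>\<^bsub>G\<^esub> inv\<^bsub>G\<^esub> a)) has_vector_derivative Adj a w) (at 0)"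
    using Ad_curve[OF a one_param_ev[OF \<gamma>] one_param_0[OF \<gamma>] d] by (simp add: o_def)
  fix s t
  have "\<gamma> (s + t) = \<gamma> s \<otimes>\<^bsub>G\<^esub> \<gamma> t" using \<gamma> by (simp add: one_param_def)
  moreover have "inv\<^bsub>G\<^esub> a \<otimes>\<^bsub>G\<^esub> (a \<otimes>\<^bsub>G\<^esub> (\<gamma> t \<otimes>\<^bsub>G\<^esub> inv\<^bsub>G\<^esub> a)) = \<gamma> t \<otimes>\<^bsub>G\<^esub> inv\<^bsub>G\<^esub> a"
    using a c[of t] by (simp add: m_assoc[symmetric])
  ultimately show "a \<otimes>\<^bsub>G\<^esub> \<gamma> (s + t) \<otimes>\<^bsub>G\<^esub> inv\<^bsub>G\<^esub> a
      = a \<otimes>\<^bsub>G\<^esub> \<gamma> s \<otimes>\<^bsub>G\<^esub> inv\<^bsub>G\<^esub> a \<otimes>\<^bsub>G\<^esub> (a \<otimes>\<^bsub>G\<^esub> \<gamma> t \<otimes>\<^bsub>G\<^esub> inv\<^bsub>G\<^esub> a)"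
    using a c by (simp add: m_assoc)
qed

text \<open>Conjugation by a gives the one-parameter subgroup with velocity \<open>Ad a w\<close>,
  and velocities determine one-parameter subgroups.\<close>

lemma one_param_commute_iff:
  assumes \<gamma>: "one_param \<gamma> w" and a: "a \<in> carrier G"
  shows "(\<forall>t. a \<otimes>\<^bsub>G\<^esub> \<gamma> t = \<gamma> t \<otimes>\<^bsub>G\<^esub> a) \<longleftrightarrow> Adj a w = w"
proof
  note c = one_param_carrier[OF \<gamma>]
  have e: "a \<otimes>\<^bsub>G\<^esub> \<gamma> t \<otimes>\<^bsub>G\<^esub> inv\<^bsub>G\<^esub> a = \<gamma> t \<longleftrightarrow> a \<otimes>\<^bsub>G\<^esub> \<gamma> t = \<gamma> t \<otimes>\<^bsub>G\<^esub> a" for t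
    using a c[of t] by (metis inv_solve_right m_closed)
  show "Adj a w = w" if "\<forall>t. a \<otimes>\<^bsub>G\<^esub> \<gamma> t = \<gamma> t \<otimes>\<^bsub>G\<^esub> a"
  proof -
    have "(\<lambda>t. a \<otimes>\<^bsub>G\<^esub> \<gamma> t \<otimes>\<^bsub>G\<^esub> inv\<^bsub>G\<^esub> a) = \<gamma>" using that e by blast
    then have "one_param \<gamma> (Adj a w)" using one_param_conj[OF \<gamma> a] by simp
    then show ?thesis using \<gamma> vector_derivative_unique_at unfolding one_param_def by blast
  qed
  show "\<forall>t. a \<otimes>\<^bsub>G\<^esub> \<gamma> t = \<gamma> t \<otimes>\<^bsub>G\<^esub> a" if "Adj a w = w"
  proof
    fix t
    have "one_param (\<lambda>t. a \<otimes>\<^bsub>G\<^esub> \<gamma> t \<otimes>\<^bsub>G\<^esub> inv\<^bsub>G\<^esub> a) w" using one_param_conj[OF \<gamma> a] that by simp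
    from one_param_unique[OF this \<gamma>, of t] show "a \<otimes>\<^bsub>G\<^esub> \<gamma> t = \<gamma> t \<otimes>\<^bsub>G\<^esub> a" using e by simp
  qed
qed

section \<open>Lie algebras of maximal tori\<close>

lemma subgroup_lie_algebra_eq:
  "subgroup_lie_algebra G X \<phi> T = {x. \<exists>\<gamma>. one_param \<gamma> x \<and> (\<forall>t. \<gamma> t \<in> T)}"
  unfolding subgroup_lie_algebra_def one_param_def by blast

text \<open>Elements of T commute with the one-parameter subgroups in T and so fix their velocities;
  differentiating this along such a subgroup makes the brackets vanish.\<close>

lemma abelian_lie_algebra:
  assumes x: "x \<in> subgroup_lie_algebra G X \<phi> T" and T: "subgroup T G"
    and ab: "\<And>a b. a \<in> T \<Longrightarrow> b \<in> T \<Longrightarrow> a \<otimes>\<^bsub>G\<^esub> b = b \<otimes>\<^bsub>G\<^esub> a"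
  shows "a \<in> T \<Longrightarrow> Adj a x = x" and "subgroup_lie_algebra G X \<phi> T \<subseteq> cent x"
proof -
  have fixT: "Adj a y = y" if "a \<in> T" "y \<in> subgroup_lie_algebra G X \<phi> T" for a y
  proof -
    obtain \<gamma> where \<gamma>: "one_param \<gamma> y" "\<And>t. \<gamma> t \<in> T" using \<open>y \<in> _\<close> by (auto simp: subgroup_lie_algebra_eq)
    have "a \<in> carrier G" using T that(1) by (rule subgroup.mem_carrier)
    then show ?thesis using one_param_commute_iff[OF \<gamma>(1)] ab[OF that(1) \<gamma>(2)] by blast
  qed
  then show "a \<in> T \<Longrightarrow> Adj a x = x" using x by blast
  obtain \<gamma> where \<gamma>: "one_param \<gamma> x" "\<And>t. \<gamma> t \<in> T" using x by (auto simp: subgroup_lie_algebra_eq)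
  show "subgroup_lie_algebra G X \<phi> T \<subseteq> cent x"
  proof
    fix y assume "y \<in> subgroup_lie_algebra G X \<phi> T"
    then have "\<And>t. Adj (\<gamma> t) y = y" using fixT \<gamma>(2) by blast
    then have "((\<lambda>t. y) has_vector_derivative bra x y) (at 0)" using one_param_Ad(1)[OF \<gamma>(1), of y 0] by simp
    then have "bra x y = 0" using vector_derivative_unique_at has_vector_derivative_const by blast
    then show "y \<in> cent x" by (simp add: cent_def)
  qed
qed

text \<open>The displacement of a commuting orbit point lies in \<open>cent y\<close>, whereas to
  first order it lies in the image of ad y, which is orthogonal to \<open>cent y\<close>. Close to y
  both cannot hold for a nonzero displacement; k / (2 K') makes the error at most half of the
  coercivity bound.\<close>

lemma orbit_commuting_isolated:
  obtains \<rho> where "\<rho> > 0"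
    "\<And>a. a \<in> carrier G \<Longrightarrow> norm (Adj a y - y) < \<rho> \<Longrightarrow> bra y (Adj a y) = 0 \<Longrightarrow> Adj a y = y"
proof -
  obtain k where k: "k > 0" "\<And>v. k * (norm v)\<^sup>2 \<le> B v v" by (rule B_coercive) blast
  obtain K where K: "\<forall>u v. norm (B u v) \<le> K * norm u * norm v" using bilinear_bounded[OF B_bilinear] by blast
  define K' where "K' = \<bar>K\<bar> + 1"
  have K': "K' > 0" "\<And>u v. B u v \<le> K' * norm u * norm v"
  proof -
    show "K' > 0" by (simp add: K'_def add_nonneg_pos)
    fix u v
    have "B u v \<le> K * norm u * norm v" using K by (metis abs_ge_self order_trans real_norm_def)
    also have "\<dots> \<le> K' * norm u * norm v" unfolding K'_def by (intro mult_right_mono) auto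
    finally show "B u v \<le> K' * norm u * norm v" .
  qed
  obtain \<rho> where \<rho>: "\<rho> > 0" "\<And>a. a \<in> carrier G \<Longrightarrow> norm (Adj a y - y) < \<rho> \<Longrightarrow>
    \<exists>u. norm (Adj a y - y - bra u y) \<le> k / (2 * K') * norm (Adj a y - y)"
    using orbit_first_order[of "k / (2 * K')" y] k(1) K'(1) by (metis divide_pos_pos mult_pos_pos zero_less_numeral)
  show thesis
  proof (rule that[OF \<rho>(1)])
    fix a assume a: "a \<in> carrier G" "norm (Adj a y - y) < \<rho>" "bra y (Adj a y) = 0"
    define v where "v = Adj a y - y"
    have v: "v \<in> cent y" using a(3) by (simp add: v_def cent_def br_simps br_self)
    obtain u where u: "norm (v - bra u y) \<le> k / (2 * K') * norm v" using \<rho>(2)[OF a(1,2)] by (auto simp: v_def)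
    have "bra u y \<in> range (bra y)" using bra_anti[of u y] bilinear_rneg[OF bra_bilinear, of y u] by (metis rangeI)
    then have "B (bra u y) v = 0" using v cent_iff_orth by blast
    then have "B v v = B (v - bra u y) v" using linear_diff[OF B_linear_left] by simp
    also have "\<dots> \<le> K' * norm (v - bra u y) * norm v" by (rule K')
    also have "\<dots> \<le> K' * (k / (2 * K') * norm v) * norm v" using u K'(1) by (intro mult_right_mono mult_left_mono) auto
    also have "\<dots> = k / 2 * (norm v)\<^sup>2" using K'(1) by (simp add: power2_eq_square)
    finally have "k * (norm v)\<^sup>2 \<le> k / 2 * (norm v)\<^sup>2" using k(2)[of v] by linarith
    then have "v = 0" using k(1) by simp
    then show "Adj a y = y" by (simp add: v_def)
  qed
qed

text \<open>T fixes x, so the T-orbit of y stays in \<open>cent x\<close>, where all elements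
  commute. Hence y is isolated in it, and a connected set with an isolated point is a single
  point.\<close>

lemma torus_acts_trivially:
  assumes T: "torus_in G X T" and x: "x \<in> subgroup_lie_algebra G X \<phi> T" "x \<in> reg"
    and y: "y \<in> cent x" and a: "a \<in> T"
  shows "Adj a y = y"
proof -
  have sT: "subgroup T G" and ab: "\<And>a b. a \<in> T \<Longrightarrow> b \<in> T \<Longrightarrow> a \<otimes>\<^bsub>G\<^esub> b = b \<otimes>\<^bsub>G\<^esub> a" and cT: "connectedin X T"
    using T by (auto simp: torus_in_def)
  note Tc = subgroup.mem_carrier[OF sT]
  have inc: "Adj b y \<in> cent x" if "b \<in> T" for b
  proof -
    have "bra x (Adj b y) = bra (Adj b x) (Adj b y)" using abelian_lie_algebra(1)[OF x(1) sT ab that] by simp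
    also have "\<dots> = Adj b (bra x y)" using Ad_bra[OF Tc[OF that]] by simp
    also have "\<dots> = 0" using y linear_0[OF Ad_linear[OF Tc[OF that]]] by (simp add: cent_def)
    finally show ?thesis by (simp add: cent_def)
  qed
  let ?Y = "(\<lambda>b. Adj b y) ` T"
  have "connectedin euclidean ?Y" by (rule connectedin_continuous_map_image[OF Ad_continuous cT])
  then have conn: "connected ?Y" by simp
  have oneT: "\<one>\<^bsub>G\<^esub> \<in> T" by (rule subgroup.one_closed[OF sT])
  have yY: "y \<in> ?Y" using oneT Ad_one by (metis image_eqI)
  have niso: "\<not> y islimpt ?Y"
  proof
    assume lim: "y islimpt ?Y"
    obtain \<rho> where \<rho>: "\<rho> > 0"
      "\<And>a. a \<in> carrier G \<Longrightarrow> norm (Adj a y - y) < \<rho> \<Longrightarrow> bra y (Adj a y) = 0 \<Longrightarrow> Adj a y = y"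
      using orbit_commuting_isolated[of y] by metis
    obtain b where b: "b \<in> T" "Adj b y \<noteq> y" "dist (Adj b y) y < \<rho>"
      using lim \<rho>(1) unfolding islimpt_approachable by blast
    have "bra y (Adj b y) = 0" by (rule cent_abelian[OF x(2) y inc[OF b(1)]])
    then show False using \<rho>(2)[OF Tc[OF b(1)]] b by (simp add: dist_norm)
  qed
  then obtain z where "?Y = {z}" using connected_imp_perfect[OF conn yY] by blast
  then show ?thesis using yY imageI[OF a, of "\<lambda>b. Adj b y"] by (simp only: singleton_iff)
qed

lemma closure_subgroup:
  assumes "subgroup S G" shows "subgroup (X closure_of S) G"
proof (rule subgroupI)
  have SC: "S \<subseteq> topspace X" using subgroup.subset[OF assms] topspace_eq by simp
  then have S: "S \<subseteq> X closure_of S" by (rule closure_of_subset)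
  show "(X closure_of S) \<subseteq> carrier G" using closure_of_subset_topspace[of X S] by (simp add: topspace_eq)
  show "X closure_of S \<noteq> {}" using subsetD[OF S subgroup.one_closed[OF assms]] by (metis empty_iff)
  have "(\<lambda>a. inv\<^bsub>G\<^esub> a) ` (X closure_of S) \<subseteq> X closure_of ((\<lambda>a. inv\<^bsub>G\<^esub> a) ` S)"
    by (rule continuous_map_image_closure_subset[OF inv_cont])
  also have "\<dots> \<subseteq> X closure_of S"
    by (rule closure_of_mono) (simp add: image_subset_iff subgroup.m_inv_closed[OF assms])
  finally show "\<And>a. a \<in> X closure_of S \<Longrightarrow> inv\<^bsub>G\<^esub> a \<in> X closure_of S"
    by (simp only: image_subset_iff)
  have "(\<lambda>(a, b). a \<otimes>\<^bsub>G\<^esub> b) ` ((prod_topology X X) closure_of (S \<times> S)) \<subseteq> X closure_of ((\<lambda>(a, b). a \<otimes>\<^bsub>G\<^esub> b) ` (S \<times> S))"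
    by (rule continuous_map_image_closure_subset[OF mult_cont])
  also have "\<dots> \<subseteq> X closure_of S"
    by (rule closure_of_mono) (simp add: image_subset_iff subgroup.m_closed[OF assms])
  finally show "\<And>a b. a \<in> X closure_of S \<Longrightarrow> b \<in> X closure_of S \<Longrightarrow> a \<otimes>\<^bsub>G\<^esub> b \<in> X closure_of S"
    unfolding closure_of_Times image_subset_iff by simp
qed

text \<open>In a Hausdorff group the elements commuting with b form a closed set.\<close>

lemma closure_commutes:
  assumes S: "S \<subseteq> carrier G" and b: "b \<in> carrier G" and com: "\<And>a. a \<in> S \<Longrightarrow> a \<otimes>\<^bsub>G\<^esub> b = b \<otimes>\<^bsub>G\<^esub> a"
    and a: "a \<in> X closure_of S"
  shows "a \<otimes>\<^bsub>G\<^esub> b = b \<otimes>\<^bsub>G\<^esub> a"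
proof -
  have cl: "closedin X {a \<in> topspace X. a \<otimes>\<^bsub>G\<^esub> b = b \<otimes>\<^bsub>G\<^esub> a}"
    by (rule closedin_continuous_maps_eq[OF Hausdorff rmult_cont[OF b] lmult_cont[OF b]])
  have "S \<subseteq> {a \<in> topspace X. a \<otimes>\<^bsub>G\<^esub> b = b \<otimes>\<^bsub>G\<^esub> a}" using S com topspace_eq by auto
  then have "X closure_of S \<subseteq> {a \<in> topspace X. a \<otimes>\<^bsub>G\<^esub> b = b \<otimes>\<^bsub>G\<^esub> a}" using cl by (rule closure_of_minimal)
  then show ?thesis using a by blast
qed

text \<open>If w centralises x, its one-parameter subgroup commutes with T, so together they
  generate a connected abelian group. Its closure is a torus containing T and therefore equals
  T.\<close>

lemma maximal_torus_lie_algebra: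
  assumes T: "maximal_torus G X T" and x: "x \<in> subgroup_lie_algebra G X \<phi> T" "x \<in> reg"
  shows "subgroup_lie_algebra G X \<phi> T = cent x"
proof
  have tT: "torus_in G X T" and max: "\<And>T'. torus_in G X T' \<Longrightarrow> T \<subseteq> T' \<Longrightarrow> T' = T"
    using T by (auto simp: maximal_torus_def)
  have sT: "subgroup T G" and ab: "\<And>a b. a \<in> T \<Longrightarrow> b \<in> T \<Longrightarrow> a \<otimes>\<^bsub>G\<^esub> b = b \<otimes>\<^bsub>G\<^esub> a" and cT: "connectedin X T"
    using tT by (auto simp: torus_in_def)
  note Tc = subgroup.mem_carrier[OF sT]
  show "subgroup_lie_algebra G X \<phi> T \<subseteq> cent x" by (rule abelian_lie_algebra(2)[OF x(1) sT ab])
  show "cent x \<subseteq> subgroup_lie_algebra G X \<phi> T"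
  proof
    fix w assume w: "w \<in> cent x"
    obtain \<gamma> where \<gamma>: "one_param \<gamma> w" by (rule one_param_exists)
    note c = one_param_carrier[OF \<gamma>]
    have com: "a \<otimes>\<^bsub>G\<^esub> \<gamma> t = \<gamma> t \<otimes>\<^bsub>G\<^esub> a" if "a \<in> T" for a t
      using one_param_commute_iff[OF \<gamma> Tc[OF that]] torus_acts_trivially[OF tT x w that] by blast
    have add: "\<gamma> (s + t) = \<gamma> s \<otimes>\<^bsub>G\<^esub> \<gamma> t" for s t using \<gamma> by (simp add: one_param_def)
    define S where "S = (\<lambda>(a, t). a \<otimes>\<^bsub>G\<^esub> \<gamma> t) ` (T \<times> UNIV)"
    have mult: "(a \<otimes>\<^bsub>G\<^esub> \<gamma> s) \<otimes>\<^bsub>G\<^esub> (b \<otimes>\<^bsub>G\<^esub> \<gamma> t) = (a \<otimes>\<^bsub>G\<^esub> b) \<otimes>\<^bsub>G\<^esub> \<gamma> (s + t)" if "a \<in> T" "b \<in> T" for a b s t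
    proof -
      have "(a \<otimes>\<^bsub>G\<^esub> \<gamma> s) \<otimes>\<^bsub>G\<^esub> (b \<otimes>\<^bsub>G\<^esub> \<gamma> t) = a \<otimes>\<^bsub>G\<^esub> (\<gamma> s \<otimes>\<^bsub>G\<^esub> b) \<otimes>\<^bsub>G\<^esub> \<gamma> t"
        using Tc[OF that(1)] Tc[OF that(2)] c by (simp add: m_assoc)
      also have "\<gamma> s \<otimes>\<^bsub>G\<^esub> b = b \<otimes>\<^bsub>G\<^esub> \<gamma> s" using com[OF that(2)] by simp
      finally show ?thesis using Tc[OF that(1)] Tc[OF that(2)] c by (simp add: m_assoc add)
    qed
    have SI: "a \<otimes>\<^bsub>G\<^esub> \<gamma> t \<in> S" if "a \<in> T" for a t using that by (auto simp: S_def)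
    have SE: "\<exists>a t. a \<in> T \<and> g = a \<otimes>\<^bsub>G\<^esub> \<gamma> t" if "g \<in> S" for g using that by (auto simp: S_def)
    have SC: "S \<subseteq> carrier G" using SE Tc c by (metis m_closed subsetI)
    have sS: "subgroup S G"
    proof (rule subgroupI[OF SC])
      show "S \<noteq> {}" using SI subgroup.one_closed[OF sT] by blast
      show "inv\<^bsub>G\<^esub> g \<in> S" if g: "g \<in> S" for g
      proof -
        obtain a t where at: "a \<in> T" "g = a \<otimes>\<^bsub>G\<^esub> \<gamma> t" using SE[OF g] by blast
        have "inv\<^bsub>G\<^esub> g = \<gamma> (- t) \<otimes>\<^bsub>G\<^esub> inv\<^bsub>G\<^esub> a"
          using at Tc c by (simp add: inv_mult_group one_param_minus[OF \<gamma>])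
        also have "\<dots> = inv\<^bsub>G\<^esub> a \<otimes>\<^bsub>G\<^esub> \<gamma> (- t)" using com[OF subgroup.m_inv_closed[OF sT at(1)]] by simp
        finally show ?thesis using SI[OF subgroup.m_inv_closed[OF sT at(1)]] by simp
      qed
      show "g \<otimes>\<^bsub>G\<^esub> h \<in> S" if g: "g \<in> S" and h: "h \<in> S" for g h
      proof -
        obtain a s where as: "a \<in> T" "g = a \<otimes>\<^bsub>G\<^esub> \<gamma> s" using SE[OF g] by blast
        obtain b t where bt: "b \<in> T" "h = b \<otimes>\<^bsub>G\<^esub> \<gamma> t" using SE[OF h] by blast
        show ?thesis using SI[OF subgroup.m_closed[OF sT as(1) bt(1)]] mult[OF as(1) bt(1)] as bt by simp
      qed
    qed
    have abS: "g \<otimes>\<^bsub>G\<^esub> h = h \<otimes>\<^bsub>G\<^esub> g" if g: "g \<in> S" and h: "h \<in> S" for g h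
    proof -
      obtain a s where as: "a \<in> T" "g = a \<otimes>\<^bsub>G\<^esub> \<gamma> s" using SE[OF g] by blast
      obtain b t where bt: "b \<in> T" "h = b \<otimes>\<^bsub>G\<^esub> \<gamma> t" using SE[OF h] by blast
      show ?thesis unfolding as(2) bt(2) mult[OF as(1) bt(1)] mult[OF bt(1) as(1)] ab[OF as(1) bt(1)] by (simp add: add.commute)
    qed
    have "connectedin (prod_topology X euclideanreal) (T \<times> UNIV)"
      using cT by (simp add: connectedin_Times)
    moreover have "continuous_map (prod_topology X euclideanreal) X (\<lambda>z. fst z \<otimes>\<^bsub>G\<^esub> \<gamma> (snd z))"
      using continuous_map_compose[OF continuous_map_snd, of euclideanreal X \<gamma> X] \<gamma>
      by (intro mult_cont' continuous_map_fst) (simp_all add: one_param_def o_def)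
    ultimately have "connectedin X ((\<lambda>z. fst z \<otimes>\<^bsub>G\<^esub> \<gamma> (snd z)) ` (T \<times> UNIV))"
      using connectedin_continuous_map_image by blast
    then have cS: "connectedin X S" by (simp add: S_def case_prod_beta')
    \<comment> \<open>The curve may wind densely, so S need not be closed; passing to the closure
      makes it compact and preserves connectedness and commutativity.\<close>
    let ?T' = "X closure_of S"
    have TS: "T \<subseteq> S"
    proof
      fix a assume a: "a \<in> T"
      show "a \<in> S" using SI[OF a, of 0] Tc[OF a] by (simp add: one_param_0[OF \<gamma>])
    qed
    have ST: "S \<subseteq> ?T'" using SC topspace_eq by (simp add: closure_of_subset)
    have "torus_in G X ?T'"
      unfolding torus_in_def
    proof (intro conjI ballI)
      show "subgroup ?T' G" by (rule closure_subgroup[OF sS])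
      show "compactin X ?T'" using closedin_compact_space[OF compact closedin_closure_of] .
      show "connectedin X ?T'" by (rule connectedin_closure_of[OF cS])
      fix a b assume ab': "a \<in> ?T'" "b \<in> ?T'"
      have T'c: "?T' \<subseteq> carrier G" using closure_of_subset_topspace[of X S] by (simp add: topspace_eq)
      have 1: "g \<otimes>\<^bsub>G\<^esub> b = b \<otimes>\<^bsub>G\<^esub> g" if "g \<in> S" for g
        using closure_commutes[OF SC _ _ ab'(2), of g] abS that SC by (metis subsetD)
      show "a \<otimes>\<^bsub>G\<^esub> b = b \<otimes>\<^bsub>G\<^esub> a"
        by (rule closure_commutes[OF SC _ 1 ab'(1)]) (use T'c ab' in auto)
    qed
    then have "?T' = T" using max TS ST by blast
    then have "S \<subseteq> T" using ST by simp
    moreover have "\<gamma> t \<in> S" for t using SI[OF subgroup.one_closed[OF sT], of t] c by simp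
    ultimately show "w \<in> subgroup_lie_algebra G X \<phi> T" using \<gamma> by (auto simp: subgroup_lie_algebra_eq)
  qed
qed

end

section \<open>The normal distribution\<close>

lemma Ck_on_bounded_linear:
  assumes L: "bounded_linear L" shows "Ck_on k S f \<Longrightarrow> Ck_on k S (\<lambda>x. L (f x))"
proof (induction k arbitrary: f)
  case 0
  then show ?case using bounded_linear.continuous_on[OF L] by simp
next
  case (Suc k)
  then obtain f' where f': "\<And>x. x \<in> S \<Longrightarrow> (f has_derivative f' x) (at x)" "\<And>v. Ck_on k S (\<lambda>x. f' x v)" by auto
  have "((\<lambda>x. L (f x)) has_derivative (\<lambda>v. L (f' x v))) (at x)" if "x \<in> S" for x
    by (rule bounded_linear.has_derivative[OF L f'(1)[OF that]])
  moreover have "Ck_on k S (\<lambda>x. L (f' x v))" for v by (rule Suc.IH[OF f'(2)])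
  ultimately show ?case unfolding Ck_on.simps by (intro exI[of _ "\<lambda>x v. L (f' x v)"]) blast
qed

lemma Ck_on_diff: "Ck_on k S f \<Longrightarrow> Ck_on k S g \<Longrightarrow> Ck_on k S (\<lambda>x. f x - g x)"
proof (induction k arbitrary: f g)
  case 0
  then show ?case by (simp add: continuous_on_diff)
next
  case (Suc k)
  obtain f' where f': "\<And>x. x \<in> S \<Longrightarrow> (f has_derivative f' x) (at x)" "\<And>v. Ck_on k S (\<lambda>x. f' x v)" using Suc.prems(1) by auto
  obtain g' where g': "\<And>x. x \<in> S \<Longrightarrow> (g has_derivative g' x) (at x)" "\<And>v. Ck_on k S (\<lambda>x. g' x v)" using Suc.prems(2) by auto
  have "((\<lambda>x. f x - g x) has_derivative (\<lambda>v. f' x v - g' x v)) (at x)" if "x \<in> S" for x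
    by (rule has_derivative_diff[OF f'(1)[OF that] g'(1)[OF that]])
  moreover have "Ck_on k S (\<lambda>x. f' x v - g' x v)" for v by (rule Suc.IH[OF f'(2) g'(2)])
  ultimately show ?case unfolding Ck_on.simps by (intro exI[of _ "\<lambda>x v. f' x v - g' x v"]) blast
qed

lemma Ck_on_const: "Ck_on k S (\<lambda>x. c)"
proof (induction k arbitrary: c)
  case (Suc k)
  show ?case unfolding Ck_on.simps by (intro exI[of _ "\<lambda>x v. 0"]) (auto intro: Suc.IH)
qed simp

lemma Ck_on_SucD: "Ck_on (Suc k) S f \<Longrightarrow> Ck_on k S f"
proof (induction k arbitrary: f)
  case 0
  then show ?case using has_derivative_continuous by (fastforce intro: continuous_at_imp_continuous_on)
next
  case (Suc k)
  then obtain f' where f': "\<And>x. x \<in> S \<Longrightarrow> (f has_derivative f' x) (at x)" "\<And>v. Ck_on (Suc k) S (\<lambda>x. f' x v)"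
    using Ck_on.simps(2)[of "Suc k" S f] by blast
  then have "Ck_on k S (\<lambda>x. f' x v)" for v using Suc.IH by blast
  then show ?case unfolding Ck_on.simps(2) using f'(1) by blast
qed

lemma smooth_on_id: "smooth_on S (\<lambda>x. x)"
  unfolding smooth_on_def
proof
  fix k show "Ck_on k S (\<lambda>x. x)"
  proof (cases k)
    case (Suc j)
    then show ?thesis by (auto intro!: exI[of _ "\<lambda>x v. v"] Ck_on_const)
  qed simp
qed

text \<open>Operators \<open>J y\<close> that depend affinely on the parameter, with a common lower
  bound \<delta> and with \<open>b\<close> as the derivative in the parameter. The aim is that
  \<open>R y\<close>, the inverse of \<open>J y\<close>, depends smoothly on y.\<close>

locale affine_operator_family =
  fixes D :: "'a::real_normed_vector set" and J :: "'a \<Rightarrow> 'm::euclidean_space \<Rightarrow> 'm"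
    and b :: "'a \<Rightarrow> 'm \<Rightarrow> 'm" and \<delta> :: real
  assumes open_D: "open D" and J_linear: "y \<in> D \<Longrightarrow> linear (J y)" and \<delta>: "\<delta> > 0"
    and J_lower: "y \<in> D \<Longrightarrow> \<delta> * norm v \<le> norm (J y v)"
    and b: "bounded_bilinear b" and J_affine: "y \<in> D \<Longrightarrow> z \<in> D \<Longrightarrow> J z v = J y v + b (z - y) v"
begin

definition R :: "'a \<Rightarrow> 'm \<Rightarrow> 'm" where "R y = inv_into UNIV (J y)"

lemma J_inj: assumes "y \<in> D" shows "inj (J y)"
proof (subst linear_injective_0[OF J_linear[OF assms]], intro allI impI)
  fix v assume "J y v = 0"
  then have "\<delta> * norm v \<le> 0" using J_lower[OF assms, of v] by simp
  then show "v = 0" using \<delta> by (simp add: mult_le_0_iff)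
qed

lemma J_surj: "y \<in> D \<Longrightarrow> surj (J y)"
  using linear_injective_imp_surjective[OF J_linear J_inj] by blast

lemma J_R: "y \<in> D \<Longrightarrow> J y (R y w) = w" by (simp add: R_def surj_f_inv_f[OF J_surj])

lemma R_J: "y \<in> D \<Longrightarrow> R y (J y v) = v" by (simp add: R_def inv_f_f[OF J_inj])

lemma R_linear: assumes "y \<in> D" shows "linear (R y)"
proof (rule linearI)
  show "R y (v + w) = R y v + R y w" for v w
    by (metis J_R R_J assms linear_add[OF J_linear[OF assms]])
  show "R y (c *\<^sub>R v) = c *\<^sub>R R y v" for c v
    by (metis J_R R_J assms linear_scale[OF J_linear[OF assms]])
qed

lemma R_bound: assumes "y \<in> D" shows "norm (R y w) \<le> norm w / \<delta>"
  using J_lower[OF assms, of "R y w"] \<delta> by (simp add: J_R[OF assms] field_simps)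

text \<open>The resolvent identity, with the two inverses applied to different vectors v and w so
  that it also covers arguments varying with the parameter.\<close>

lemma R_diff:
  assumes "y \<in> D" "z \<in> D"
  shows "R z v - R y w = R y (v - w - b (z - y) (R z v))"
proof -
  have "J y (R z v - R y w) = J y (R z v) - w" by (simp add: linear_diff[OF J_linear[OF assms(1)]] J_R[OF assms(1)])
  also have "J y (R z v) = v - b (z - y) (R z v)"
    unfolding eq_diff_eq using J_affine[OF assms, of "R z v", symmetric] J_R[OF assms(2), of v] by (rule trans)
  finally have "J y (R z v - R y w) = v - w - b (z - y) (R z v)" by simp
  then show ?thesis using R_J[OF assms(1)] by metis
qed

lemma R_tendsto:
  assumes y: "y \<in> D" and f: "isCont f y"
  shows "isCont (\<lambda>y. R y (f y)) y"
proof -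
  obtain K where K: "K > 0" "\<And>h v. norm (b h v) \<le> norm h * norm v * K"
    using bounded_bilinear.pos_bounded[OF b] by blast
  have ev: "\<forall>\<^sub>F z in at y. z \<in> D" using open_D y by (auto simp: eventually_at_topological)
  have "((\<lambda>z. R z (f z) - R y (f y)) \<longlongrightarrow> 0) (at y)"
  proof (rule Lim_null_comparison)
    show "\<forall>\<^sub>F z in at y. norm (R z (f z) - R y (f y)) \<le> (norm (f z - f y) + norm (z - y) * (norm (f z) / \<delta>) * K) / \<delta>"
      using ev
    proof eventually_elim
      case (elim z)
      have "norm (R z (f z) - R y (f y)) \<le> norm (f z - f y - b (z - y) (R z (f z))) / \<delta>"
        unfolding R_diff[OF y elim] by (rule R_bound[OF y])
      also have "norm (f z - f y - b (z - y) (R z (f z))) \<le> norm (f z - f y) + norm (b (z - y) (R z (f z)))"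
        by (rule norm_triangle_ineq4)
      also have "norm (b (z - y) (R z (f z))) \<le> norm (z - y) * norm (R z (f z)) * K" by (rule K)
      also have "\<dots> \<le> norm (z - y) * (norm (f z) / \<delta>) * K"
        using K(1) R_bound[OF elim] by (intro mult_right_mono mult_left_mono) auto
      finally show ?case using \<delta> by (simp add: divide_right_mono)
    qed
    have "((\<lambda>z. (norm (f z - f y) + norm (z - y) * (norm (f z) / \<delta>) * K) / \<delta>) \<longlongrightarrow>
      (norm (f y - f y) + norm (y - y) * (norm (f y) / \<delta>) * K) / \<delta>) (at y)"
      using f \<delta> by (intro tendsto_intros) (auto simp: isCont_def)
    then show "((\<lambda>z. (norm (f z - f y) + norm (z - y) * (norm (f z) / \<delta>) * K) / \<delta>) \<longlongrightarrow> 0) (at y)" by simp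
  qed
  then show ?thesis unfolding isCont_def by (simp only: LIM_zero_iff)
qed

text \<open>In the resolvent identity, \<open>R z\<close> in the last term may be replaced by
  \<open>R y\<close> up to higher order, since y \<mapsto> R y (f y) is continuous.\<close>

lemma R_has_derivative:
  assumes y: "y \<in> D" and f: "(f has_derivative f') (at y)"
  shows "((\<lambda>y. R y (f y)) has_derivative (\<lambda>h. R y (f' h - b h (R y (f y))))) (at y)"
proof -
  let ?g = "\<lambda>y. R y (f y)"
  obtain K where K: "K > 0" "\<And>h v. norm (b h v) \<le> norm h * norm v * K"
    using bounded_bilinear.pos_bounded[OF b] by blast
  have Rb: "bounded_linear (R y)" using R_linear[OF y] by (simp add: linear_conv_bounded_linear)
  have "isCont ?g y" by (rule R_tendsto[OF y has_derivative_continuous[OF f]])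
  then have gt: "(?g \<longlongrightarrow> ?g y) (nhds y)" by (rule isCont_tendsto_nhds)
  show ?thesis unfolding has_derivative_at_alt
  proof (intro conjI allI impI)
    show "bounded_linear (\<lambda>h. R y (f' h - b h (R y (f y))))"
      by (intro bounded_linear_compose[OF Rb] bounded_linear_sub has_derivative_bounded_linear[OF f]
          bounded_bilinear.bounded_linear_left[OF b])
    fix e :: real assume e: "e > 0"
    \<comment> \<open>The remainder has two terms; each is granted e / 2 once \<open>R y\<close> has
      contributed the factor 1 / \<delta>.\<close>
    obtain d1 where d1: "d1 > 0" "\<And>z. norm (z - y) < d1 \<Longrightarrow> norm (f z - f y - f' (z - y)) \<le> (e * \<delta> / 2) * norm (z - y)"
    proof -
      have "e * \<delta> / 2 > 0" using e \<delta> by simp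
      from f[unfolded has_derivative_at_alt, THEN conjunct2, rule_format, OF this] show ?thesis using that by blast
    qed
    have "\<forall>\<^sub>F z in nhds y. dist (?g z) (?g y) < e * \<delta> / (2 * K)" using gt e \<delta> K(1) by (intro tendstoD) auto
    then obtain d2 where d2: "d2 > 0" "\<And>z. dist z y < d2 \<Longrightarrow> dist (?g z) (?g y) < e * \<delta> / (2 * K)"
      unfolding eventually_nhds_metric by blast
    obtain d3 where d3: "d3 > 0" "ball y d3 \<subseteq> D" using open_D y openE by blast
    have "norm (?g z - ?g y - R y (f' (z - y) - b (z - y) (?g y))) \<le> e * norm (z - y)"
      if z: "norm (z - y) < min d1 (min d2 d3)" for z
    proof -
      have zD: "z \<in> D" using d3(2) z by (auto simp: dist_norm norm_minus_commute)
      have "?g z - ?g y - R y (f' (z - y) - b (z - y) (?g y))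
          = R y (f z - f y - b (z - y) (?g z) - (f' (z - y) - b (z - y) (?g y)))"
        by (simp only: R_diff[OF y zD] linear_diff[OF R_linear[OF y]])
      also have "f z - f y - b (z - y) (?g z) - (f' (z - y) - b (z - y) (?g y))
          = (f z - f y - f' (z - y)) - b (z - y) (?g z - ?g y)"
        by (simp add: bounded_bilinear.diff_right[OF b])
      finally have "norm (?g z - ?g y - R y (f' (z - y) - b (z - y) (?g y)))
          \<le> norm ((f z - f y - f' (z - y)) - b (z - y) (?g z - ?g y)) / \<delta>" using R_bound[OF y] by metis
      also have "norm ((f z - f y - f' (z - y)) - b (z - y) (?g z - ?g y))
          \<le> norm (f z - f y - f' (z - y)) + norm (b (z - y) (?g z - ?g y))" by (rule norm_triangle_ineq4)
      also have "norm (b (z - y) (?g z - ?g y)) \<le> norm (z - y) * norm (?g z - ?g y) * K" by (rule K)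
      also have "\<dots> \<le> norm (z - y) * (e * \<delta> / (2 * K)) * K"
        using d2(2)[of z] z K(1) by (intro mult_right_mono mult_left_mono) (auto simp: dist_norm)
      also have "norm (f z - f y - f' (z - y)) \<le> (e * \<delta> / 2) * norm (z - y)" using d1(2) z by simp
      finally have "norm (?g z - ?g y - R y (f' (z - y) - b (z - y) (?g y)))
          \<le> ((e * \<delta> / 2) * norm (z - y) + norm (z - y) * (e * \<delta> / (2 * K)) * K) / \<delta>" using \<delta> by (simp add: divide_right_mono)
      also have "\<dots> = e * norm (z - y)" using \<delta> K(1) by (simp add: field_simps)
      finally show ?thesis .
    qed
    then show "\<exists>d>0. \<forall>z. norm (z - y) < d \<longrightarrow> norm (?g z - ?g y - R y (f' (z - y) - b (z - y) (?g y))) \<le> e * norm (z - y)"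
      using d1(1) d2(1) d3(1) by (intro exI[of _ "min d1 (min d2 d3)"]) auto
  qed
qed

text \<open>The derivative in direction v is again R applied to a map built from f', b and R applied
  to f. The induction hypothesis is therefore used twice, the inner time for f itself after lowering
  its order by \<open>Ck_on_SucD\<close>.\<close>

lemma Ck_on_R: "Ck_on k D f \<Longrightarrow> Ck_on k D (\<lambda>y. R y (f y))"
proof (induction k arbitrary: f)
  case 0
  then have "\<And>y. y \<in> D \<Longrightarrow> isCont f y" using open_D by (simp add: continuous_on_eq_continuous_at)
  then show ?case using R_tendsto by (simp add: continuous_at_imp_continuous_on)
next
  case (Suc k)
  obtain f' where f': "\<And>x. x \<in> D \<Longrightarrow> (f has_derivative f' x) (at x)" "\<And>v. Ck_on k D (\<lambda>x. f' x v)" using Suc.prems by auto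
  have "Ck_on k D (\<lambda>y. R y (f' y v - b v (R y (f y))))" for v
    by (intro Suc.IH Ck_on_diff f'(2) Ck_on_bounded_linear[OF bounded_bilinear.bounded_linear_right[OF b]] Ck_on_SucD[OF Suc.prems])
  then show ?case unfolding Ck_on.simps
    using R_has_derivative[OF _ f'(1)] by (intro exI[of _ "\<lambda>y v. R y (f' y v - b v (R y (f y)))"]) blast
qed

end

section \<open>Transport to the dual by the Killing form\<close>

lemma tangent_space_image:
  assumes f: "bounded_linear f" and g: "bounded_linear g" and gf: "\<And>x. g (f x) = x"
    and fg: "\<And>y. f (g y) = y"
  shows "tangent_space (f ` S) (f p) = f ` tangent_space S p"
proof (intro equalityI subsetI)
  fix v assume "v \<in> tangent_space (f ` S) (f p)"
  then obtain \<gamma> where \<gamma>: "\<gamma> 0 = f p" "\<And>t. \<gamma> t \<in> f ` S" "(\<gamma> has_vector_derivative v) (at (0::real))"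
    by (auto simp: tangent_space_def)
  have "((\<lambda>t. g (\<gamma> t)) has_vector_derivative g v) (at 0)" by (rule bounded_linear.has_vector_derivative[OF g \<gamma>(3)])
  moreover have "g (\<gamma> t) \<in> S" for t using \<gamma>(2)[of t] gf by auto
  ultimately have "g v \<in> tangent_space S p"
    unfolding tangent_space_def using \<gamma>(1) gf by (auto intro!: exI[of _ "\<lambda>t. g (\<gamma> t)"])
  then show "v \<in> f ` tangent_space S p" using fg by (metis imageI)
next
  fix v assume "v \<in> f ` tangent_space S p"
  then obtain w \<gamma> where \<gamma>: "v = f w" "\<gamma> 0 = p" "\<And>t. \<gamma> t \<in> S" "(\<gamma> has_vector_derivative w) (at (0::real))"
    by (auto simp: tangent_space_def)
  have "((\<lambda>t. f (\<gamma> t)) has_vector_derivative f w) (at 0)" by (rule bounded_linear.has_vector_derivative[OF f \<gamma>(4)])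
  then show "v \<in> tangent_space (f ` S) (f p)"
    unfolding tangent_space_def using \<gamma> by (auto intro!: exI[of _ "\<lambda>t. f (\<gamma> t)"])
qed

lemma dim_injective_image:
  fixes f :: "'a::euclidean_space \<Rightarrow> 'b::real_vector"
  assumes "linear f" "inj f" shows "dim (f ` S) = dim S"
proof -
  obtain C where C: "C \<subseteq> S" "independent C" "S \<subseteq> span C" "card C = dim S" by (rule basis_exists)
  have i: "inj_on f (span C)" using assms(2) by (rule inj_on_subset) simp
  have "independent (f ` C)" by (rule linear_independent_injective_image[OF assms(1) C(2) i])
  moreover have "f ` S \<subseteq> span (f ` C)" using C(3) by (simp add: linear_span_image[OF assms(1)] image_mono)
  ultimately have "dim (f ` S) = card (f ` C)" using C(1) by (intro dim_unique[of "f ` C"]) auto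
  also have "\<dots> = card C" using assms(2) by (simp add: card_image inj_on_subset)
  finally show ?thesis using C(4) by simp
qed

context compact_lie_chart
begin

abbreviation \<kappa> where "\<kappa> \<equiv> killing_dual G U \<phi>"

lemma killing_form_eq: "killing_form G U \<phi> x y = - B x y"
  by (simp add: killing_form_def B_def)

lemma \<kappa>_apply: "blinfun_apply (\<kappa> x) y = - B x y"
proof -
  have "linear (killing_form G U \<phi> x)"
    using linear_compose_neg[OF B_linear] by (simp add: killing_form_eq[abs_def])
  then show ?thesis
    by (simp add: killing_dual_def linear_conv_bounded_linear bounded_linear_Blinfun_apply killing_form_eq)
qed

lemma \<kappa>_linear: "linear \<kappa>"
  by (rule linearI; rule blinfun_eqI)
    (simp_all add: \<kappa>_apply blinfun.bilinear_simps bilinear_ladd[OF B_bilinear] bilinear_lmul[OF B_bilinear])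

lemma \<kappa>_bounded: "bounded_linear \<kappa>" using \<kappa>_linear by (simp add: linear_conv_bounded_linear)

definition \<kappa>i :: "('m \<Rightarrow>\<^sub>L real) \<Rightarrow> 'm" where "\<kappa>i = inv_into UNIV \<kappa>"

lemma \<kappa>_inj: "inj \<kappa>"
proof (subst linear_injective_0[OF \<kappa>_linear], intro allI impI)
  fix x assume "\<kappa> x = 0"
  then have "B x x = 0" using \<kappa>_apply[of x x] by simp
  then show "x = 0" using B_pos[of x] by auto
qed

text \<open>The dimension count is made on \<open>'m\<close>: L represents the functional
  \<open>B x\<close> by a Euclidean vector, and an injective endomorphism is surjective. The minus
  sign in \<open>h\<close> reflects that \<kappa> is given by K = - B.\<close>

lemma \<kappa>_inverse_exists:
  obtains g where "bounded_linear g" "\<And>\<xi>. \<kappa> (g \<xi>) = \<xi>"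
proof -
  define L where "L x = (\<Sum>b\<in>Basis. B x b *\<^sub>R b)" for x
  have Lb: "L x \<bullet> b = B x b" if "b \<in> Basis" for x b using that by (simp add: L_def)
  have lL: "linear L"
    by (rule linearI) (simp_all add: L_def bilinear_ladd[OF B_bilinear] bilinear_lmul[OF B_bilinear]
        scaleR_add_left sum.distrib scaleR_sum_right)
  have "inj L"
  proof (subst linear_injective_0[OF lL], intro allI impI)
    fix x assume x: "L x = 0"
    have "B x x = 0" by (rule linear_eq_0_on_span[OF B_linear, of Basis]) (use Lb[of _ x] x in auto)
    then show "x = 0" using B_pos[of x] by auto
  qed
  then have "surj L" using linear_injective_imp_surjective[OF lL] by blast
  then obtain g where g: "linear g" "L \<circ> g = id" using linear_surjective_right_inverse[OF lL] by blast
  define h where "h \<xi> = g (- (\<Sum>b\<in>Basis. blinfun_apply \<xi> b *\<^sub>R b))" for \<xi> :: "'m \<Rightarrow>\<^sub>L real"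
  have "bounded_linear h" unfolding h_def
    by (rule bounded_linear_compose[OF linear_conv_bounded_linear[THEN iffD1, OF g(1)]])
      (intro bounded_linear_minus bounded_linear_sum
        bounded_linear_compose[OF bounded_linear_scaleR_left] blinfun.bounded_linear_left)
  moreover have "\<kappa> (h \<xi>) = \<xi>" for \<xi>
  proof (rule blinfun_euclidean_eqI)
    fix b :: 'm assume b: "b \<in> Basis"
    have "L (h \<xi>) = - (\<Sum>b\<in>Basis. blinfun_apply \<xi> b *\<^sub>R b)" using g(2) by (metis comp_apply h_def id_apply)
    then have "L (h \<xi>) \<bullet> b = - blinfun_apply \<xi> b" using b by simp
    then show "blinfun_apply (\<kappa> (h \<xi>)) b = blinfun_apply \<xi> b" using Lb[OF b] by (simp add: \<kappa>_apply)
  qed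
  ultimately show thesis by (rule that)
qed

lemma \<kappa>i_\<kappa> [simp]: "\<kappa>i (\<kappa> x) = x" by (simp add: \<kappa>i_def \<kappa>_inj)

lemma \<kappa>_\<kappa>i [simp]: "\<kappa> (\<kappa>i \<xi>) = \<xi>"
proof -
  obtain g where "\<And>\<xi>. \<kappa> (g \<xi>) = \<xi>" using \<kappa>_inverse_exists by metis
  then show ?thesis unfolding \<kappa>i_def by (metis \<kappa>_inj inv_f_f)
qed

lemma \<kappa>i_bounded: "bounded_linear \<kappa>i"
proof -
  obtain g where g: "bounded_linear g" "\<And>\<xi>. \<kappa> (g \<xi>) = \<xi>" using \<kappa>_inverse_exists by metis
  have "\<kappa>i = g" using g(2) \<kappa>i_\<kappa> by (metis ext)
  then show ?thesis using g(1) by simp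
qed

text \<open>By \<open>Ad_bra\<close>, ad (Ad a x) is conjugate to ad x under \<open>Ad a\<close>,
  and the trace does not see a conjugation.\<close>

lemma B_Ad_invariant:
  assumes a: "a \<in> carrier G" shows "B (Adj a x) (Adj a y) = B x y"
proof -
  have ic: "inv\<^bsub>G\<^esub> a \<in> carrier G" using a by simp
  have l: "linear (\<lambda>v. Adj a (bra x (bra y v)))"
    using linear_compose[OF linear_compose[OF lin lin] Ad_linear[OF a]] by (simp add: o_def)
  have e: "bra (Adj a x) v = Adj a (bra x (Adj (inv\<^bsub>G\<^esub> a) v))" for x v
    using Ad_bra[OF a, of x "Adj (inv\<^bsub>G\<^esub> a) v"] a by (simp add: Ad_inv)
  have "bra (Adj a x) \<circ> bra (Adj a y) = (\<lambda>v. Adj a (bra x (bra y v))) \<circ> Adj (inv\<^bsub>G\<^esub> a)"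
    using a by (auto simp: e Ad_inv)
  moreover have "Adj (inv\<^bsub>G\<^esub> a) \<circ> (\<lambda>v. Adj a (bra x (bra y v))) = bra x \<circ> bra y"
    using a by (auto simp: Ad_inv)
  ultimately show ?thesis unfolding B_def using linear_trace_comm[OF l Ad_linear[OF ic]] by simp
qed

lemma coadjoint_orbit_\<kappa>: "coadjoint_orbit G U \<phi> (\<kappa> x) = \<kappa> ` ((\<lambda>a. Adj a x) ` carrier G)"
proof -
  have "\<kappa> x o\<^sub>L Blinfun (Adj (inv\<^bsub>G\<^esub> a)) = \<kappa> (Adj a x)" if a: "a \<in> carrier G" for a
  proof (rule blinfun_eqI)
    fix y
    have "bounded_linear (Adj (inv\<^bsub>G\<^esub> a))" using Ad_linear[of "inv\<^bsub>G\<^esub> a"] a by (simp add: linear_conv_bounded_linear)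
    then have "blinfun_apply (\<kappa> x o\<^sub>L Blinfun (Adj (inv\<^bsub>G\<^esub> a))) y = - B x (Adj (inv\<^bsub>G\<^esub> a) y)"
      by (simp add: \<kappa>_apply bounded_linear_Blinfun_apply)
    also have "\<dots> = - B (Adj a x) y" using B_Ad_invariant[OF a, of x "Adj (inv\<^bsub>G\<^esub> a) y"] a by (simp add: Ad_inv)
    finally show "blinfun_apply (\<kappa> x o\<^sub>L Blinfun (Adj (inv\<^bsub>G\<^esub> a))) y = blinfun_apply (\<kappa> (Adj a x)) y" by (simp add: \<kappa>_apply)
  qed
  then show ?thesis unfolding coadjoint_orbit_def image_image by (rule image_cong[OF refl])
qed

text \<open>One-parameter subgroups realise every vector of the image. Conversely, for z in
  \<open>cent x\<close> the function t \<mapsto> B (c t) z has derivative 0 by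
  \<open>orbit_normal\<close>, so the velocity is orthogonal to \<open>cent x\<close> and lies in
  the image.\<close>

lemma orbit_tangent: "tangent_space ((\<lambda>a. Adj a x) ` carrier G) x = range (bra x)"
proof (intro equalityI subsetI)
  fix v assume "v \<in> range (bra x)"
  then obtain u where "v = bra x u" by blast
  then have v: "v = bra (- u) x" using bra_anti[of x u] by (simp add: br_simps)
  obtain \<gamma> where \<gamma>: "one_param \<gamma> (- u)" by (rule one_param_exists)
  have "((\<lambda>t. Adj (\<gamma> t) x) has_vector_derivative v) (at 0)"
    using one_param_Ad(1)[OF \<gamma>, of x 0] by (simp add: one_param_0[OF \<gamma>] Ad_one v)
  then show "v \<in> tangent_space ((\<lambda>a. Adj a x) ` carrier G) x"
    unfolding tangent_space_def using one_param_carrier[OF \<gamma>]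
    by (auto intro!: exI[of _ "\<lambda>t. Adj (\<gamma> t) x"] simp: one_param_0[OF \<gamma>] Ad_one)
next
  fix v assume "v \<in> tangent_space ((\<lambda>a. Adj a x) ` carrier G) x"
  then obtain c where c: "c 0 = x" "\<And>t. c t \<in> (\<lambda>a. Adj a x) ` carrier G" "(c has_vector_derivative v) (at (0::real))"
    by (auto simp: tangent_space_def)
  have "B v z = 0" if z: "z \<in> cent x" for z
  proof -
    have "bounded_linear (\<lambda>v. B v z)" using B_linear_left[of z] by (simp add: linear_conv_bounded_linear)
    from bounded_linear.has_vector_derivative[OF this c(3)]
    have 1: "((\<lambda>t. B (c t) z) has_vector_derivative B v z) (at 0)" .
    have "((\<lambda>t. B (c t) z) has_derivative (\<lambda>t. 0)) (at 0)"
      unfolding has_derivative_at_alt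
    proof (intro conjI allI impI)
      fix e :: real assume e: "e > 0"
      \<comment> \<open>Near 0 the curve moves at most (norm v + 1) times \<bar>t\<bar> away from
        x.\<close>
      define \<epsilon> where "\<epsilon> = e / (norm v + 1)"
      have n1: "norm v + 1 > 0" by (simp add: add_nonneg_pos)
      have \<epsilon>: "\<epsilon> > 0" using e n1 by (simp add: \<epsilon>_def)
      obtain \<rho> where \<rho>: "\<rho> > 0" "\<And>a. a \<in> carrier G \<Longrightarrow> norm (Adj a x - x) < \<rho> \<Longrightarrow>
        \<bar>B (Adj a x - x) z\<bar> \<le> \<epsilon> * norm (Adj a x - x)" using orbit_normal[OF z \<epsilon>] by metis
      obtain d where d: "d > 0" "\<And>t. norm (t - 0) < d \<Longrightarrow> norm (c t - c 0 - (t - 0) *\<^sub>R v) \<le> 1 * norm (t - 0)"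
        using c(3)[unfolded has_vector_derivative_def has_derivative_at_alt, THEN conjunct2, rule_format, OF zero_less_one]
        by blast
      have "norm (B (c t) z - B (c 0) z - 0) \<le> e * norm (t - 0)" if t: "norm (t - 0) < min d (\<rho> / (norm v + 1))" for t
      proof -
        have "norm (c t - x) \<le> norm (c t - x - t *\<^sub>R v) + norm (t *\<^sub>R v)" using norm_triangle_ineq[of "c t - x - t *\<^sub>R v" "t *\<^sub>R v"] by simp
        also have "\<dots> \<le> (norm v + 1) * \<bar>t\<bar>" using d(2)[of t] t c(1) by (simp add: algebra_simps)
        finally have ct: "norm (c t - x) \<le> (norm v + 1) * \<bar>t\<bar>" .
        also have "\<dots> < \<rho>" using t n1 by (simp add: field_simps)
        finally have "norm (c t - x) < \<rho>" .
        then have "\<bar>B (c t - x) z\<bar> \<le> \<epsilon> * norm (c t - x)" using \<rho>(2) c(2)[of t] by fastforce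
        also have "\<dots> \<le> \<epsilon> * ((norm v + 1) * \<bar>t\<bar>)" using ct \<epsilon> by (intro mult_left_mono) auto
        also have "\<dots> = e * \<bar>t\<bar>" using n1 by (simp add: \<epsilon>_def)
        finally show ?thesis using c(1) linear_diff[OF B_linear_left] by simp
      qed
      then show "\<exists>d>0. \<forall>t. norm (t - 0) < d \<longrightarrow> norm (B (c t) z - B (c 0) z - 0) \<le> e * norm (t - 0)"
        using d(1) \<rho>(1) n1 by (intro exI[of _ "min d (\<rho> / (norm v + 1))"]) auto
    qed simp
    then have "((\<lambda>t. B (c t) z) has_vector_derivative 0) (at 0)" by (simp add: has_vector_derivative_def)
    then show ?thesis using 1 vector_derivative_unique_at by blast
  qed
  then show "v \<in> range (bra x)" using im_iff_orth by blast
qed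

lemma leaf_tangent_\<kappa>: "leaf_tangent G U \<phi> (\<kappa> x) = \<kappa> ` range (bra x)"
  unfolding leaf_tangent_def coadjoint_orbit_\<kappa>
  by (subst tangent_space_image[OF \<kappa>_bounded \<kappa>i_bounded]) (simp_all add: orbit_tangent)

lemma surj_\<kappa>: "\<exists>x. \<xi> = \<kappa> x" by (metis \<kappa>_\<kappa>i)

lemma coadjoint_regular_eq: "coadjoint_regular G U \<phi> = \<kappa> ` reg"
proof -
  have "\<kappa> x \<in> coadjoint_regular G U \<phi> \<longleftrightarrow> x \<in> reg" for x
  proof -
    have "(\<forall>\<eta>. dim (leaf_tangent G U \<phi> \<eta>) \<le> dim (leaf_tangent G U \<phi> (\<kappa> x))) \<longleftrightarrow>
        (\<forall>y. dim (leaf_tangent G U \<phi> (\<kappa> y)) \<le> dim (leaf_tangent G U \<phi> (\<kappa> x)))" by (metis surj_\<kappa>)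
    then show ?thesis
      by (simp add: coadjoint_regular_def reg_def leaf_tangent_\<kappa> dim_injective_image[OF \<kappa>_linear \<kappa>_inj])
  qed
  then show ?thesis by (metis (no_types, lifting) equalityI image_iff subsetI surj_\<kappa>)
qed

lemma \<kappa>_regular: "\<kappa> x \<in> coadjoint_regular G U \<phi> \<longleftrightarrow> x \<in> reg"
  unfolding coadjoint_regular_eq using \<kappa>_inj by (simp add: inj_image_mem_iff)

lemma regular_vimage: "coadjoint_regular G U \<phi> = \<kappa>i -` reg"
  using \<kappa>_regular surj_\<kappa> by (metis (no_types, lifting) \<kappa>_\<kappa>i equalityI subsetI vimage_eq)

text \<open>The sign arises because \<kappa> uses K while the metric uses - K.\<close>

lemma raise_index_\<kappa>: "raise_index G U \<phi> (\<kappa> x) = - x"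
  unfolding raise_index_def
proof (rule the_equality)
  show "\<forall>y. - killing_form G U \<phi> (- x) y = blinfun_apply (\<kappa> x) y"
    by (simp add: killing_form_eq \<kappa>_apply bilinear_lneg[OF B_bilinear])
  fix x' assume *: "\<forall>y. - killing_form G U \<phi> x' y = blinfun_apply (\<kappa> x) y"
  have "B (x' + x) (x' + x) = B x' (x' + x) + B x (x' + x)" by (rule bilinear_ladd[OF B_bilinear])
  also have "\<dots> = 0" using * by (simp add: killing_form_eq \<kappa>_apply)
  finally have "x' + x = 0" using B_pos[of "x' + x"] by auto
  then show "x' = - x" by (simp add: eq_neg_iff_add_eq_0)
qed

text \<open>The signs from raising both indices cancel, so \<kappa> carries \<open>B\<close> to the
  dual metric and orthogonality to the leaf becomes \<open>cent_iff_orth\<close>.\<close>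

lemma normal_distribution_\<kappa>: "normal_distribution G U \<phi> (\<kappa> x) = \<kappa> ` cent x"
proof -
  have "\<kappa> v \<in> normal_distribution G U \<phi> (\<kappa> x) \<longleftrightarrow> v \<in> cent x" for v
  proof -
    have "\<kappa> v \<in> normal_distribution G U \<phi> (\<kappa> x) \<longleftrightarrow> (\<forall>w\<in>range (bra x). B v w = 0)"
      by (simp add: normal_distribution_def leaf_tangent_\<kappa> dual_metric_def raise_index_\<kappa> killing_form_eq
          bilinear_lneg[OF B_bilinear] bilinear_rneg[OF B_bilinear])
    also have "\<dots> \<longleftrightarrow> v \<in> cent x" unfolding cent_iff_orth using B_sym by metis
    finally show ?thesis .
  qed
  then show ?thesis by (metis (no_types, lifting) equalityI image_iff subsetI surj_\<kappa>)
qed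

lemma normal_distribution_eq: "normal_distribution G U \<phi> \<xi> = \<kappa> ` cent (\<kappa>i \<xi>)"
  using normal_distribution_\<kappa>[of "\<kappa>i \<xi>"] by simp

end

section \<open>Smoothness and integrability of the normal distribution\<close>

lemma submanifold_subspace_Int:
  fixes D V S :: "'v::real_normed_vector set"
  assumes D: "open D" and V: "subspace V" and S: "S = D \<inter> V"
  shows "submanifold S"
  unfolding submanifold_def
proof
  fix p assume p: "p \<in> S"
  let ?P = "\<lambda>D E \<psi> \<psi>' V. open D \<and> p \<in> D \<and> open E \<and> homeomorphism D E \<psi> \<psi>' \<and>
      smooth_on D \<psi> \<and> smooth_on E \<psi>' \<and> subspace (V :: 'v set) \<and> \<psi> ` (D \<inter> S) = E \<inter> V"
  have "homeomorphism D D (\<lambda>x. x) (\<lambda>x. x)" by (simp add: homeomorphism_def)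
  moreover have "(\<lambda>x. x) ` (D \<inter> S) = D \<inter> V" using S by auto
  ultimately have "?P D D (\<lambda>x. x) (\<lambda>x. x) V" using D V p S smooth_on_id[of D] by simp
  then show "\<exists>D E \<psi> \<psi>' V. ?P D E \<psi> \<psi>' V" by (intro exI)
qed

context compact_lie_chart
begin

abbreviation Mreg where "Mreg \<equiv> coadjoint_regular G U \<phi>"
abbreviation Nd where "Nd \<equiv> normal_distribution G U \<phi>"

lemma continuous_\<kappa>i: "continuous_on S \<kappa>i" by (rule linear_continuous_on[OF \<kappa>i_bounded])

lemma open_Mreg: "open Mreg"
  unfolding regular_vimage by (rule open_vimage[OF open_reg continuous_\<kappa>i])

text \<open>Write v = k + w with k in \<open>cent y\<close> and w in the image of ad x. Then v is
  orthogonal to k, being in the image of ad y, and to w, being in \<open>cent x\<close>; so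
  \<open>B v v = 0\<close>.\<close>

lemma cent_meets_im_near:
  assumes "x \<in> reg"
  obtains r where "r > 0"
    "\<And>y v. norm (y - x) < r \<Longrightarrow> v \<in> cent x \<Longrightarrow> v \<in> range (bra y) \<Longrightarrow> v = 0"
proof -
  obtain r where r: "r > 0" "\<And>y v. norm (y - x) < r \<Longrightarrow> \<exists>k w. v = k + w \<and> k \<in> cent y \<and> w \<in> range (bra x)"
    using near_decomp[OF assms] by metis
  show thesis
  proof (rule that[OF r(1)])
    fix y v assume y: "norm (y - x) < r" and v: "v \<in> cent x" "v \<in> range (bra y)"
    obtain k w where kw: "v = k + w" "k \<in> cent y" "w \<in> range (bra x)" using r(2)[OF y, of v] by blast
    have "B v v = B v (k + w)" using kw(1) by simp
    also have "\<dots> = B v k + B w v" by (simp only: B_add B_sym[of v w])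
    also have "B v k = 0" using cent_iff_orth[of k y] v(2) kw(2) by blast
    also have "B w v = 0" using cent_iff_orth[of v x] v(1) kw(3) by blast
    finally have "B v v = 0" by simp
    then show "v = 0" using B_pos[of v] by auto
  qed
qed

text \<open>Near a regular \<open>x\<close>, the operators \<open>J y = ad x \<circ> ad y + Q\<close>, where \<open>Q\<close> maps \<open>cent x\<close> injectively into
  itself and kills its orthogonal complement, are invertible, and \<open>inverse (J y)\<close> maps \<open>cent x\<close> onto
  \<open>cent y\<close>.\<close>

lemma regular_frame:
  assumes x: "x \<in> reg"
  obtains D Z where "open D" "\<kappa> x \<in> D" "D \<subseteq> Mreg" "\<And>i. smooth_on D (Z i)"
    "\<And>\<xi>. \<xi> \<in> D \<Longrightarrow> Nd \<xi> = span ((\<lambda>i::nat. Z i \<xi>) ` {..<dim (cent x)}) \<and> dim (Nd \<xi>) = dim (cent x)"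
proof -
  obtain E where E: "E \<subseteq> cent x" "independent E" "cent x \<subseteq> span E" "card E = dim (cent x)" by (rule basis_exists)
  have finE: "finite E" using E(2) by (rule finiteI_independent)
  obtain e where "bij_betw e {0..<card E} E" using ex_bij_betw_nat_finite[OF finE] by blast
  then have e: "e ` {..<dim (cent x)} = E" by (simp add: bij_betw_def E(4) atLeast0LessThan)
  define Q where "Q v = (\<Sum>b\<in>E. B v b *\<^sub>R b)" for v
  have Q_lin: "linear Q"
    by (rule linearI) (simp_all add: Q_def bilinear_ladd[OF B_bilinear] bilinear_lmul[OF B_bilinear]
        scaleR_add_left sum.distrib scaleR_sum_right)
  have Q_in: "Q v \<in> cent x" for v
    unfolding Q_def by (intro subspace_sum[OF subspace_cent] subspace_scale[OF subspace_cent]) (use E(1) in auto)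
  define J where "J y v = bra x (bra y v) + Q v" for y v
  have J_lin: "linear (J y)" for y
    unfolding J_def using linear_compose_add[OF linear_compose[OF lin lin] Q_lin] by (simp add: o_def)
  have "inj (J x)"
  proof (subst linear_injective_0[OF J_lin], intro allI impI)
    fix v assume "J x v = 0"
    \<comment> \<open>One summand of \<open>J x v\<close> lies in the image of ad x, the other in
      its kernel, so both vanish. Then v is in the kernel and, E being independent, also orthogonal
      to it.\<close>
    then have 1: "bra x (bra x v) = - Q v" by (simp add: J_def eq_neg_iff_add_eq_0)
    then have "bra x (bra x v) \<in> cent x" using Q_in subspace_neg[OF subspace_cent] by simp
    then have 2: "bra x (bra x v) = 0" by (rule cent_im_0) simp
    then have Q0: "Q v = 0" using 1 by simp
    have "\<forall>b\<in>E. B v b = 0"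
      using E(2) finE Q0 unfolding Q_def by (auto simp: dependent_finite)
    then have "\<forall>k\<in>cent x. B v k = 0" using linear_eq_0_on_span[OF B_linear, of E v] E(3) by blast
    then have "v \<in> range (bra x)" by (simp only: im_iff_orth)
    moreover have "bra x v = 0" using 2 by (intro cent_im_0[of "bra x v" x]) (auto simp: cent_def)
    ultimately show "v = 0" by (intro cent_im_0[of v x]) (auto simp: cent_def)
  qed
  then obtain \<delta> where \<delta>: "\<delta> > 0" "\<And>v. \<delta> * norm v \<le> norm (J x v)"
    using linear_inj_bounded_below_pos[OF J_lin] by blast
  obtain C where C: "C > 0" "\<And>x y. norm (bra x y) \<le> C * norm x * norm y" using br_bounded by blast
  define K where "K = C * norm x * C + 1"
  have K: "K > 0" using C(1) by (simp add: K_def add_nonneg_pos)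
  \<comment> \<open>Passing from J x to J y changes the operator by at most K times norm (y - x);
    within r1 this takes at most half of \<delta>.\<close>
  define r1 where "r1 = \<delta> / (2 * K)"
  have r1: "r1 > 0" using \<delta> K by (simp add: r1_def)
  have low: "\<delta> / 2 * norm v \<le> norm (J y v)" if y: "norm (y - x) < r1" for y v
  proof -
    have "norm (bra x (bra (y - x) v)) \<le> C * norm x * (C * norm (y - x) * norm v)"
      using C(1) by (intro order_trans[OF C(2)] mult_left_mono C(2)) auto
    also have "\<dots> \<le> K * (norm (y - x) * norm v)" by (simp add: K_def algebra_simps)
    also have "\<dots> \<le> K * (r1 * norm v)" using y K by (intro mult_left_mono mult_right_mono) auto
    also have "\<dots> = \<delta> / 2 * norm v" using K by (simp add: r1_def)
    finally have "norm (bra x (bra (y - x) v)) \<le> \<delta> / 2 * norm v" .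
    moreover have "J y v = J x v + bra x (bra (y - x) v)" by (simp add: J_def br_simps)
    then have "norm (J x v) \<le> norm (J y v) + norm (bra x (bra (y - x) v))"
      by (metis add_diff_cancel_right' norm_triangle_ineq4)
    ultimately show ?thesis using \<delta>(2)[of v] by linarith
  qed
  obtain r2 where r2: "r2 > 0"
    "\<And>y v. norm (y - x) < r2 \<Longrightarrow> v \<in> cent x \<Longrightarrow> v \<in> range (bra y) \<Longrightarrow> v = 0"
    using cent_meets_im_near[OF x] by metis
  define D where "D = \<kappa>i -` (ball x (min r1 r2) \<inter> reg)"
  have D1: "norm (\<kappa>i \<xi> - x) < r1" "norm (\<kappa>i \<xi> - x) < r2" "\<kappa>i \<xi> \<in> reg" if "\<xi> \<in> D" for \<xi>
    using that by (auto simp: D_def dist_norm norm_minus_commute)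
  have oD: "open D" unfolding D_def by (intro open_vimage open_Int open_ball open_reg continuous_\<kappa>i)
  have bb: "bounded_bilinear (\<lambda>h v. bra x (bra (\<kappa>i h) v))"
  proof -
    have "bilinear (\<lambda>h v. bra x (bra h v))"
      unfolding bilinear_def linear_iff by (simp add: br_simps)
    then have "bounded_bilinear (\<lambda>h v. bra x (bra h v))" by (simp add: bilinear_conv_bounded_bilinear)
    from bounded_bilinear.comp[OF this \<kappa>i_bounded bounded_linear_ident] show ?thesis .
  qed
  interpret F: affine_operator_family D "\<lambda>\<xi>. J (\<kappa>i \<xi>)" "\<lambda>h v. bra x (bra (\<kappa>i h) v)" "\<delta> / 2"
  proof (rule affine_operator_family.intro)
    show "open D" by (rule oD)
    show "linear (J (\<kappa>i \<xi>))" for \<xi> by (rule J_lin)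
    show "\<delta> / 2 > 0" using \<delta> by simp
    show "\<delta> / 2 * norm v \<le> norm (J (\<kappa>i \<xi>) v)" if "\<xi> \<in> D" for \<xi> v by (rule low[OF D1(1)[OF that]])
    show "bounded_bilinear (\<lambda>h v. bra x (bra (\<kappa>i h) v))" by (rule bb)
    show "J (\<kappa>i \<eta>) v = J (\<kappa>i \<xi>) v + bra x (bra (\<kappa>i (\<eta> - \<xi>)) v)" for \<xi> \<eta> v
      by (simp add: J_def linear_diff[OF bounded_linear.linear[OF \<kappa>i_bounded]] br_simps)
  qed
  define Z where "Z i \<xi> = \<kappa> (F.R \<xi> (e i))" for i \<xi>
  show thesis
  proof (rule that[of D Z])
    show "open D" by (rule oD)
    show "\<kappa> x \<in> D" using x r1 r2(1) by (simp add: D_def)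
    show "D \<subseteq> Mreg" by (auto simp: D_def regular_vimage)
    show "smooth_on D (Z i)" for i
      unfolding smooth_on_def Z_def
      by (intro allI Ck_on_bounded_linear[OF \<kappa>_bounded] F.Ck_on_R Ck_on_const)
    fix \<xi> assume \<xi>: "\<xi> \<in> D"
    let ?y = "\<kappa>i \<xi>"
    \<comment> \<open>If J y v = b with b in \<open>cent x\<close>, then [x, [y, v]] = b - Q v lies
      in both kernel and image of ad x, so it is 0. Hence [y, v] lies in \<open>cent x\<close> and
      in the image of ad y, and vanishes by the choice of r2.\<close>
    have sub: "F.R \<xi> ` E \<subseteq> cent ?y"
    proof
      fix v assume "v \<in> F.R \<xi> ` E"
      then obtain b where b: "b \<in> E" "v = F.R \<xi> b" by blast
      have "J ?y v = b" unfolding b(2) by (rule F.J_R[OF \<xi>])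
      then have 1: "bra x (bra ?y v) = b - Q v" by (simp add: J_def eq_diff_eq)
      have "b - Q v \<in> cent x" using b(1) E(1) Q_in by (intro subspace_diff[OF subspace_cent]) auto
      then have "bra x (bra ?y v) \<in> cent x" unfolding 1 .
      then have "bra x (bra ?y v) = 0" by (rule cent_im_0) simp
      then have "bra ?y v \<in> cent x" by (simp add: cent_def)
      then have "bra ?y v = 0" by (rule r2(2)[OF D1(2)[OF \<xi>]]) simp
      then show "v \<in> cent ?y" by (simp add: cent_def)
    qed
    have inj: "inj (F.R \<xi>)" by (rule inj_on_inverseI[of _ "J ?y"]) (rule F.J_R[OF \<xi>])
    have ind: "independent (F.R \<xi> ` E)"
      by (rule linear_independent_injective_image[OF F.R_linear[OF \<xi>] E(2)]) (rule inj_on_subset[OF inj], simp)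
    have card: "card (F.R \<xi> ` E) = dim (cent x)" using card_image[OF inj_on_subset[OF inj subset_UNIV], of E] E(4) by simp
    have dc: "dim (cent ?y) = dim (cent x)" by (rule reg_dim_eq[OF D1(3)[OF \<xi>] x])
    have sp: "span (F.R \<xi> ` E) = cent ?y"
      by (rule subspace_dim_equal[OF subspace_span subspace_cent span_minimal[OF sub subspace_cent]])
        (simp add: dim_eq_card_independent[OF ind] card dc)
    have "(\<lambda>i. Z i \<xi>) ` {..<dim (cent x)} = \<kappa> ` (F.R \<xi> ` E)"
      unfolding e[symmetric] by (simp add: Z_def image_image)
    then have "span ((\<lambda>i. Z i \<xi>) ` {..<dim (cent x)}) = \<kappa> ` cent ?y"
      by (simp only: linear_span_image[OF \<kappa>_linear] sp)
    then show "Nd \<xi> = span ((\<lambda>i. Z i \<xi>) ` {..<dim (cent x)}) \<and> dim (Nd \<xi>) = dim (cent x)"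
      by (simp add: normal_distribution_eq dim_injective_image[OF \<kappa>_linear \<kappa>_inj] dc)
  qed
qed

text \<open>The rank has to be one number for the whole regular set. It is read off at any regular
  element, since centralisers of regular elements share their dimension; if there is none, any
  number will do.\<close>

lemma smooth_normal_distribution: "smooth_distribution Mreg Nd"
proof (cases "reg = {}")
  case True
  then show ?thesis using open_Mreg by (simp add: smooth_distribution_def coadjoint_regular_eq)
next
  case False
  then obtain x0 where x0: "x0 \<in> reg" by blast
  show ?thesis unfolding smooth_distribution_def
  proof (intro conjI open_Mreg exI[of _ "dim (cent x0)"] ballI)
    fix p assume "p \<in> Mreg"
    then obtain x where x: "x \<in> reg" "p = \<kappa> x" by (auto simp: coadjoint_regular_eq)
    have d: "dim (cent x) = dim (cent x0)" by (rule reg_dim_eq[OF x(1) x0])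
    obtain D Z where DZ: "open D" "\<kappa> x \<in> D" "D \<subseteq> Mreg" "\<And>i. smooth_on D (Z i)"
      "\<And>\<xi>. \<xi> \<in> D \<Longrightarrow> Nd \<xi> = span ((\<lambda>i::nat. Z i \<xi>) ` {..<dim (cent x)}) \<and> dim (Nd \<xi>) = dim (cent x)"
      by (rule regular_frame[OF x(1)]) blast
    show "\<exists>D Z. open D \<and> p \<in> D \<and> D \<subseteq> Mreg \<and> (\<forall>i<dim (cent x0). smooth_on D (Z i)) \<and>
        (\<forall>q\<in>D. Nd q = span ((\<lambda>i. Z i q) ` {..<dim (cent x0)}) \<and> dim (Nd q) = dim (cent x0))"
      using DZ unfolding d x(2) by (intro exI[of _ D] exI[of _ Z]) blast
  qed
qed

lemma tangent_space_cent:
  assumes O': "open O'" and y: "y \<in> O' \<inter> cent x"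
  shows "tangent_space (O' \<inter> cent x) y = cent x"
proof (intro equalityI subsetI)
  fix v assume "v \<in> tangent_space (O' \<inter> cent x) y"
  then obtain \<gamma> where \<gamma>: "\<And>t. \<gamma> t \<in> O' \<inter> cent x" "(\<gamma> has_vector_derivative v) (at (0::real))"
    by (auto simp: tangent_space_def)
  have "bounded_linear (bra x)" using lin by (simp add: linear_conv_bounded_linear)
  from bounded_linear.has_vector_derivative[OF this \<gamma>(2)]
  have "((\<lambda>t. bra x (\<gamma> t)) has_vector_derivative bra x v) (at 0)" .
  moreover have "bra x (\<gamma> t) = 0" for t using \<gamma>(1)[of t] by (simp add: cent_def)
  ultimately have "((\<lambda>t. 0) has_vector_derivative bra x v) (at (0::real))" by simp
  then have "bra x v = 0" using vector_derivative_unique_at has_vector_derivative_const by blast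
  then show "v \<in> cent x" by (simp add: cent_def)
next
  fix v assume v: "v \<in> cent x"
  \<comment> \<open>A curve in \<open>tangent_space\<close> has to stay in the set for all times, so
    the line is replaced by its starting point wherever it leaves O'.\<close>
  define \<gamma> where "\<gamma> t = (if y + t *\<^sub>R v \<in> O' then y + t *\<^sub>R v else y)" for t :: real
  have d: "((\<lambda>t. y + t *\<^sub>R v) has_vector_derivative v) (at 0)" by (auto intro!: derivative_eq_intros)
  have "isCont (\<lambda>t. y + t *\<^sub>R v) (0::real)" by (intro continuous_intros)
  then have "((\<lambda>t. y + t *\<^sub>R v) \<longlongrightarrow> y) (nhds (0::real))" using isCont_tendsto_nhds[where f = "\<lambda>t. y + t *\<^sub>R v" and a = 0] by simp
  then have "\<forall>\<^sub>F t in nhds (0::real). y + t *\<^sub>R v \<in> O'" using O' y by (auto simp: tendsto_def)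
  then have ev: "\<forall>\<^sub>F t in nhds (0::real). y + t *\<^sub>R v = \<gamma> t" by (rule eventually_mono) (simp add: \<gamma>_def)
  have "(\<gamma> has_vector_derivative v) (at 0)"
    using d unfolding has_vector_derivative_def
    by (rule has_derivative_transform_eventually) (use ev in \<open>auto simp: eventually_nhds_conv_at\<close>)
  moreover have "\<gamma> t \<in> O' \<inter> cent x" for t
    using y v subspace_add[OF subspace_cent] subspace_scale[OF subspace_cent] by (auto simp: \<gamma>_def)
  moreover have "\<gamma> 0 = y" by (simp add: \<gamma>_def)
  ultimately show "v \<in> tangent_space (O' \<inter> cent x) y" unfolding tangent_space_def by blast
qed

text \<open>An open piece of the linear space \<open>cent x\<close> has tangent space
  \<open>cent x\<close> everywhere, and by \<open>cent_eq\<close> this is the centraliser of each of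
  its regular points.\<close>

lemma integral_manifold_cent:
  assumes x: "x \<in> reg" and O': "open O'" and S: "S = O' \<inter> cent x" "S \<subseteq> reg"
  shows "integral_manifold Mreg Nd (top_of_set (\<kappa> ` S))"
  unfolding integral_manifold_def
proof (intro conjI ballI)
  show "topspace (top_of_set (\<kappa> ` S)) \<subseteq> Mreg" using S(2) by (auto simp: coadjoint_regular_eq)
  fix p assume p: "p \<in> topspace (top_of_set (\<kappa> ` S))"
  have "submanifold (\<kappa> ` S)"
  proof (rule submanifold_subspace_Int)
    show "open (\<kappa>i -` O')" by (rule open_vimage[OF O' continuous_\<kappa>i])
    show "subspace (\<kappa> ` cent x)" by (rule linear_subspace_image[OF \<kappa>_linear subspace_cent])
    show "\<kappa> ` S = (\<kappa>i -` O') \<inter> \<kappa> ` cent x" unfolding S(1) by auto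
  qed
  moreover have "tangent_space (\<kappa> ` S) q = Nd q" if "q \<in> \<kappa> ` S" for q
  proof -
    obtain y where y: "y \<in> S" "q = \<kappa> y" using \<open>q \<in> \<kappa> ` S\<close> by blast
    have "tangent_space (\<kappa> ` S) q = \<kappa> ` tangent_space S y"
      unfolding y(2) by (rule tangent_space_image[OF \<kappa>_bounded \<kappa>i_bounded]) simp_all
    also have "tangent_space S y = cent x" using tangent_space_cent[OF O', of y x] y(1) S(1) by simp
    also have "cent x = cent y" using cent_eq[OF x, of y] y(1) S by auto
    finally show ?thesis by (simp add: y(2) normal_distribution_\<kappa>)
  qed
  ultimately show "\<exists>W. openin (top_of_set (\<kappa> ` S)) W \<and> p \<in> W \<and>
      subtopology (top_of_set (\<kappa> ` S)) W = top_of_set W \<and> submanifold W \<and> (\<forall>q\<in>W. tangent_space W q = Nd q)"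
    using p by (intro exI[of _ "\<kappa> ` S"]) (simp add: subtopology_subtopology)
qed

lemma integrable_normal_distribution: "integrable_distribution Mreg Nd"
  unfolding integrable_distribution_def
proof (intro conjI ballI smooth_normal_distribution)
  fix p assume "p \<in> Mreg"
  then obtain x where x: "x \<in> reg" "p = \<kappa> x" by (auto simp: coadjoint_regular_eq)
  have "integral_manifold Mreg Nd (top_of_set (\<kappa> ` (reg \<inter> cent x)))"
    by (rule integral_manifold_cent[OF x(1) open_reg refl]) simp
  moreover have "p \<in> topspace (top_of_set (\<kappa> ` (reg \<inter> cent x)))"
    using x by (auto simp: cent_def br_self)
  ultimately show "\<exists>\<tau>. integral_manifold Mreg Nd \<tau> \<and> p \<in> topspace \<tau>" by blast
qed

section \<open>Uniqueness and maximality of integral manifolds\<close>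

text \<open>A chart that flattens W into V joins q to a nearby point by the image of a segment in V.
  This curve stays in W, so its velocities lie in the centralisers of its points and
  \<open>cent_const_along\<close> applies.\<close>

lemma integral_manifold_cent_locally_const:
  assumes \<tau>: "integral_manifold Mreg Nd \<tau>" and q: "q \<in> topspace \<tau>"
  obtains W where "openin \<tau> W" "q \<in> W" "\<And>p. p \<in> W \<Longrightarrow> cent (\<kappa>i p) = cent (\<kappa>i q)"
proof -
  from \<tau>[unfolded integral_manifold_def, THEN conjunct2, THEN bspec, OF q]
  obtain W where "openin \<tau> W \<and> q \<in> W \<and> subtopology \<tau> W = top_of_set W \<and> submanifold W
      \<and> (\<forall>p\<in>W. tangent_space W p = Nd p)"
    by (rule exE)
  then have W: "openin \<tau> W" "q \<in> W" "subtopology \<tau> W = top_of_set W" "submanifold W"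
    "\<And>p. p \<in> W \<Longrightarrow> tangent_space W p = Nd p"
    by simp_all
  have WM: "W \<subseteq> Mreg"
    by (rule order_trans[OF openin_subset[OF W(1)] \<tau>[unfolded integral_manifold_def, THEN conjunct1]])
  then have Wreg: "\<kappa>i p \<in> reg" if "p \<in> W" for p using that by (auto simp: regular_vimage)
  \<comment> \<open>From here \<psi> is the flattening chart of W, not the inverse of the group
    chart.\<close>
  obtain D E \<psi> \<psi>' and V :: "('m \<Rightarrow>\<^sub>L real) set" where ch: "open D" "q \<in> D" "open E" "homeomorphism D E \<psi> \<psi>'"
    "smooth_on E \<psi>'" "subspace V" "\<psi> ` (D \<inter> W) = E \<inter> V"
    using W(4)[unfolded submanifold_def, rule_format, OF W(2)] by blast
  have inv1: "\<psi>' (\<psi> p) = p" if "p \<in> D" for p using ch(4) that by (simp add: homeomorphism_def)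
  have param_in: "\<psi>' u \<in> D \<inter> W" if u: "u \<in> E \<inter> V" for u
  proof -
    obtain p where "p \<in> D \<inter> W" "u = \<psi> p" using u ch(7) by blast
    then show ?thesis using inv1 by auto
  qed
  have "Ck_on (Suc 0) E \<psi>'" using ch(5) by (simp only: smooth_on_def)
  then obtain g where g: "\<And>e. e \<in> E \<Longrightarrow> (\<psi>' has_derivative g e) (at e)" "\<And>v. continuous_on E (\<lambda>e. g e v)" by auto
  obtain r where r: "r > 0"
    "\<And>al al' M b. (\<And>s. 0 \<le> s \<Longrightarrow> s \<le> b \<Longrightarrow> (al has_vector_derivative al' s) (at s) \<and> al' s \<in> cent (al s)
        \<and> al s \<in> reg \<and> norm (al s - \<kappa>i q) < r \<and> norm (al' s) \<le> M) \<Longrightarrow> 0 \<le> b \<Longrightarrow> cent (al b) = cent (al 0)"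
    using cent_const_along[OF Wreg[OF W(2)]] by metis
  let ?base = "\<psi> q"
  have e0: "?base \<in> E \<inter> V" using ch(2,7) W(2) by blast
  have "isCont (\<lambda>e. \<kappa>i (\<psi>' e)) ?base"
    using bounded_linear.isCont[OF \<kappa>i_bounded has_derivative_continuous[OF g(1)]] e0 by auto
  then have "((\<lambda>e. \<kappa>i (\<psi>' e)) \<longlongrightarrow> \<kappa>i q) (nhds ?base)"
    using isCont_tendsto_nhds[where f = "\<lambda>e. \<kappa>i (\<psi>' e)" and a = ?base] inv1[OF ch(2)] by simp
  then have "\<forall>\<^sub>F e in nhds ?base. dist (\<kappa>i (\<psi>' e)) (\<kappa>i q) < r" using r(1) by (rule tendstoD)
  moreover have "\<forall>\<^sub>F e in nhds ?base. e \<in> E" using ch(3) e0 by (auto simp: eventually_nhds)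
  ultimately have "\<forall>\<^sub>F e in nhds ?base. e \<in> E \<and> dist (\<kappa>i (\<psi>' e)) (\<kappa>i q) < r" by (simp add: eventually_conj_iff)
  then obtain \<epsilon> where \<epsilon>: "\<epsilon> > 0" "\<And>e. dist e ?base < \<epsilon> \<Longrightarrow> e \<in> E \<and> dist (\<kappa>i (\<psi>' e)) (\<kappa>i q) < r"
    unfolding eventually_nhds_metric by blast
  \<comment> \<open>A chart ball cut down to W is open in \<tau>, because W is \<tau>-open and
    carries the induced topology.\<close>
  let ?W = "{p \<in> D. \<psi> p \<in> ball ?base \<epsilon>} \<inter> W"
  have "openin (top_of_set D) (D \<inter> \<psi> -` ball ?base \<epsilon>)"
    using ch(4) by (intro continuous_openin_preimage_gen) (auto simp: homeomorphism_def)
  then have "open (D \<inter> \<psi> -` ball ?base \<epsilon>)" using ch(1) by (simp add: openin_open_eq)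
  moreover have "{p \<in> D. \<psi> p \<in> ball ?base \<epsilon>} = D \<inter> \<psi> -` ball ?base \<epsilon>" by auto
  ultimately have "openin (top_of_set W) (W \<inter> {p \<in> D. \<psi> p \<in> ball ?base \<epsilon>})" by (simp add: openin_open_Int)
  then have "openin (subtopology \<tau> W) ?W" using W(3) by (simp add: Int_commute)
  then have oW: "openin \<tau> ?W" by (rule openin_trans_full[OF _ W(1)])
  show thesis
  proof (rule that[OF oW])
    show "q \<in> ?W" using ch(2) W(2) \<epsilon>(1) by simp
    fix p assume p: "p \<in> ?W"
    define v where "v = \<psi> p - ?base"
    have "\<psi> p \<in> E \<inter> V" using p ch(7) by blast
    then have vV: "v \<in> V" using e0 subspace_diff[OF ch(6)] by (simp add: v_def)
    have nv: "norm v < \<epsilon>" using p by (auto simp: v_def dist_norm norm_minus_commute)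
    have seg: "?base + s *\<^sub>R v \<in> E \<inter> V" "dist (\<kappa>i (\<psi>' (?base + s *\<^sub>R v))) (\<kappa>i q) < r"
      if "0 \<le> s" "s \<le> 1" for s
    proof -
      have "s * norm v \<le> 1 * norm v" using that by (intro mult_right_mono) auto
      then have d: "dist (?base + s *\<^sub>R v) ?base < \<epsilon>" using nv that by (simp add: dist_norm)
      show "?base + s *\<^sub>R v \<in> E \<inter> V"
        using \<epsilon>(2)[OF d] e0 vV subspace_add[OF ch(6)] subspace_scale[OF ch(6)] by simp
      show "dist (\<kappa>i (\<psi>' (?base + s *\<^sub>R v))) (\<kappa>i q) < r" using \<epsilon>(2)[OF d] by simp
    qed
    define al where "al s = \<kappa>i (\<psi>' (?base + s *\<^sub>R v))" for s
    define al' where "al' s = \<kappa>i (g (?base + s *\<^sub>R v) v)" for s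
    have "continuous_on {0..1::real} al'"
      unfolding al'_def
    proof (rule bounded_linear.continuous_on[OF \<kappa>i_bounded])
      show "continuous_on {0..1} (\<lambda>s. g (?base + s *\<^sub>R v) v)"
        by (rule continuous_on_compose2[OF g(2)[of v], of _ "\<lambda>s. ?base + s *\<^sub>R v"])
          (use seg(1) in \<open>auto intro!: continuous_intros\<close>)
    qed
    \<comment> \<open>\<open>cent_const_along\<close> asks for a uniform bound on the speed;
      continuity of the derivative on the compact interval supplies it.\<close>
    then have "bounded (al' ` {0..1})" using compact_continuous_image compact_Icc compact_imp_bounded by blast
    then obtain K where "\<forall>s\<in>{0..1}. norm (al' s) \<le> K" by (auto simp: bounded_iff)
    then have K: "\<And>s. 0 \<le> s \<Longrightarrow> s \<le> 1 \<Longrightarrow> norm (al' s) \<le> K" by simp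
    have "cent (al 1) = cent (al 0)"
    proof (rule r(2)[of 1 al al' K])
      fix s :: real assume s: "0 \<le> s" "s \<le> 1"
      let ?pt = "?base + s *\<^sub>R v"
      have eE: "?pt \<in> E \<inter> V" by (rule seg(1)[OF s])
      have der: "((\<lambda>t. \<psi>' (?base + t *\<^sub>R v)) has_vector_derivative g ?pt v) (at s)"
      proof -
        have "((\<lambda>t. ?base + t *\<^sub>R v) has_derivative (\<lambda>t. t *\<^sub>R v)) (at s)" by (auto intro!: derivative_eq_intros)
        from has_derivative_compose[OF this g(1)] eE
        have "((\<lambda>t. \<psi>' (?base + t *\<^sub>R v)) has_derivative (\<lambda>t. g ?pt (t *\<^sub>R v))) (at s)" by blast
        moreover have "g ?pt (t *\<^sub>R v) = t *\<^sub>R g ?pt v" for t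
          using linear_scale[OF has_derivative_linear[OF g(1)]] eE by blast
        ultimately show ?thesis by (simp add: has_vector_derivative_def)
      qed
      have ald: "(al has_vector_derivative al' s) (at s)"
        unfolding al_def al'_def by (rule bounded_linear.has_vector_derivative[OF \<kappa>i_bounded der])
      have inW: "\<psi>' ?pt \<in> W" using param_in[OF eE] by blast
      have "g ?pt v \<in> tangent_space W (\<psi>' ?pt)"
      proof -
        \<comment> \<open>The segment is shifted so that time s becomes 0, and outside E it is
          replaced by a constant, since a curve in \<open>tangent_space\<close> must run in W for
          all times.\<close>
        define c where "c t = (if ?base + (s + t) *\<^sub>R v \<in> E then \<psi>' (?base + (s + t) *\<^sub>R v) else \<psi>' ?pt)" for t
        have cW: "c t \<in> W" for t
        proof (cases "?base + (s + t) *\<^sub>R v \<in> E")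
          case True
          have "?base + (s + t) *\<^sub>R v \<in> V" using e0 vV subspace_add[OF ch(6)] subspace_scale[OF ch(6)] by simp
          then show ?thesis using True param_in by (simp add: c_def)
        next
          case False then show ?thesis using inW by (simp add: c_def)
        qed
        have "((\<lambda>t. s + t) has_vector_derivative 1) (at 0)" by (auto intro!: derivative_eq_intros)
        from vector_diff_chain_at[OF this, of "\<lambda>t. \<psi>' (?base + t *\<^sub>R v)" "g ?pt v"] der
        have 1: "((\<lambda>t. \<psi>' (?base + (s + t) *\<^sub>R v)) has_vector_derivative g ?pt v) (at 0)" by (simp add: o_def)
        have "isCont (\<lambda>t. ?base + (s + t) *\<^sub>R v) 0" by (intro continuous_intros)
        then have "((\<lambda>t. ?base + (s + t) *\<^sub>R v) \<longlongrightarrow> ?pt) (nhds 0)"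
          using isCont_tendsto_nhds[where f = "\<lambda>t. ?base + (s + t) *\<^sub>R v" and a = 0] by simp
        then have "\<forall>\<^sub>F t in nhds 0. ?base + (s + t) *\<^sub>R v \<in> E" using ch(3) eE by (auto simp: tendsto_def)
        then have ev: "\<forall>\<^sub>F t in nhds 0. \<psi>' (?base + (s + t) *\<^sub>R v) = c t" by (rule eventually_mono) (simp add: c_def)
        have "(c has_vector_derivative g ?pt v) (at 0)"
          using 1 unfolding has_vector_derivative_def
          by (rule has_derivative_transform_eventually) (use ev in \<open>auto simp: eventually_nhds_conv_at\<close>)
        moreover have "c 0 = \<psi>' ?pt" by (simp add: c_def)
        ultimately show ?thesis unfolding tangent_space_def using cW by blast
      qed
      then have "g ?pt v \<in> \<kappa> ` cent (al s)" using W(5)[OF inW] by (simp add: normal_distribution_eq al_def)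
      then have "al' s \<in> cent (al s)" unfolding al'_def by auto
      moreover have "norm (al s - \<kappa>i q) < r" using seg(2)[OF s] by (simp add: al_def dist_norm)
      moreover have "al s \<in> reg" using Wreg[OF inW] by (simp add: al_def)
      ultimately show "(al has_vector_derivative al' s) (at s) \<and> al' s \<in> cent (al s)
        \<and> al s \<in> reg \<and> norm (al s - \<kappa>i q) < r \<and> norm (al' s) \<le> K" using ald K[OF s] by blast
    qed simp
    moreover have "al 1 = \<kappa>i p" using inv1 p by (simp add: al_def v_def)
    moreover have "al 0 = \<kappa>i q" using inv1[OF ch(2)] by (simp add: al_def)
    ultimately show "cent (\<kappa>i p) = cent (\<kappa>i q)" by simp
  qed
qed

text \<open>Locally \<tau> is the induced topology, so it can only be finer. Connectedness for
  \<tau> thus passes to the underlying set.\<close>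

lemma integral_manifold_continuous:
  assumes "integral_manifold Mreg Nd \<tau>"
  shows "continuous_map \<tau> euclidean (\<lambda>q. q)"
  unfolding continuous_map_def
proof (intro conjI allI impI)
  fix O' :: "('m \<Rightarrow>\<^sub>L real) set" assume O': "openin euclidean O'"
  show "openin \<tau> {q \<in> topspace \<tau>. q \<in> O'}"
  proof (subst openin_subopen, intro ballI)
    fix q assume q: "q \<in> {q \<in> topspace \<tau>. q \<in> O'}"
    from assms[unfolded integral_manifold_def, THEN conjunct2, THEN bspec, of q] q
    obtain W where W: "openin \<tau> W" "q \<in> W" "subtopology \<tau> W = top_of_set W" by auto
    have "openin (subtopology \<tau> W) (W \<inter> O')" using O' unfolding W(3) by (simp add: openin_open_Int)
    then have "openin \<tau> (W \<inter> O')" by (rule openin_trans_full[OF _ W(1)])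
    then show "\<exists>T. openin \<tau> T \<and> q \<in> T \<and> T \<subseteq> {q \<in> topspace \<tau>. q \<in> O'}"
      using q W(2) openin_subset[OF W(1)] by (intro exI[of _ "W \<inter> O'"]) auto
  qed
qed simp

text \<open>The centraliser is locally constant, hence constant on a connected integral manifold,
  and every point belongs to its own centraliser.\<close>

lemma connected_integral_manifold_subset:
  assumes \<tau>: "integral_manifold Mreg Nd \<tau>" "connected_space \<tau>" and x: "\<kappa> x \<in> topspace \<tau>"
  shows "topspace \<tau> \<subseteq> \<kappa> ` (reg \<inter> cent x)" and "connected (topspace \<tau>)"
proof -
  \<comment> \<open>Taken for an arbitrary predicate, so that it yields both the set where the
    centraliser is \<open>cent x\<close> and the complement of that set as open.\<close>
  have loc: "openin \<tau> {q \<in> topspace \<tau>. P (cent (\<kappa>i q))}" for P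
  proof (subst openin_subopen, intro ballI)
    fix q assume q: "q \<in> {q \<in> topspace \<tau>. P (cent (\<kappa>i q))}"
    then have qt: "q \<in> topspace \<tau>" by simp
    obtain W where W: "openin \<tau> W" "q \<in> W" "\<And>p. p \<in> W \<Longrightarrow> cent (\<kappa>i p) = cent (\<kappa>i q)"
      using integral_manifold_cent_locally_const[OF \<tau>(1) qt] by metis
    have "W \<subseteq> {q \<in> topspace \<tau>. P (cent (\<kappa>i q))}"
    proof
      fix p assume p: "p \<in> W"
      have "P (cent (\<kappa>i p))" unfolding W(3)[OF p] using q by simp
      then show "p \<in> {q \<in> topspace \<tau>. P (cent (\<kappa>i q))}" using subsetD[OF openin_subset[OF W(1)] p] by simp
    qed
    then show "\<exists>T. openin \<tau> T \<and> q \<in> T \<and> T \<subseteq> {q \<in> topspace \<tau>. P (cent (\<kappa>i q))}"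
      using W(1,2) by blast
  qed
  let ?S = "{q \<in> topspace \<tau>. cent (\<kappa>i q) = cent x}"
  have op: "openin \<tau> ?S" by (rule loc)
  have "openin \<tau> {q \<in> topspace \<tau>. cent (\<kappa>i q) \<noteq> cent x}" by (rule loc)
  moreover have "topspace \<tau> - ?S = {q \<in> topspace \<tau>. cent (\<kappa>i q) \<noteq> cent x}" by blast
  ultimately have cl: "closedin \<tau> ?S" by (simp add: closedin_def)
  have "?S = {} \<or> ?S = topspace \<tau>" using \<tau>(2) op cl unfolding connected_space_clopen_in by blast
  moreover have "\<kappa> x \<in> ?S" using x by simp
  ultimately have all: "?S = topspace \<tau>" by blast
  show "topspace \<tau> \<subseteq> \<kappa> ` (reg \<inter> cent x)"
  proof
    fix q assume q: "q \<in> topspace \<tau>"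
    then have "cent (\<kappa>i q) = cent x" using all by blast
    then have "\<kappa>i q \<in> cent x" by (metis (mono_tags) br_self cent_def mem_Collect_eq)
    moreover have "\<kappa>i q \<in> reg" using \<tau>(1) q unfolding integral_manifold_def regular_vimage by blast
    ultimately show "q \<in> \<kappa> ` (reg \<inter> cent x)" by (intro image_eqI[of _ _ "\<kappa>i q"]) simp_all
  qed
  have "connectedin \<tau> (topspace \<tau>)" using \<tau>(2) by (simp add: connectedin_topspace)
  from connectedin_continuous_map_image[OF integral_manifold_continuous[OF \<tau>(1)] this]
  show "connected (topspace \<tau>)" by simp
qed

text \<open>The regular part is \<open>reg \<inter> cent x\<close>, open in a linear space and so
  locally connected; its component C is therefore open in \<open>cent x\<close> and an integral
  manifold. A competitor through the same point is a connected subset of the regular part, hence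
  lies in the component C.\<close>

lemma weyl_chamber_maximal:
  assumes T: "maximal_torus G X T" and C: "C \<in> components (regular_part G X U \<phi> T)" and x: "x \<in> C"
  shows "maximal_integral_manifold_at Mreg Nd (top_of_set (\<kappa> ` C)) (\<kappa> x)"
proof -
  have rp: "regular_part G X U \<phi> T = subgroup_lie_algebra G X \<phi> T \<inter> reg"
    by (auto simp: regular_part_def \<kappa>_regular)
  have xr: "x \<in> subgroup_lie_algebra G X \<phi> T" "x \<in> reg" using in_components_subset[OF C] x rp by auto
  have rp': "regular_part G X U \<phi> T = reg \<inter> cent x"
    unfolding rp maximal_torus_lie_algebra[OF T xr] by blast
  have "locally connected (cent x)"
    by (rule convex_imp_locally_connected[OF subspace_imp_convex[OF subspace_cent]])
  moreover have "openin (top_of_set (cent x)) (reg \<inter> cent x)"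
    by (subst Int_commute) (rule openin_open_Int[OF open_reg])
  ultimately have lc: "locally connected (reg \<inter> cent x)" by (rule locally_open_subset)
  have "openin (top_of_set (reg \<inter> cent x)) C"
    using openin_components_locally_connected[OF lc] C rp' by simp
  then obtain O' where O': "open O'" "C = (reg \<inter> cent x) \<inter> O'" by (auto simp: openin_open)
  have im: "integral_manifold Mreg Nd (top_of_set (\<kappa> ` C))"
    by (rule integral_manifold_cent[OF xr(2), of "O' \<inter> reg"]) (use O' open_reg in auto)
  have "connected C" by (rule in_components_connected[OF C])
  then have "connected (\<kappa> ` C)"
    by (rule connected_continuous_image[OF linear_continuous_on[OF \<kappa>_bounded]])
  then have cs: "connected_space (top_of_set (\<kappa> ` C))" by (simp add: connected_space_subtopology)
  have "topspace \<tau> \<subseteq> \<kappa> ` C"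
    if \<tau>: "integral_manifold Mreg Nd \<tau>" "connected_space \<tau>" "\<kappa> x \<in> topspace \<tau>" for \<tau>
  proof -
    note sub = connected_integral_manifold_subset[OF \<tau>]
    have "connected (\<kappa>i ` topspace \<tau>)" by (rule connected_continuous_image[OF continuous_\<kappa>i sub(2)])
    moreover have "\<kappa>i ` topspace \<tau> \<subseteq> regular_part G X U \<phi> T"
    proof
      fix y assume "y \<in> \<kappa>i ` topspace \<tau>"
      then obtain z where "z \<in> reg \<inter> cent x" "y = \<kappa>i (\<kappa> z)" using sub(1) by blast
      then show "y \<in> regular_part G X U \<phi> T" by (simp add: rp')
    qed
    moreover have "x \<in> C \<inter> \<kappa>i ` topspace \<tau>" using x \<tau>(3) by (auto intro: image_eqI[of _ _ "\<kappa> x"])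
    ultimately have "\<kappa>i ` topspace \<tau> \<subseteq> C" by (intro components_maximal[OF C]) auto
    then show ?thesis by (metis \<kappa>_\<kappa>i image_eqI image_subset_iff subsetI)
  qed
  then show ?thesis unfolding maximal_integral_manifold_at_def using im cs x by auto
qed

end

theorem corollary4:
  fixes G :: "('g, 'b) monoid_scheme"
    and X :: "'g topology"
    and A :: "('g set \<times> ('g \<Rightarrow> 'm::euclidean_space)) set"
    and U :: "'g set" and \<phi> :: "'g \<Rightarrow> 'm"
  assumes "lie_group G X A" and "compact_space X" and "connected_space X"
    and "(U, \<phi>) \<in> A" and "\<one>\<^bsub>G\<^esub> \<in> U"
    and "semisimple_bracket (lie_bracket G U \<phi>)"
  shows "integrable_distribution (coadjoint_regular G U \<phi>) (normal_distribution G U \<phi>) \<and>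
    (\<forall>T. maximal_torus G X T \<longrightarrow>
      (\<forall>C \<in> components (regular_part G X U \<phi> T). \<forall>x\<in>C.
        maximal_integral_manifold_at (coadjoint_regular G U \<phi>) (normal_distribution G U \<phi>)
          (top_of_set (killing_dual G U \<phi> ` C)) (killing_dual G U \<phi> x)))"
proof -
  interpret compact_lie_chart G X A U \<phi>
    using assms by unfold_locales
  show ?thesis using integrable_normal_distribution weyl_chamber_maximal by blast
qed

end
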